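(* Let $0<\alpha_2<\alpha_1<1$, $c_1,c_2\ge0$, $c_1+c_2=1$. The mean queue length $\mathcal M^{\alpha_1,\alpha_2}(t)$ of the mixed time-changed Erlang queue solves, for $t>0$, the fractional differential equation $$\Big(c_1\frac{\mathrm d^{\alpha_1}}{\mathrm dt^{\alpha_1}}+c_2\frac{\mathrm d^{\alpha_2}}{\mathrm dt^{\alpha_2}}\Big)\mathcal M^{\alpha_1,\alpha_2}(t)=k(\lambda-\mu)+k\mu\,p_0^{\alpha_1,\alpha_2}(t),$$ with initial condition $\mathcal M^{\alpha_1,\alpha_2}(0)=0$, where $\frac{\mathrm d^{\alpha}}{\mathrm dt^{\alpha}}$ is the Caputo fractional derivative of order $\alpha$.
   Context: Parameters: $\lambda>0$, $\mu>0$, $k\in\mathbb N=\{1,2,\dots\}$. Erlang queue: single-server queue with Poisson arrivals of rate $\lambda$, each service consisting of $k$ successive phases, each exponential with parameter $k\mu$, all independent. $\mathcal Q(t)=(\mathcal N(t),\mathcal S(t))$, where $\mathcal N(t)$ is the number of customers in the system and $\mathcal S(t)$ is the phase of the customer being served if $\mathcal N(t)>0$ (phases are counted down: service starts at phase $k$ and ends upon completion of phase $1$), with $\mathcal S(t)=0$ if $\mathcal N(t)=0$. Thus $\mathcal Q$ is the continuous-time Markov chain on $\mathcal H_0=\mathcal H\cup\{(0,0)\}$, $\mathcal H=\{(n,s)\in\mathbb N\times\mathbb N: s\le k\}$, with $\mathcal Q(0)=(0,0)$ and transition rates: $(0,0)\to(1,k)$ at rate $\lambda$; $(n,s)\to(n+1,s)$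 at rate $\lambda$; $(n,s)\to(n,s-1)$ at rate $k\mu$ if $s\ge2$; $(n,1)\to(n-1,k)$ at rate $k\mu$ if $n\ge2$; $(1,1)\to(0,0)$ at rate $k\mu$. Inverse mixed stable subordinator: $\{D_{\alpha_1,\alpha_2}(t)\}_{t\ge0}$ is the nondecreasing Lévy process (started at $0$) with $\mathbb E(e^{-zD_{\alpha_1,\alpha_2}(t)})=e^{-t(c_1z^{\alpha_1}+c_2z^{\alpha_2})}$, $z>0$; $Y_{\alpha_1,\alpha_2}(t)=\inf\{s\ge0:D_{\alpha_1,\alpha_2}(s)>t\}$, $t>0$, $Y_{\alpha_1,\alpha_2}(0)=0$. Mixed time-changed Erlang queue: $\mathcal Q^{\alpha_1,\alpha_2}(t)=\mathcal Q(Y_{\alpha_1,\alpha_2}(t))$, with $\mathcal Q$ and $Y_{\alpha_1,\alpha_2}$ independent; $p_0^{\alpha_1,\alpha_2}(t)=\Pr(\mathcal Q^{\alpha_1,\alpha_2}(t)=(0,0)\mid \mathcal Q^{\alpha_1,\alpha_2}(0)=(0,0))$. Queue length process (in number of phases): $\mathcal L^{\alpha_1,\alpha_2}(t)=g_k(\mathcal Q^{\alpha_1,\alpha_2}(t))$, where $g_k:\mathcal H_0\to\mathbb N\cup\{0\}$ is the bijection $g_k(n,s)=k(n-1)+s$ for $(n,s)\in\mathcal H$, $g_k(0,0)=0$. Mean queue length: $\mathcal M^{\alpha_1,\alpha_2}(t)=\mathbb E(\mathcal L^{\alpha_1,\alpha_2}(t)\mid\mathcal L^{\alpha_1,\alpha_2}(0)=0)$.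 Caputo derivative for $0<\alpha<1$: $\frac{\mathrm d^\alpha}{\mathrm dt^\alpha}g(t)=\frac1{\Gamma(1-\alpha)}\int_0^t(t-y)^{-\alpha}g'(y)\,\mathrm dy$. *)

theory Defs
  imports "HOL-Probability.Probability"
begin

definition transition_function :: "'s set \<Rightarrow> (real \<Rightarrow> 's \<Rightarrow> 's pmf) \<Rightarrow> bool" where
  "transition_function S P \<longleftrightarrow>
     (\<forall>t\<ge>0. \<forall>x\<in>S. set_pmf (P t x) \<subseteq> S) \<and>
     (\<forall>x\<in>S. P 0 x = return_pmf x) \<and>
     (\<forall>s\<ge>0. \<forall>t\<ge>0. \<forall>x\<in>S. P (s + t) x = bind_pmf (P s x) (P t))"

text \<open>Infinitesimal description: as \<open>h\<close> decreases to \<open>0\<close>, the chain moves from \<open>x\<close> to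
  \<open>y \<noteq> x\<close> with probability \<open>q x y * h + o(h)\<close>, and leaves \<open>x\<close> with probability
  \<open>(\<Sum>y\<noteq>x. q x y) * h + o(h)\<close>. The diagonal of \<open>q\<close> is never used.\<close>

definition has_transition_rates ::
    "'s set \<Rightarrow> (real \<Rightarrow> 's \<Rightarrow> 's pmf) \<Rightarrow> ('s \<Rightarrow> 's \<Rightarrow> real) \<Rightarrow> bool" where
  "has_transition_rates S P q \<longleftrightarrow>
     (\<forall>x\<in>S. \<forall>y\<in>S. x \<noteq> y \<longrightarrow> ((\<lambda>h. pmf (P h x) y / h) \<longlongrightarrow> q x y) (at_right 0)) \<and>
     (\<forall>x\<in>S. ((\<lambda>h. (1 - pmf (P h x) x) / h) \<longlongrightarrow> (\<Sum>\<^sub>\<infinity>y\<in>S - {x}. q x y)) (at_right 0))"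

text \<open>Processes are indexed by \<open>real\<close>; only times \<open>t \<ge> 0\<close> matter. Paths are
  right-continuous for the discrete topology on the states, that is, constant for a positive time
  after each time.\<close>

definition markov_chain_with_rates ::
    "'w measure \<Rightarrow> 's set \<Rightarrow> ('s \<Rightarrow> 's \<Rightarrow> real) \<Rightarrow> 's \<Rightarrow> (real \<Rightarrow> 'w \<Rightarrow> 's) \<Rightarrow> bool" where
  "markov_chain_with_rates M S q x0 X \<longleftrightarrow>
     (\<forall>t\<ge>0. X t \<in> measurable M (count_space UNIV)) \<and>
     (\<forall>t\<ge>0. \<forall>\<omega>\<in>space M. X t \<omega> \<in> S) \<and>
     (\<forall>t\<ge>0. \<forall>\<omega>\<in>space M. \<forall>\<^sub>F u in at_right t. X u \<omega> = X t \<omega>) \<and>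
     (AE \<omega> in M. X 0 \<omega> = x0) \<and>
     (\<exists>P. transition_function S P \<and> has_transition_rates S P q \<and>
        (\<forall>(n::nat) (t::nat \<Rightarrow> real) (x::nat \<Rightarrow> 's) u y.
           0 \<le> t 0 \<longrightarrow> (\<forall>i<n. t i \<le> t (Suc i)) \<longrightarrow> t n \<le> u \<longrightarrow>
           measure M {\<omega>\<in>space M. \<forall>i\<le>n. X (t i) \<omega> = x i} \<noteq> 0 \<longrightarrow>
           \<P>(\<omega> in M. X u \<omega> = y \<bar> \<forall>i\<le>n. X (t i) \<omega> = x i) = pmf (P (u - t n) (x n)) y))"

definition erlang_states :: "nat \<Rightarrow> (nat \<times> nat) set" where
  "erlang_states k = insert (0, 0) {(n, s). 1 \<le> n \<and> 1 \<le> s \<and> s \<le> k}"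

definition erlang_rate :: "real \<Rightarrow> real \<Rightarrow> nat \<Rightarrow> nat \<times> nat \<Rightarrow> nat \<times> nat \<Rightarrow> real" where
  "erlang_rate lam mu k x y =
     (case x of (n, s) \<Rightarrow>
        if n = 0 then (if y = (1, k) then lam else 0)
        else if y = (n + 1, s) then lam
        else if 2 \<le> s \<and> y = (n, s - 1) then real k * mu
        else if s = 1 \<and> 2 \<le> n \<and> y = (n - 1, k) then real k * mu
        else if s = 1 \<and> n = 1 \<and> y = (0, 0) then real k * mu
        else 0)"

definition erlang_queue ::
    "'w measure \<Rightarrow> real \<Rightarrow> real \<Rightarrow> nat \<Rightarrow> (real \<Rightarrow> 'w \<Rightarrow> nat \<times> nat) \<Rightarrow> bool" where
  "erlang_queue M lam mu k Q \<longleftrightarrow>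
     markov_chain_with_rates M (erlang_states k) (erlang_rate lam mu k) (0, 0) Q"

text \<open>Maps \<open>erlang_states k\<close> bijectively onto the natural numbers; the value is the number of
  phases still to be completed by all customers present. The subtraction is exact as \<open>n \<ge> 1\<close> there.\<close>

definition phase_count :: "nat \<Rightarrow> nat \<times> nat \<Rightarrow> nat" where
  "phase_count k x = (case x of (n, s) \<Rightarrow> if n = 0 then 0 else k * (n - 1) + s)"

definition levy_process :: "'w measure \<Rightarrow> (real \<Rightarrow> 'w \<Rightarrow> real) \<Rightarrow> bool" where
  "levy_process M X \<longleftrightarrow>
     (\<forall>t\<ge>0. X t \<in> borel_measurable M) \<and>
     (AE \<omega> in M. X 0 \<omega> = 0) \<and>
     (\<forall>(n::nat) (t::nat \<Rightarrow> real). 0 \<le> t 0 \<longrightarrow> (\<forall>i<n. t i \<le> t (Suc i)) \<longrightarrow>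
        prob_space.indep_vars M (\<lambda>_. borel) (\<lambda>i \<omega>. X (t (Suc i)) \<omega> - X (t i) \<omega>) {..<n}) \<and>
     (\<forall>s\<ge>0. \<forall>t\<ge>0. distr M borel (\<lambda>\<omega>. X (s + t) \<omega> - X s \<omega>) = distr M borel (X t)) \<and>
     (\<forall>\<omega>\<in>space M. \<forall>t\<ge>0. continuous (at_right t) (\<lambda>u. X u \<omega>)) \<and>
     (\<forall>\<omega>\<in>space M. \<forall>t>0. \<exists>l. ((\<lambda>u. X u \<omega>) \<longlongrightarrow> l) (at_left t))"

definition mixed_stable_subordinator ::
    "'w measure \<Rightarrow> real \<Rightarrow> real \<Rightarrow> real \<Rightarrow> real \<Rightarrow> (real \<Rightarrow> 'w \<Rightarrow> real) \<Rightarrow> bool" where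
  "mixed_stable_subordinator M c1 \<alpha>1 c2 \<alpha>2 D \<longleftrightarrow>
     levy_process M D \<and>
     (\<forall>\<omega>\<in>space M. mono_on {0..} (\<lambda>t. D t \<omega>)) \<and>
     (\<forall>t\<ge>0. \<forall>z>0. (\<integral>\<omega>. exp (- z * D t \<omega>) \<partial>M)
        = exp (- t * (c1 * z powr \<alpha>1 + c2 * z powr \<alpha>2)))"

text \<open>The set below is nonempty outside a null event. On that event the value is set to \<open>0\<close>,
  because \<open>Inf {} :: real\<close> is unspecified and might be negative.\<close>

definition first_passage :: "(real \<Rightarrow> 'w \<Rightarrow> real) \<Rightarrow> real \<Rightarrow> 'w \<Rightarrow> real" where
  "first_passage D t \<omega> =
     (if t = 0 \<or> {s. 0 \<le> s \<and> D s \<omega> > t} = {} then 0 else Inf {s. 0 \<le> s \<and> D s \<omega> > t})"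

text \<open>Independence of the two processes as random elements of the path spaces. The library's
  \<open>indep_var\<close> needs both values in one type, hence the generated sigma-algebras.\<close>

definition process_events :: "'w measure \<Rightarrow> 's measure \<Rightarrow> (real \<Rightarrow> 'w \<Rightarrow> 's) \<Rightarrow> 'w set set" where
  "process_events M N X =
     sets (vimage_algebra (space M) (\<lambda>\<omega>. \<lambda>t\<in>{0..}. X t \<omega>) (\<Pi>\<^sub>M t\<in>{0..}. N))"

definition independent_processes ::
    "'w measure \<Rightarrow> (real \<Rightarrow> 'w \<Rightarrow> nat \<times> nat) \<Rightarrow> (real \<Rightarrow> 'w \<Rightarrow> real) \<Rightarrow> bool" where
  "independent_processes M Q Y \<longleftrightarrow>
     prob_space.indep_set M (process_events M (count_space UNIV) Q) (process_events M borel Y)"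

definition time_changed :: "(real \<Rightarrow> 'w \<Rightarrow> 's) \<Rightarrow> (real \<Rightarrow> 'w \<Rightarrow> real) \<Rightarrow> real \<Rightarrow> 'w \<Rightarrow> 's" where
  "time_changed Q Y t \<omega> = Q (Y t \<omega>) \<omega>"

definition queue_length :: "nat \<Rightarrow> (real \<Rightarrow> 'w \<Rightarrow> nat \<times> nat) \<Rightarrow> real \<Rightarrow> 'w \<Rightarrow> nat" where
  "queue_length k X t \<omega> = phase_count k (X t \<omega>)"

definition empty_prob :: "'w measure \<Rightarrow> (real \<Rightarrow> 'w \<Rightarrow> nat \<times> nat) \<Rightarrow> real \<Rightarrow> real" where
  "empty_prob M X t = \<P>(\<omega> in M. X t \<omega> = (0, 0) \<bar> X 0 \<omega> = (0, 0))"

definition cond_mean :: "'w measure \<Rightarrow> ('w \<Rightarrow> real) \<Rightarrow> ('w \<Rightarrow> bool) \<Rightarrow> real" where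
  "cond_mean M Z A =
     (\<integral>\<omega>\<in>{\<omega>\<in>space M. A \<omega>}. Z \<omega> \<partial>M) / measure M {\<omega>\<in>space M. A \<omega>}"

definition mean_queue_length ::
    "'w measure \<Rightarrow> nat \<Rightarrow> (real \<Rightarrow> 'w \<Rightarrow> nat \<times> nat) \<Rightarrow> real \<Rightarrow> real" where
  "mean_queue_length M k X t =
     cond_mean M (\<lambda>\<omega>. real (queue_length k X t \<omega>)) (\<lambda>\<omega>. queue_length k X 0 \<omega> = 0)"

definition caputo_derivative :: "real \<Rightarrow> (real \<Rightarrow> real) \<Rightarrow> real \<Rightarrow> real" where
  "caputo_derivative \<alpha> g t =
     1 / Gamma (1 - \<alpha>) * (LINT y:{0<..<t}|lborel. (t - y) powr (- \<alpha>) * deriv g y)"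

text \<open>The formula above is total; this predicate says that its ingredients exist.\<close>

definition caputo_differentiable :: "real \<Rightarrow> (real \<Rightarrow> real) \<Rightarrow> real \<Rightarrow> bool" where
  "caputo_differentiable \<alpha> g t \<longleftrightarrow>
     (\<forall>y\<in>{0<..<t}. g differentiable (at y)) \<and>
     set_integrable lborel {0<..<t} (\<lambda>y. (t - y) powr (- \<alpha>) * deriv g y)"

end

theory Submission
  imports Defs
begin

text \<open>At a fixed time \<open>u\<close> the subordinator has the law of \<open>E u = u powr (1/\<alpha>1) * a + u powr (1/\<alpha>2) * b\<close>
  with \<open>a\<close>, \<open>b\<close> independent one-sided stable variables, which are obtained as rescaled limits of the
  subordinator itself. Hence its first passage time over \<open>t\<close> has the law of the explicit inverse \<open>Z t\<close> of
  \<open>u \<mapsto> E u\<close>, and \<open>Z\<close> is differentiable in \<open>t\<close> with \<open>Z' t \<le> Z t / t\<close>. The forward equation of the Erlang chain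
  gives the mean phase count as the integral of \<open>f s = k (\<lambda> - \<mu>) + k \<mu> p\<^sub>0 s\<close>, so that
  the mean after the time change is differentiable with derivative \<open>h t = \<E> (f (Z t) * Z' t)\<close>. The Laplace
  transform of \<open>h\<close> at \<open>z\<close> is that of \<open>f\<close> at \<open>\<phi> z = c1 z powr \<alpha>1 + c2 z powr \<alpha>2\<close>, and the
  combination of Caputo derivatives multiplies it by \<open>\<phi> z / z\<close>, which is the transform of
  \<open>t \<mapsto> \<E> (f (Z t))\<close>. Both sides are continuous, hence equal for every \<open>t > 0\<close>.\<close>

section \<open>Uniqueness of Laplace transforms\<close>

text \<open>A Caputo derivative asks for a classical derivative of the mean at every time, whereas
  Laplace transforms determine functions only up to null sets, and the paths of a first passage time
  are monotone but need not be differentiable. The mean at time t, however, involves the first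
  passage time over t only, so any family with the same one-time laws may stand in for it;
  \<open>Z\<close> is such a family with smooth paths. The bound on \<open>Z'\<close> says that both
  exponents 1/\<alpha>1 and 1/\<alpha>2 are at least 1. Together with an estimate of the mean of
  \<open>Z t\<close> by a multiple of t^e with 0 < e < 1 it dominates the difference quotients, and
  it shows that \<open>h\<close> is at most of order t^(e-1), which is integrable at 0 and against
  the kernel (t - y)^(-\<alpha>). Continuity of the right-hand side rests on \<open>f\<close> being
  itself, up to a constant, the antiderivative of a bounded continuous function, by the forward
  equation for the empty state.\<close>

text \<open>Polynomials are covered by the moments, and Weierstrass approximation within e on [0,1]
  changes each side by at most e times the total absolute weight. Signed weights and two different
  spaces let one statement serve both to compare two laws (weights 1) and to show that a density
  orthogonal to all powers vanishes (other side 0).\<close>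

lemma weierstrass_moments_eq:
  fixes W1 X1 :: "'a \<Rightarrow> real" and W2 X2 :: "'b \<Rightarrow> real" and f :: "real \<Rightarrow> real"
  assumes W1: "integrable M1 W1" and W2: "integrable M2 W2"
    and X1 [measurable]: "X1 \<in> borel_measurable M1" and X2 [measurable]: "X2 \<in> borel_measurable M2"
    and b1: "AE x in M1. X1 x \<in> {0..1}" and b2: "AE x in M2. X2 x \<in> {0..1}"
    and mom: "\<And>n. (\<integral>x. W1 x * X1 x ^ n \<partial>M1) = (\<integral>x. W2 x * X2 x ^ n \<partial>M2)"
    and f: "continuous_on UNIV f"
  shows "(\<integral>x. W1 x * f (X1 x) \<partial>M1) = (\<integral>x. W2 x * f (X2 x) \<partial>M2)"
proof -
  have fm[measurable]: "f \<in> borel_measurable borel"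
    using f by (rule borel_measurable_continuous_onI)
  have bdd: "\<exists>B. \<forall>x\<in>{0..1}. \<bar>g x\<bar> \<le> B" if "continuous_on UNIV g" for g :: "real \<Rightarrow> real"
  proof -
    have "compact (g ` {0..1})"
      using that by (intro compact_continuous_image) (auto intro: continuous_on_subset)
    then have "bounded (g ` {0..1})" by (rule compact_imp_bounded)
    then show ?thesis unfolding bounded_iff by auto
  qed
  have int: "integrable M (\<lambda>x. W x * g (X x))"
    if W: "integrable M W" and X[measurable]: "X \<in> borel_measurable M" and b: "AE x in M. X x \<in> {0..1}"
      and g: "continuous_on UNIV g" for M :: "'c measure" and W X and g :: "real \<Rightarrow> real"
  proof -
    have [measurable]: "g \<in> borel_measurable borel"
      using g by (rule borel_measurable_continuous_onI)
    have [measurable]: "W \<in> borel_measurable M" using W by auto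
    obtain B where B: "\<forall>x\<in>{0..1}. \<bar>g x\<bar> \<le> B" using bdd[OF g] by auto
    show ?thesis
    proof (rule Bochner_Integration.integrable_bound)
      show "integrable M (\<lambda>x. W x * B)" using W by simp
      show "AE x in M. norm (W x * g (X x)) \<le> norm (W x * B)"
        using b
      proof eventually_elim
        case (elim x)
        then have "\<bar>g (X x)\<bar> \<le> \<bar>B\<bar>" using B by force
        then show ?case by (auto simp: abs_mult intro!: mult_left_mono)
      qed
    qed simp
  qed
  define C where "C = (\<integral>x. \<bar>W1 x\<bar> \<partial>M1) + (\<integral>x. \<bar>W2 x\<bar> \<partial>M2)"
  have C0: "C \<ge> 0" unfolding C_def by (intro add_nonneg_nonneg integral_nonneg_AE) auto
  have approx: "\<bar>(\<integral>x. W x * f (X x) \<partial>M) - (\<integral>x. W x * p (X x) \<partial>M)\<bar> \<le> e * (\<integral>x. \<bar>W x\<bar> \<partial>M)"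
    if W: "integrable M W" and X[measurable]: "X \<in> borel_measurable M" and b: "AE x in M. X x \<in> {0..1}"
      and p: "continuous_on UNIV p" and e: "\<And>x. x \<in> {0..1} \<Longrightarrow> \<bar>f x - p x\<bar> < e"
    for M :: "'c measure" and W X and p :: "real \<Rightarrow> real" and e
  proof -
    have "(\<integral>x. W x * f (X x) \<partial>M) - (\<integral>x. W x * p (X x) \<partial>M) = (\<integral>x. W x * f (X x) - W x * p (X x) \<partial>M)"
      by (intro Bochner_Integration.integral_diff[symmetric] int W X b p f)
    also have "\<bar>\<dots>\<bar> \<le> (\<integral>x. \<bar>W x * f (X x) - W x * p (X x)\<bar> \<partial>M)"
      by (rule integral_abs_bound)
    also have "\<dots> \<le> (\<integral>x. e * \<bar>W x\<bar> \<partial>M)"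
    proof (rule integral_mono_AE)
      show "integrable M (\<lambda>x. \<bar>W x * f (X x) - W x * p (X x)\<bar>)"
        by (intro integrable_abs Bochner_Integration.integrable_diff int W X b p f)
      show "integrable M (\<lambda>x. e * \<bar>W x\<bar>)" using W by auto
      show "AE x in M. \<bar>W x * f (X x) - W x * p (X x)\<bar> \<le> e * \<bar>W x\<bar>"
        using b
      proof eventually_elim
        case (elim x)
        then have "\<bar>W x\<bar> * \<bar>f (X x) - p (X x)\<bar> \<le> \<bar>W x\<bar> * e"
          using e[of "X x"] by (intro mult_left_mono) auto
        then show ?case by (simp add: abs_mult[symmetric] right_diff_distrib mult.commute)
      qed
    qed
    finally show ?thesis by simp
  qed
  have "\<bar>(\<integral>x. W1 x * f (X1 x) \<partial>M1) - (\<integral>x. W2 x * f (X2 x) \<partial>M2)\<bar> \<le> e * C" if e: "e > 0" for e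
  proof -
    have "continuous_on {0..1} f" using f by (rule continuous_on_subset) auto
    then obtain p where rp: "real_polynomial_function p" and p: "\<And>x. x \<in> {0..1} \<Longrightarrow> \<bar>f x - p x\<bar> < e"
      using Stone_Weierstrass_real_polynomial_function[of "{0..1::real}" f e] e by blast
    obtain a n where pe: "p = (\<lambda>x. \<Sum>i\<le>(n::nat). a i * x ^ i)"
      using rp unfolding real_polynomial_function_iff_sum by auto
    have pc: "continuous_on UNIV p" unfolding pe by (intro continuous_intros)
    have expd: "(\<integral>x. W x * p (X x) \<partial>M) = (\<Sum>i\<le>n. a i * (\<integral>x. W x * X x ^ i \<partial>M))"
      if W: "integrable M W" and X[measurable]: "X \<in> borel_measurable M" and b: "AE x in M. X x \<in> {0..1}"
      for M :: "'c measure" and W X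
    proof -
      have "(\<integral>x. W x * p (X x) \<partial>M) = (\<integral>x. (\<Sum>i\<le>n. a i * (W x * X x ^ i)) \<partial>M)"
        unfolding pe by (simp add: sum_distrib_left mult.left_commute)
      also have "\<dots> = (\<Sum>i\<le>n. (\<integral>x. a i * (W x * X x ^ i) \<partial>M))"
      proof (intro Bochner_Integration.integral_sum integrable_mult_right)
        fix i show "integrable M (\<lambda>x. W x * X x ^ i)"
          using W X b by (rule int) (intro continuous_intros)
      qed
      finally show ?thesis by simp
    qed
    have "(\<integral>x. W1 x * p (X1 x) \<partial>M1) = (\<integral>x. W2 x * p (X2 x) \<partial>M2)"
      by (simp add: expd[OF W1 X1 b1] expd[OF W2 X2 b2] mom)
    with approx[OF W1 X1 b1 pc p] approx[OF W2 X2 b2 pc p]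
    show ?thesis unfolding C_def by (simp add: distrib_left)
  qed
  note bound = this
  have "\<bar>(\<integral>x. W1 x * f (X1 x) \<partial>M1) - (\<integral>x. W2 x * f (X2 x) \<partial>M2)\<bar> \<le> 0 + e" if e: "e > 0" for e
  proof -
    \<comment> \<open>Dividing by C + 1 instead of C covers the case C = 0 as well.\<close>
    have "e / (C + 1) * C \<le> e" using e C0 by (simp add: field_simps)
    then show ?thesis using bound[of "e / (C + 1)"] e C0 by (auto intro: order_trans)
  qed
  then have "\<bar>(\<integral>x. W1 x * f (X1 x) \<partial>M1) - (\<integral>x. W2 x * f (X2 x) \<partial>M2)\<bar> \<le> 0"
    by (rule field_le_epsilon)
  then show ?thesis by simp
qed

text \<open>The substitution y = exp (-x) carries the half-line into (0,1] and turns the transform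
  at n \<ge> 1 into the nth moment; the moment of order 0 is the total mass. Testing with cos and
  sin gives equal characteristic functions of the image laws, and \<open>- ln\<close> undoes the
  substitution.\<close>

lemma laplace_transform_unique:
  fixes \<mu> \<nu> :: "real measure"
  assumes "real_distribution \<mu>" and "real_distribution \<nu>"
    and pos1: "AE x in \<mu>. 0 \<le> x" and pos2: "AE x in \<nu>. 0 \<le> x"
    and lt: "\<And>z. z > 0 \<Longrightarrow> (\<integral>x. exp (- z * x) \<partial>\<mu>) = (\<integral>x. exp (- z * x) \<partial>\<nu>)"
  shows "\<mu> = \<nu>"
proof -
  interpret m: real_distribution \<mu> by fact
  interpret n: real_distribution \<nu> by fact
  let ?e = "\<lambda>x::real. exp (- x)"
  define \<mu>' where "\<mu>' = distr \<mu> borel ?e"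
  define \<nu>' where "\<nu>' = distr \<nu> borel ?e"
  have eq: "(\<integral>x. f (?e x) \<partial>\<mu>) = (\<integral>x. f (?e x) \<partial>\<nu>)" if "continuous_on UNIV f" for f :: "real \<Rightarrow> real"
  proof -
    have "(\<integral>x. 1 * f (?e x) \<partial>\<mu>) = (\<integral>x. 1 * f (?e x) \<partial>\<nu>)"
    proof (rule weierstrass_moments_eq[where ?X1.0 = ?e and ?X2.0 = ?e and ?W1.0 = "\<lambda>_. 1" and ?W2.0 = "\<lambda>_. 1"])
      show "AE x in \<mu>. exp (- x) \<in> {0..1}" "AE x in \<nu>. exp (- x) \<in> {0..1}"
        using pos1 pos2 by auto
      fix n :: nat
      show "(LINT x|\<mu>. 1 * exp (- x) ^ n) = (LINT x|\<nu>. 1 * exp (- x) ^ n)"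
      proof (cases "n = 0")
        case True then show ?thesis using m.prob_space n.prob_space by simp
      next
        case False
        then show ?thesis using lt[of "real n"] by (simp add: exp_of_nat_mult[symmetric])
      qed
    qed (use that in simp_all)
    then show ?thesis by simp
  qed
  have "char \<mu>' = char \<nu>'"
  proof
    fix t
    have c: "char (distr \<kappa> borel ?e) t = Complex (\<integral>x. cos (t * ?e x) \<partial>\<kappa>) (\<integral>x. sin (t * ?e x) \<partial>\<kappa>)"
      if "real_distribution \<kappa>" for \<kappa>
    proof -
      interpret real_distribution \<kappa> by fact
      have i: "integrable \<kappa> (\<lambda>x. iexp (t * ?e x))"
        by (rule integrable_const_bound[where B=1]) auto
      have "char (distr \<kappa> borel ?e) t = (\<integral>x. iexp (t * ?e x) \<partial>\<kappa>)"
        unfolding char_def by (subst integral_distr) auto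
      also have "\<dots> = Complex (\<integral>x. cos (t * ?e x) \<partial>\<kappa>) (\<integral>x. sin (t * ?e x) \<partial>\<kappa>)"
        by (rule complex_eqI) (simp_all only: integral_Re[OF i, symmetric] integral_Im[OF i, symmetric] complex.sel Re_exp Im_exp,
            simp_all)
      finally show ?thesis .
    qed
    show "char \<mu>' t = char \<nu>' t"
      unfolding \<mu>'_def \<nu>'_def c[OF assms(1)] c[OF assms(2)]
      using eq[of "\<lambda>x. cos (t * x)"] eq[of "\<lambda>x. sin (t * x)"]
      by (simp add: continuous_intros)
  qed
  then have mn: "\<mu>' = \<nu>'"
    unfolding \<mu>'_def \<nu>'_def by (intro Levy_uniqueness m.real_distribution_distr n.real_distribution_distr) auto
  have distr_back: "distr (distr \<kappa> borel ?e) borel (\<lambda>y. - ln y) = \<kappa>" if "real_distribution \<kappa>" for \<kappa>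
  proof -
    interpret real_distribution \<kappa> by fact
    have "distr (distr \<kappa> borel ?e) borel (\<lambda>y. - ln y) = distr \<kappa> borel (\<lambda>x. x)"
      by (subst distr_distr) (auto simp: o_def)
    also have "\<dots> = \<kappa>" by (rule distr_id2) simp
    finally show ?thesis .
  qed
  have "distr \<mu>' borel (\<lambda>y. - ln y) = \<mu>" "distr \<nu>' borel (\<lambda>y. - ln y) = \<nu>"
    unfolding \<mu>'_def \<nu>'_def by (rule distr_back[OF assms(1)], rule distr_back[OF assms(2)])
  then show ?thesis unfolding mn by (rule trans[OF sym])
qed

text \<open>After the substitution y = exp (-s) all moments of a signed weight vanish, so it is
  orthogonal to every continuous function of y. If g t were nonzero, a bump near t carrying the sign
  of g t would have a strictly positive integral against it. Continuity of g makes the conclusion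
  pointwise rather than almost everywhere.\<close>

lemma lerch:
  fixes g :: "real \<Rightarrow> real"
  assumes cont: "continuous_on {0<..} g"
    and int: "\<And>z. z > 0 \<Longrightarrow> set_integrable lborel {0<..} (\<lambda>t. exp (- z * t) * g t)"
    and lt: "\<And>z. z > 0 \<Longrightarrow> (LINT t:{0<..}|lborel. exp (- z * t) * g t) = 0"
    and t: "t > 0"
  shows "g t = 0"
proof (rule ccontr)
  assume "g t \<noteq> 0"
  \<comment> \<open>The factor exp (-s) makes the weight integrable and shifts the nth moment to the
    transform at n + 1, which is a positive argument even for n = 0.\<close>
  define W where "W s = indicator {0<..} s * (exp (- s) * g s)" for s
  have W: "integrable lborel W"
    using int[of 1] unfolding W_def set_integrable_def by simp
  \<comment> \<open>The maximum keeps the values in [0,1] for negative s too, where \<open>W\<close>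
    vanishes anyway.\<close>
  let ?X = "\<lambda>s::real. exp (- max 0 s)"
  have orth: "(\<integral>s. W s * f (?X s) \<partial>lborel) = 0" if f: "continuous_on UNIV f" for f :: "real \<Rightarrow> real"
  proof -
    \<comment> \<open>Vanishing of all moments is expressed as agreement with the weight 0 on a null
      measure.\<close>
    have "(\<integral>s. W s * f (?X s) \<partial>lborel) = (\<integral>s. (0::real) * f 0 \<partial>(null_measure (count_space UNIV :: unit measure)))"
    proof (rule weierstrass_moments_eq[OF W _ _ _ _ _ _ f])
      fix n :: nat
      have "(\<integral>s. W s * ?X s ^ n \<partial>lborel) = (LINT t:{0<..}|lborel. exp (- (1 + real n) * t) * g t)"
        unfolding set_lebesgue_integral_def W_def
        by (intro Bochner_Integration.integral_cong)
           (auto simp: indicator_def exp_of_nat_mult[symmetric] exp_add[symmetric] algebra_simps)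
      also have "\<dots> = 0" by (rule lt) simp
      finally show "(\<integral>s. W s * ?X s ^ n \<partial>lborel)
        = (\<integral>s. (0::real) * 0 ^ n \<partial>(null_measure (count_space UNIV :: unit measure)))" by simp
    qed auto
    then show ?thesis by simp
  qed
  have gc: "isCont g t" using cont t by (simp add: continuous_on_eq_continuous_at)
  define s where "s = sgn (g t)"
  obtain d where d: "d > 0" "\<And>x. \<bar>x - t\<bar> < d \<Longrightarrow> \<bar>g x - g t\<bar> < \<bar>g t\<bar>"
    using gc \<open>g t \<noteq> 0\<close> unfolding continuous_at_eps_delta dist_real_def
    by (metis zero_less_abs_iff)
  \<comment> \<open>The bound \<open>t / 2\<close> keeps the interval inside the positive axis; the
    margins \<open>d / 2\<close> keep its closure strictly within distance d of t, where g has the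
    sign of g t.\<close>
  define lo where "lo = max (t / 2) (t - d / 2)"
  define hi where "hi = t + d / 2"
  have lohi: "0 < lo" "lo < t" "t < hi" "\<And>x. lo \<le> x \<Longrightarrow> x \<le> hi \<Longrightarrow> \<bar>x - t\<bar> < d"
    using t d unfolding lo_def hi_def by (auto simp: max_def abs_if field_simps split: if_splits)
  \<comment> \<open>The positive part of a parabola with zeros at exp (- hi) and exp (- lo), so as a
    function of s the bump is supported between \<open>lo\<close> and \<open>hi\<close>; the sign
    \<open>s\<close> makes its product with \<open>W\<close> nonnegative.\<close>
  define f where "f y = s * max 0 ((exp (- lo) - y) * (y - exp (- hi)))" for y
  have fc: "continuous_on UNIV f" unfolding f_def by (intro continuous_intros)
  have fpos: "f (exp (- x)) = s * (if lo < x \<and> x < hi then (exp (- lo) - exp (- x)) * (exp (- x) - exp (- hi)) else 0)" for x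
  proof -
    have "((exp (- lo) - exp (- x)) * (exp (- x) - exp (- hi)) > 0) \<longleftrightarrow> lo < x \<and> x < hi"
      using lohi by (auto simp: zero_less_mult_iff)
    then show ?thesis unfolding f_def by (auto simp: max_def)
  qed
  have nonneg: "W x * f (?X x) \<ge> 0" for x
  proof (cases "x > 0 \<and> lo < x \<and> x < hi")
    case True
    then have "s * g x > 0" using d(2)[of x] lohi(4)[of x] unfolding s_def by (auto simp: sgn_real_def abs_if split: if_splits)
    moreover have "(exp (- lo) - exp (- x)) * (exp (- x) - exp (- hi)) \<ge> 0" using True by (intro mult_nonneg_nonneg) auto
    ultimately have "(s * g x) * ((exp (- lo) - exp (- x)) * (exp (- x) - exp (- hi))) \<ge> 0"
      using mult_nonneg_nonneg[OF less_imp_le] by blast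
    then have "exp (- x) * ((s * g x) * ((exp (- lo) - exp (- x)) * (exp (- x) - exp (- hi)))) \<ge> 0"
      by (rule mult_nonneg_nonneg[OF exp_ge_zero])
    also have "\<dots> = W x * f (?X x)" using True unfolding W_def by (simp add: fpos max_def mult_ac)
    finally show ?thesis .
  next
    case False
    then show ?thesis using lohi unfolding W_def by (auto simp: indicator_def fpos max_def)
  qed
  have fm[measurable]: "f \<in> borel_measurable borel"
    using fc by (rule borel_measurable_continuous_onI)
  have Wm[measurable]: "W \<in> borel_measurable lborel" using W by auto
  have fb: "\<bar>f (?X x)\<bar> \<le> 1" for x
  proof -
    have "\<bar>f y\<bar> \<le> 1" if "0 \<le> y" "y \<le> 1" for y
    proof (cases "(exp (- lo) - y) * (y - exp (- hi)) > 0")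
      case True
      have "0 < exp (- lo)" "exp (- lo) \<le> 1" "0 < exp (- hi)" "exp (- hi) \<le> 1" using lohi by auto
      then have "\<bar>exp (- lo) - y\<bar> \<le> 1" "\<bar>y - exp (- hi)\<bar> \<le> 1" using that by linarith+
      then have "\<bar>(exp (- lo) - y) * (y - exp (- hi))\<bar> \<le> 1"
        unfolding abs_mult by (rule mult_le_one[OF _ abs_ge_zero])
      then show ?thesis using True unfolding f_def s_def by (simp add: abs_mult abs_sgn_eq)
    next
      case False then show ?thesis unfolding f_def by (simp add: max_def)
    qed
    then show ?thesis by auto
  qed
  have I: "integrable lborel (\<lambda>x. W x * f (?X x))"
  proof (rule Bochner_Integration.integrable_bound[OF W])
    show "AE x in lborel. norm (W x * f (?X x)) \<le> norm (W x)"
      using fb by (auto simp: abs_mult intro!: mult_left_le)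
  qed simp
  have "AE x in lborel. W x * f (?X x) = 0"
    using integral_nonneg_eq_0_iff_AE[OF I] nonneg orth[OF fc] by auto
  then have "AE x in lborel. x \<notin> {lo<..<hi}"
  proof eventually_elim
    case (elim x)
    show ?case
    proof
      assume x: "x \<in> {lo<..<hi}"
      then have "g x \<noteq> 0" "s \<noteq> 0" using d(2)[of x] lohi(4)[of x] \<open>g t \<noteq> 0\<close> unfolding s_def by (auto simp: sgn_real_def)
      then show False using elim x lohi unfolding W_def by (auto simp: fpos max_def)
    qed
  qed
  then have "{lo<..<hi} \<in> null_sets lborel"
    by (rule AE_iff_null_sets[THEN iffD2, rotated]) simp
  then show False using lohi by (auto simp: null_sets_def)
qed

section \<open>One-sided stable laws\<close>

text \<open>A continuity theorem for Laplace transforms: the lower bound l, uniform in n and tending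
  to 1 at 0, prevents mass from escaping and gives tightness. A weakly convergent subsequence
  exists, and its transform is identified by the limit assumed for the whole sequence.\<close>

lemma laplace_limit_exists:
  fixes \<mu> :: "nat \<Rightarrow> real measure" and l L :: "real \<Rightarrow> real"
  assumes dist: "\<And>n. real_distribution (\<mu> n)"
    and pos: "\<And>n. AE x in \<mu> n. 0 \<le> x"
    and lower: "\<And>n z. z > 0 \<Longrightarrow> l z \<le> (\<integral>x. exp (- z * x) \<partial>\<mu> n)"
    and l: "(l \<longlongrightarrow> 1) (at_right 0)"
    and lim: "\<And>z. z > 0 \<Longrightarrow> (\<lambda>n. \<integral>x. exp (- z * x) \<partial>\<mu> n) \<longlonglongrightarrow> L z"
  shows "\<exists>\<nu>. real_distribution \<nu> \<and> (AE x in \<nu>. 0 \<le> x) \<and> (\<forall>z>0. (\<integral>x. exp (- z * x) \<partial>\<nu>) = L z)"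
proof -
  have int: "integrable (\<mu> n) (\<lambda>x. exp (- z * x))" if "z > 0" for n z
  proof -
    interpret real_distribution "\<mu> n" by (rule dist)
    show ?thesis
    proof (rule integrable_const_bound[where B=1])
      show "AE x in \<mu> n. norm (exp (- z * x)) \<le> 1"
        using pos[of n] by eventually_elim (use that in auto)
    qed simp
  qed
  have "tight \<mu>"
    unfolding tight_def
  proof (intro conjI allI impI)
    fix n show "real_distribution (\<mu> n)" by (rule dist)
  next
    fix e :: real assume e: "e > 0"
    have "eventually (\<lambda>z. l z > 1 - e / 2) (at_right 0)"
      using l e by (intro order_tendstoD(1)) auto
    then obtain z where z: "z > 0" "l z > 1 - e / 2"
      unfolding eventually_at_right_field using field_lbound_gt_zero by fastforce
    have "measure (\<mu> n) {-1<..1/z} > 1 - e" for n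
    proof -
      interpret real_distribution "\<mu> n" by (rule dist)
      have "2 \<le> exp (1::real)" using exp_ge_add_one_self[of 1] by simp
      then have e1: "exp (-1::real) \<le> 1 / 2" by (simp add: exp_minus field_simps)
      \<comment> \<open>To the right of 1/z the exponential is at most 1/2, so 2 exp (-zx) - 1 is
        almost everywhere at most the indicator of the interval, while its mean exceeds 1 - e by the
        choice of z. The left end -1 only has to lie below the support.\<close>
      have "2 * l z - 1 \<le> (\<integral>x. 2 * exp (- z * x) - 1 \<partial>\<mu> n)"
        using lower[OF z(1), of n] int[OF z(1), of n] prob_space by simp
      also have "\<dots> \<le> (\<integral>x. indicator {-1<..1/z} x \<partial>\<mu> n)"
      proof (rule integral_mono_AE)
        show "AE x in \<mu> n. 2 * exp (- z * x) - 1 \<le> indicator {-1<..1/z} x"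
          using pos[of n]
        proof eventually_elim
          case (elim x)
          show ?case
          proof (cases "x \<le> 1 / z")
            case True
            have "exp (- z * x) \<le> 1" using elim z by simp
            then show ?thesis using True elim by (simp add: indicator_def)
          next
            case False
            then have "- z * x \<le> -1" using z by (simp add: field_simps)
            then have "exp (- z * x) \<le> exp (-1)" by simp
            also note e1
            finally have "exp (- z * x) \<le> 1 / 2" .
            then show ?thesis using False by (simp add: indicator_def)
          qed
        qed
      qed (use int[OF z(1), of n] in \<open>auto intro!: integrable_real_indicator simp: emeasure_eq_measure\<close>)
      finally show ?thesis using z by simp
    qed
    then show "\<exists>a b. a < b \<and> (\<forall>n. measure (\<mu> n) {a<..b} > 1 - e)"
      using z by (intro exI[of _ "-1"] exI[of _ "1/z"]) (auto intro: less_trans[of _ 0])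
  qed
  then obtain r \<nu> where r: "strict_mono (r :: nat \<Rightarrow> nat)" and \<nu>: "real_distribution \<nu>"
    and conv: "weak_conv_m (\<mu> \<circ> id \<circ> r) \<nu>"
    using tight_imp_convergent_subsubsequence[of \<mu> id] by (auto simp: strict_mono_id id_def)
  interpret real_distribution \<nu> by (rule \<nu>)
  have dr: "real_distribution ((\<mu> \<circ> id \<circ> r) n)" for n using dist by simp
  note wc = weak_conv_imp_integral_bdd_continuous_conv[OF dr \<nu> conv]
  have nu_pos: "AE x in \<nu>. 0 \<le> x"
  proof -
    \<comment> \<open>A bounded continuous function that is positive exactly on the negative axis,
      so that weak convergence transfers the support condition.\<close>
    define g where "g x = min 1 (max 0 (- x))" for x :: real
    have g: "isCont g x" "norm (g x) \<le> 1" "g x \<ge> 0" for x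
      unfolding g_def by (auto intro!: continuous_intros)
    have "(\<lambda>n. integral\<^sup>L ((\<mu> \<circ> id \<circ> r) n) g) \<longlonglongrightarrow> integral\<^sup>L \<nu> g"
      by (rule wc) (rule g)+
    moreover have "integral\<^sup>L ((\<mu> \<circ> id \<circ> r) n) g = 0" for n
    proof -
      have "integral\<^sup>L (\<mu> (r n)) g = (\<integral>x. 0 \<partial>\<mu> (r n))"
      proof (rule integral_cong_AE)
        interpret m: real_distribution "\<mu> (r n)" by (rule dist)
        show "g \<in> borel_measurable (\<mu> (r n))" unfolding g_def by measurable
        show "AE x in \<mu> (r n). g x = 0" using pos[of "r n"] by eventually_elim (auto simp: g_def)
      qed simp
      then show ?thesis by simp
    qed
    moreover have gm: "g \<in> borel_measurable borel" unfolding g_def by measurable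
    ultimately have "integral\<^sup>L \<nu> g = 0" by (simp add: LIMSEQ_const_iff)
    moreover have "integrable \<nu> g"
      by (rule integrable_const_bound[where B=1]) (use g gm in auto)
    ultimately have "AE x in \<nu>. g x = 0"
      using integral_nonneg_eq_0_iff_AE[of \<nu> g] g by auto
    then show ?thesis by eventually_elim (auto simp: g_def min_def max_def split: if_splits)
  qed
  have "(\<integral>x. exp (- z * x) \<partial>\<nu>) = L z" if z: "z > 0" for z
  proof -
    \<comment> \<open>Truncation at 0 makes the exponential bounded on the whole line without
      changing it on the support.\<close>
    define g where "g x = exp (- z * max 0 x)" for x
    have g: "isCont g x" "norm (g x) \<le> 1" for x
      unfolding g_def using z by (auto intro!: continuous_intros)
    have "(\<lambda>n. integral\<^sup>L ((\<mu> \<circ> id \<circ> r) n) g) \<longlonglongrightarrow> integral\<^sup>L \<nu> g"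
      by (rule wc) (rule g)+
    moreover have eq: "integral\<^sup>L \<kappa> g = (\<integral>x. exp (- z * x) \<partial>\<kappa>)"
      if "real_distribution \<kappa>" "AE x in \<kappa>. 0 \<le> x" for \<kappa>
    proof (rule integral_cong_AE)
      interpret k: real_distribution \<kappa> by fact
      show "g \<in> borel_measurable \<kappa>" "(\<lambda>x. exp (- z * x)) \<in> borel_measurable \<kappa>"
        unfolding g_def by measurable
      show "AE x in \<kappa>. g x = exp (- z * x)" using that(2) by eventually_elim (auto simp: g_def)
    qed
    ultimately have "(\<lambda>n. \<integral>x. exp (- z * x) \<partial>\<mu> (r n)) \<longlonglongrightarrow> integral\<^sup>L \<nu> g"
      using dist pos by simp
    moreover have "(\<lambda>n. \<integral>x. exp (- z * x) \<partial>\<mu> (r n)) \<longlonglongrightarrow> L z"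
      using LIMSEQ_subseq_LIMSEQ[OF lim[OF z] r] by (simp add: o_def)
    ultimately show ?thesis
      using LIMSEQ_unique eq[OF \<nu> nu_pos] by metis
  qed
  with \<nu> nu_pos show ?thesis by (intro exI[of _ \<nu>]) simp
qed

text \<open>Multiplying a variable of law \<open>\<delta> (u n)\<close> by s n replaces the
  coefficients c1, c2 by c1 (u n) (s n)^\<alpha>1 and c2 (u n) (s n)^\<alpha>2. Keeping both factors
  below 1 supplies the uniform lower bound that tightness requires.\<close>

lemma scaled_laplace_limit_exists:
  fixes \<delta> :: "real \<Rightarrow> real measure" and \<alpha>1 \<alpha>2 c1 c2 x1 x2 :: real and u s :: "nat \<Rightarrow> real"
  assumes \<alpha>: "0 < \<alpha>1" "0 < \<alpha>2" and c: "0 \<le> c1" "0 \<le> c2"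
    and dist: "\<And>u. u > 0 \<Longrightarrow> real_distribution (\<delta> u)"
    and pos: "\<And>u. u > 0 \<Longrightarrow> AE x in \<delta> u. 0 \<le> x"
    and lt: "\<And>u z. u > 0 \<Longrightarrow> z > 0 \<Longrightarrow>
      (\<integral>x. exp (- z * x) \<partial>\<delta> u) = exp (- u * (c1 * z powr \<alpha>1 + c2 * z powr \<alpha>2))"
    and us: "\<And>n. u n > 0" "\<And>n. s n > 0"
    and le: "\<And>n. u n * s n powr \<alpha>1 \<le> 1" "\<And>n. u n * s n powr \<alpha>2 \<le> 1"
    and lim: "(\<lambda>n. u n * s n powr \<alpha>1) \<longlonglongrightarrow> x1" "(\<lambda>n. u n * s n powr \<alpha>2) \<longlonglongrightarrow> x2"
  shows "\<exists>\<nu>. real_distribution \<nu> \<and> (AE x in \<nu>. 0 \<le> x) \<and>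
    (\<forall>z>0. (\<integral>x. exp (- z * x) \<partial>\<nu>) = exp (- (c1 * x1 * z powr \<alpha>1 + c2 * x2 * z powr \<alpha>2)))"
proof -
  define \<mu> where "\<mu> n = distr (\<delta> (u n)) borel (\<lambda>x. s n * x)" for n
  have LT: "(\<integral>x. exp (- z * x) \<partial>\<mu> n)
      = exp (- (c1 * (u n * s n powr \<alpha>1) * z powr \<alpha>1 + c2 * (u n * s n powr \<alpha>2) * z powr \<alpha>2))"
    if z: "z > 0" for n z
  proof -
    interpret real_distribution "\<delta> (u n)" using us by (intro dist)
    have "(\<integral>x. exp (- z * x) \<partial>\<mu> n) = (\<integral>x. exp (- (z * s n) * x) \<partial>\<delta> (u n))"
      unfolding \<mu>_def by (subst integral_distr) (auto simp: mult_ac)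
    also have "\<dots> = exp (- u n * (c1 * (z * s n) powr \<alpha>1 + c2 * (z * s n) powr \<alpha>2))"
      using us z by (intro lt) auto
    also have "\<dots> = exp (- (c1 * (u n * s n powr \<alpha>1) * z powr \<alpha>1 + c2 * (u n * s n powr \<alpha>2) * z powr \<alpha>2))"
      using us[of n] z by (simp add: powr_mult algebra_simps)
    finally show ?thesis .
  qed
  show ?thesis
  proof (rule laplace_limit_exists[where \<mu> = \<mu> and l = "\<lambda>z. exp (- (c1 * z powr \<alpha>1 + c2 * z powr \<alpha>2))"])
    show "real_distribution (\<mu> n)" for n
    proof -
      interpret real_distribution "\<delta> (u n)" using us by (intro dist)
      show ?thesis unfolding \<mu>_def by (rule real_distribution_distr) simp
    qed
    show "AE x in \<mu> n. 0 \<le> x" for n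
    proof -
      interpret real_distribution "\<delta> (u n)" using us by (intro dist)
      show ?thesis unfolding \<mu>_def
        using pos[OF us(1)[of n]] us(2)[of n] by (subst AE_distr_iff) (auto elim!: eventually_mono)
    qed
    show "exp (- (c1 * z powr \<alpha>1 + c2 * z powr \<alpha>2)) \<le> (\<integral>x. exp (- z * x) \<partial>\<mu> n)" if "z > 0" for n z
    proof -
      have "c1 * (u n * s n powr \<alpha>1) \<le> c1" "c2 * (u n * s n powr \<alpha>2) \<le> c2"
        using mult_left_mono[OF le(1)[of n] c(1)] mult_left_mono[OF le(2)[of n] c(2)] by simp_all
      then have "c1 * (u n * s n powr \<alpha>1) * z powr \<alpha>1 \<le> c1 * z powr \<alpha>1"
        "c2 * (u n * s n powr \<alpha>2) * z powr \<alpha>2 \<le> c2 * z powr \<alpha>2"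
        by (simp_all add: mult_right_mono)
      then show ?thesis unfolding LT[OF that] by simp
    qed
    have "((\<lambda>z. exp (- (c1 * z powr \<alpha>1 + c2 * z powr \<alpha>2))) \<longlongrightarrow> exp (- (c1 * 0 powr \<alpha>1 + c2 * 0 powr \<alpha>2))) (at_right 0)"
      using \<alpha> by (intro tendsto_intros) (auto simp: eventually_at_right_less intro!: eventually_at_right_less[THEN eventually_mono])
    then show "((\<lambda>z. exp (- (c1 * z powr \<alpha>1 + c2 * z powr \<alpha>2))) \<longlongrightarrow> 1) (at_right 0)" by simp
    show "(\<lambda>n. \<integral>x. exp (- z * x) \<partial>\<mu> n) \<longlonglongrightarrow> exp (- (c1 * x1 * z powr \<alpha>1 + c2 * x2 * z powr \<alpha>2))" if "z > 0" for z
      unfolding LT[OF that] by (intro tendsto_intros lim)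
  qed
qed

text \<open>Rescaled, \<open>\<delta> u\<close> converges to the \<open>\<alpha>1\<close>-stable law as \<open>u\<close> decreases to \<open>0\<close> and to the \<open>\<alpha>2\<close>-stable law
  as \<open>u\<close> tends to infinity.\<close>

lemma stable_components_exist:
  fixes \<delta> :: "real \<Rightarrow> real measure" and \<alpha>1 \<alpha>2 c1 c2 :: real
  assumes \<alpha>: "0 < \<alpha>2" "\<alpha>2 < \<alpha>1" and c: "0 \<le> c1" "0 \<le> c2"
    and dist: "\<And>u. u > 0 \<Longrightarrow> real_distribution (\<delta> u)"
    and pos: "\<And>u. u > 0 \<Longrightarrow> AE x in \<delta> u. 0 \<le> x"
    and lt: "\<And>u z. u > 0 \<Longrightarrow> z > 0 \<Longrightarrow>
      (\<integral>x. exp (- z * x) \<partial>\<delta> u) = exp (- u * (c1 * z powr \<alpha>1 + c2 * z powr \<alpha>2))"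
  shows "\<exists>A. real_distribution A \<and> (AE x in A. 0 \<le> x) \<and>
      (\<forall>z>0. (\<integral>x. exp (- z * x) \<partial>A) = exp (- (c1 * z powr \<alpha>1)))"
    and "\<exists>B. real_distribution B \<and> (AE x in B. 0 \<le> x) \<and>
      (\<forall>z>0. (\<integral>x. exp (- z * x) \<partial>B) = exp (- (c2 * z powr \<alpha>2)))"
proof -
  define u v where "u n = inverse (real (Suc n))" and "v n = real (Suc n)" for n
  \<comment> \<open>The scale x^(-1/a) normalizes the term of order a to coefficient 1 and leaves
    x^(1 - b/a) in front of the term of order b. That exponent is positive for a = \<alpha>1, b =
    \<alpha>2, where x tends to 0, and negative for a = \<alpha>2, b = \<alpha>1, where x tends to
    infinity; the other term dies in both cases.\<close>
  have pw: "x * (x powr (- (1 / a))) powr b = x powr (1 - b / a)" if "x > 0" for x a b :: real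
  proof -
    have "x * (x powr (- (1 / a))) powr b = x powr 1 * x powr (- (1 / a) * b)"
      using that by (simp add: powr_powr)
    also have "\<dots> = x powr (1 - b / a)" unfolding powr_add[symmetric] by simp
    finally show ?thesis .
  qed
  have 1: "\<exists>\<nu>. real_distribution \<nu> \<and> (AE x in \<nu>. 0 \<le> x) \<and>
    (\<forall>z>0. (\<integral>x. exp (- z * x) \<partial>\<nu>) = exp (- (c1 * 1 * z powr \<alpha>1 + c2 * 0 * z powr \<alpha>2)))"
  proof (rule scaled_laplace_limit_exists[where u = u and s = "\<lambda>n. u n powr (- (1 / \<alpha>1))"])
    have u0: "u n > 0" "u n \<le> 1" for n unfolding u_def by (auto simp: field_simps)
    show "0 < u n" "0 < u n powr (- (1 / \<alpha>1))" for n using u0[of n] by auto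
    show "u n * (u n powr (- (1 / \<alpha>1))) powr \<alpha>1 \<le> 1" "u n * (u n powr (- (1 / \<alpha>1))) powr \<alpha>2 \<le> 1" for n
      unfolding pw[OF u0(1)] using u0[of n] \<alpha> by (auto intro!: powr_le1)
    show "(\<lambda>n. u n * (u n powr (- (1 / \<alpha>1))) powr \<alpha>1) \<longlonglongrightarrow> 1"
      unfolding pw[OF u0(1)] using \<alpha> u0(1) by (simp add: less_imp_neq[symmetric])
    have "u \<longlonglongrightarrow> 0" unfolding u_def by (rule LIMSEQ_inverse_real_of_nat)
    then have "(\<lambda>n. u n powr (1 - \<alpha>2 / \<alpha>1)) \<longlonglongrightarrow> 0 powr (1 - \<alpha>2 / \<alpha>1)"
      using \<alpha> u0 by (intro tendsto_powr2 tendsto_const) (auto simp: less_imp_le)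
    then show "(\<lambda>n. u n * (u n powr (- (1 / \<alpha>1))) powr \<alpha>2) \<longlonglongrightarrow> 0"
      unfolding pw[OF u0(1)] by simp
  qed (use \<alpha> c dist pos lt in auto)
  have 2: "\<exists>\<nu>. real_distribution \<nu> \<and> (AE x in \<nu>. 0 \<le> x) \<and>
    (\<forall>z>0. (\<integral>x. exp (- z * x) \<partial>\<nu>) = exp (- (c1 * 0 * z powr \<alpha>1 + c2 * 1 * z powr \<alpha>2)))"
  proof (rule scaled_laplace_limit_exists[where u = v and s = "\<lambda>n. v n powr (- (1 / \<alpha>2))"])
    have v0: "v n > 0" "v n \<ge> 1" for n unfolding v_def by auto
    show "0 < v n" "0 < v n powr (- (1 / \<alpha>2))" for n using v0[of n] by auto
    have neg: "1 - \<alpha>1 / \<alpha>2 < 0" using \<alpha> by (simp add: field_simps)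
    show "v n * (v n powr (- (1 / \<alpha>2))) powr \<alpha>1 \<le> 1" "v n * (v n powr (- (1 / \<alpha>2))) powr \<alpha>2 \<le> 1" for n
      unfolding pw[OF v0(1)] using v0[of n] \<alpha> neg powr_mono[of "1 - \<alpha>1 / \<alpha>2" 0 "v n"] by auto
    show "(\<lambda>n. v n * (v n powr (- (1 / \<alpha>2))) powr \<alpha>2) \<longlonglongrightarrow> 1"
      unfolding pw[OF v0(1)] using \<alpha> v0(1) by (simp add: less_imp_neq[symmetric])
    have "filterlim v at_top sequentially"
      unfolding v_def by (rule filterlim_compose[OF filterlim_real_sequentially filterlim_Suc])
    then have "(\<lambda>n. v n powr (1 - \<alpha>1 / \<alpha>2)) \<longlonglongrightarrow> 0"
      using neg by (intro tendsto_neg_powr)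
    then show "(\<lambda>n. v n * (v n powr (- (1 / \<alpha>2))) powr \<alpha>1) \<longlonglongrightarrow> 0"
      unfolding pw[OF v0(1)] .
  qed (use \<alpha> c dist pos lt in auto)
  from 1 show "\<exists>A. real_distribution A \<and> (AE x in A. 0 \<le> x) \<and>
      (\<forall>z>0. (\<integral>x. exp (- z * x) \<partial>A) = exp (- (c1 * z powr \<alpha>1)))"
    by (simp only: mult_1_right mult_zero_right mult_zero_left add_0_right)
  from 2 show "\<exists>B. real_distribution B \<and> (AE x in B. 0 \<le> x) \<and>
      (\<forall>z>0. (\<integral>x. exp (- z * x) \<partial>B) = exp (- (c2 * z powr \<alpha>2)))"
    by (simp only: mult_1_right mult_zero_right mult_zero_left add_0_left)
qed

section \<open>Chains with bounded rates\<close>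

lemma integrable_pmf_bounded:
  fixes g :: "'s \<Rightarrow> real"
  assumes "\<And>y. y \<in> set_pmf p \<Longrightarrow> \<bar>g y\<bar> \<le> G"
  shows "integrable (measure_pmf p) g"
  by (rule measure_pmf.integrable_const_bound[where B=G]) (use assms in \<open>auto simp: AE_measure_pmf_iff\<close>)

lemma expectation_pmf_abs_le:
  fixes g :: "'s \<Rightarrow> real"
  assumes "\<And>y. y \<in> set_pmf p \<Longrightarrow> \<bar>g y\<bar> \<le> G"
  shows "\<bar>measure_pmf.expectation p g\<bar> \<le> G"
proof -
  have "\<bar>measure_pmf.expectation p g\<bar> \<le> measure_pmf.expectation p (\<lambda>y. \<bar>g y\<bar>)"
    by (rule integral_abs_bound)
  also have "\<dots> \<le> measure_pmf.expectation p (\<lambda>y. G)"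
    using assms integrable_pmf_bounded[of p g G]
    by (intro integral_mono_AE) (auto simp: AE_measure_pmf_iff)
  finally show ?thesis by simp
qed

lemma expectation_bind_pmf_bounded:
  fixes g :: "'s \<Rightarrow> real"
  assumes "\<And>y. \<bar>g y\<bar> \<le> G"
  shows "measure_pmf.expectation (bind_pmf p f) g = measure_pmf.expectation p (\<lambda>y. measure_pmf.expectation (f y) g)"
  unfolding measure_pmf_bind
  by (rule integral_bind[where K = "count_space UNIV" and B = G and B' = 1])
     (use assms in \<open>auto simp: measure_pmf_in_subprob_algebra measure_pmf.emeasure_space_1\<close>)

text \<open>The finite set \<open>F x\<close> collects the possible targets of a jump from x and
  reduces the infinite sum of rates to a finite one. The common bound \<open>C\<close> on the exit
  rates makes the generator a bounded operator on bounded functions.\<close>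

locale bounded_rate_chain =
  fixes S :: "'s set" and P :: "real \<Rightarrow> 's \<Rightarrow> 's pmf" and q :: "'s \<Rightarrow> 's \<Rightarrow> real"
    and F :: "'s \<Rightarrow> 's set" and C :: real
  assumes tf: "transition_function S P"
    and rates: "has_transition_rates S P q"
    and F: "\<And>x. x \<in> S \<Longrightarrow> finite (F x)" "\<And>x. x \<in> S \<Longrightarrow> F x \<subseteq> S - {x}"
    and q0: "\<And>x y. x \<in> S \<Longrightarrow> y \<in> S - {x} - F x \<Longrightarrow> q x y = 0"
    and exit_le: "\<And>x. x \<in> S \<Longrightarrow> (\<Sum>y\<in>F x. q x y) \<le> C"
begin

text \<open>The value 0 off \<open>S\<close>, here and in \<open>quot\<close>, lets the uniform
  bounds hold for every argument.\<close>

definition gen :: "('s \<Rightarrow> real) \<Rightarrow> 's \<Rightarrow> real" where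
  "gen g x = (if x \<in> S then \<Sum>y\<in>F x. q x y * (g y - g x) else 0)"

definition quot :: "('s \<Rightarrow> real) \<Rightarrow> real \<Rightarrow> 's \<Rightarrow> real" where
  "quot g h x = (if x \<in> S then (measure_pmf.expectation (P h x) g - g x) / h else 0)"

lemma set_P: "0 \<le> t \<Longrightarrow> x \<in> S \<Longrightarrow> set_pmf (P t x) \<subseteq> S"
  and P_0: "x \<in> S \<Longrightarrow> P 0 x = return_pmf x"
  and P_add: "0 \<le> s \<Longrightarrow> 0 \<le> t \<Longrightarrow> x \<in> S \<Longrightarrow> P (s + t) x = bind_pmf (P s x) (P t)"
  using tf unfolding transition_function_def by blast+

lemma rate_lim: "x \<in> S \<Longrightarrow> y \<in> S \<Longrightarrow> x \<noteq> y \<Longrightarrow> ((\<lambda>h. pmf (P h x) y / h) \<longlongrightarrow> q x y) (at_right 0)"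
  using rates unfolding has_transition_rates_def by blast

lemma exit_lim:
  assumes "x \<in> S"
  shows "((\<lambda>h. (1 - pmf (P h x) x) / h) \<longlongrightarrow> (\<Sum>y\<in>F x. q x y)) (at_right 0)"
proof -
  have "(\<Sum>\<^sub>\<infinity>y\<in>S - {x}. q x y) = (\<Sum>\<^sub>\<infinity>y\<in>F x. q x y)"
    using F(2)[OF assms] q0[OF assms] by (intro infsum_cong_neutral) auto
  also have "\<dots> = (\<Sum>y\<in>F x. q x y)" using F(1)[OF assms] by simp
  finally show ?thesis using rates assms unfolding has_transition_rates_def by metis
qed

lemma q_nonneg: "x \<in> S \<Longrightarrow> y \<in> S \<Longrightarrow> x \<noteq> y \<Longrightarrow> 0 \<le> q x y"
  by (rule tendsto_lowerbound[OF rate_lim]) (auto simp: eventually_at_right_less intro!: eventually_at_right_less[THEN eventually_mono])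

lemma C_nonneg: "x \<in> S \<Longrightarrow> 0 \<le> C"
  using exit_le[of x] F(2)[of x] sum_nonneg[of "F x" "q x"] q_nonneg[of x] by fastforce

text \<open>The exit probability is subadditive in time, hence at most linear with slope its derivative
  at \<open>0\<close>. This makes the pointwise limits of \<open>has_transition_rates\<close> uniform.\<close>

lemma exit_prob_le:
  assumes x: "x \<in> S" and h: "0 \<le> h"
  shows "1 - pmf (P h x) x \<le> C * h"
proof -
  define a where "a h = 1 - pmf (P h x) x" for h
  \<comment> \<open>One way to be at x at time s + t is to be there at time s as well, so the return
    probabilities are supermultiplicative; expanding a product of two exit probabilities turns this
    into subadditivity.\<close>
  have sub: "a (s + t) \<le> a s + a t" if "0 \<le> s" "0 \<le> t" for s t
  proof -
    have "pmf (P (s + t) x) x = measure_pmf.expectation (P s x) (\<lambda>y. pmf (P t y) x)"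
      using that x by (simp add: P_add pmf_bind)
    also have "\<dots> \<ge> measure_pmf.expectation (P s x) (\<lambda>y. indicator {x} y * pmf (P t x) x)"
    proof (rule integral_mono)
      show "integrable (measure_pmf (P s x)) (\<lambda>y. indicator {x} y * pmf (P t x) x)"
        by (rule integrable_pmf_bounded[where G=1]) (auto simp: pmf_le_1 indicator_def)
      show "integrable (measure_pmf (P s x)) (\<lambda>y. pmf (P t y) x)"
        by (rule integrable_pmf_bounded[where G=1]) (auto simp: pmf_le_1)
    qed (auto simp: indicator_def)
    finally have "pmf (P s x) x * pmf (P t x) x \<le> pmf (P (s + t) x) x"
      by (simp add: pmf.rep_eq)
    moreover have "(1 - pmf (P s x) x) * (1 - pmf (P t x) x) \<ge> 0"
      by (intro mult_nonneg_nonneg) (auto simp: pmf_le_1)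
    ultimately show ?thesis unfolding a_def by (simp add: algebra_simps)
  qed
  have a0: "a 0 = 0" unfolding a_def using x by (simp add: P_0)
  have n: "a (real n * t) \<le> real n * a t" if "0 \<le> t" for n t
  proof (induction n)
    case (Suc n)
    have "a (real (Suc n) * t) \<le> a (real n * t) + a t"
      using sub[of "real n * t" t] that by (simp add: distrib_right add.commute)
    then show ?case using Suc by (simp add: distrib_right)
  qed (simp add: a0)
  show ?thesis
  proof (cases "h = 0")
    case True then show ?thesis using a0 unfolding a_def by simp
  next
    case False
    with h have h: "h > 0" by simp
    have f: "filterlim (\<lambda>n. h / real (Suc n)) (at_right 0) sequentially"
      using tendsto_mult_right_zero[OF LIMSEQ_inverse_real_of_nat, of h] h
      by (simp add: filterlim_at divide_inverse)
    have "(\<lambda>n. a (h / real (Suc n)) / (h / real (Suc n))) \<longlonglongrightarrow> (\<Sum>y\<in>F x. q x y)"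
      using filterlim_compose[OF exit_lim[OF x] f] unfolding a_def by (simp add: o_def)
    \<comment> \<open>By subadditivity the average exit rate can only grow when h is divided by n +
      1, and along these steps it converges to the rate at 0.\<close>
    moreover have "a h / h \<le> a (h / real (Suc n)) / (h / real (Suc n))" for n
    proof -
      have "a h \<le> real (Suc n) * a (h / real (Suc n))"
        using n[of "h / real (Suc n)" "Suc n"] h by (simp del: of_nat_Suc)
      then have "a h / h \<le> real (Suc n) * a (h / real (Suc n)) / h"
        using h by (intro divide_right_mono) auto
      then show ?thesis by (simp add: mult.commute del: of_nat_Suc)
    qed
    ultimately have "a h / h \<le> (\<Sum>y\<in>F x. q x y)"
      by (intro LIMSEQ_le_const) auto
    also have "\<dots> \<le> C" by (rule exit_le[OF x])
    finally show ?thesis using h unfolding a_def by (simp add: field_simps)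
  qed
qed

text \<open>The change of g is at most 2 G and occurs only if the chain is no longer at x, which has
  probability at most C h.\<close>

lemma expectation_diff_le:
  assumes x: "x \<in> S" and h: "0 \<le> h" and g: "\<And>y. \<bar>g y\<bar> \<le> G"
  shows "\<bar>measure_pmf.expectation (P h x) g - g x\<bar> \<le> 2 * G * (C * h)"
proof -
  have G0: "G \<ge> 0" using g[of x] by simp
  have ig: "integrable (measure_pmf (P h x)) g" using g by (rule integrable_pmf_bounded)
  have "measure_pmf.expectation (P h x) g - g x = measure_pmf.expectation (P h x) (\<lambda>y. g y - g x)"
    using ig by simp
  also have "\<bar>\<dots>\<bar> \<le> measure_pmf.expectation (P h x) (\<lambda>y. \<bar>g y - g x\<bar>)"
    by (rule integral_abs_bound)
  also have "\<dots> \<le> measure_pmf.expectation (P h x) (\<lambda>y. 2 * G * indicator (- {x}) y)"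
  proof (rule integral_mono)
    show "integrable (measure_pmf (P h x)) (\<lambda>y. \<bar>g y - g x\<bar>)" using ig by simp
    show "integrable (measure_pmf (P h x)) (\<lambda>y. 2 * G * indicator (- {x}) y)"
      by (rule integrable_pmf_bounded[where G="2*G"]) (use G0 in \<open>auto simp: indicator_def\<close>)
    show "\<bar>g y - g x\<bar> \<le> 2 * G * indicator (- {x}) y" for y
      using g[of x] g[of y] by (auto simp: indicator_def)
  qed
  also have "\<dots> = 2 * G * (1 - pmf (P h x) x)"
    using measure_pmf.prob_compl[of "{x}" "P h x"] by (simp add: Compl_eq_Diff_UNIV pmf.rep_eq)
  also have "\<dots> \<le> 2 * G * (C * h)"
    using exit_prob_le[OF x h] G0 by (intro mult_left_mono) auto
  finally show ?thesis .
qed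

text \<open>Conditioning at the smaller time reduces this to \<open>expectation_diff_le\<close>,
  whose bound is the same for every state and so survives averaging. It is what makes left-sided
  difference quotients tractable.\<close>

lemma expectation_lipschitz:
  assumes x: "x \<in> S" and "0 \<le> s" "0 \<le> t" and g: "\<And>y. \<bar>g y\<bar> \<le> G"
  shows "\<bar>measure_pmf.expectation (P s x) g - measure_pmf.expectation (P t x) g\<bar> \<le> 2 * G * (C * \<bar>s - t\<bar>)"
proof -
  have *: "\<bar>measure_pmf.expectation (P (t + h) x) g - measure_pmf.expectation (P t x) g\<bar> \<le> 2 * G * (C * h)"
    if "0 \<le> h" "0 \<le> t" for t h
  proof -
    have b: "\<bar>measure_pmf.expectation (P h y) g\<bar> \<le> G" for y
      using g by (rule expectation_pmf_abs_le)
    have "measure_pmf.expectation (P (t + h) x) g - measure_pmf.expectation (P t x) g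
      = measure_pmf.expectation (P t x) (\<lambda>y. measure_pmf.expectation (P h y) g - g y)"
      using integrable_pmf_bounded[of "P t x" g G] integrable_pmf_bounded[OF b, of "P t x"] g
      by (simp add: P_add that x expectation_bind_pmf_bounded[of g G])
    also have "\<bar>\<dots>\<bar> \<le> 2 * G * (C * h)"
      using set_P[OF \<open>0 \<le> t\<close> x] \<open>0 \<le> h\<close> g by (intro expectation_pmf_abs_le expectation_diff_le) auto
    finally show ?thesis .
  qed
  show ?thesis
    using *[of "s - t" t] *[of "t - s" s] assms(2,3) by (cases "t \<le> s") (auto simp: abs_minus_commute)
qed

text \<open>Convergence of the rate to each single target does not control the mass sent to the
  infinitely many other states. That mass, divided by h, is the remainder \<open>R\<close>; it tends
  to 0 because the exit rate equals the sum of the rates over \<open>F x\<close>.\<close>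

lemma quot_lim:
  assumes x: "x \<in> S" and g: "\<And>y. \<bar>g y\<bar> \<le> G"
  shows "((\<lambda>h. quot g h x) \<longlongrightarrow> gen g x) (at_right 0)"
proof -
  have G0: "G \<ge> 0" using g[of x] by simp
  define R where "R h = (1 - pmf (P h x) x) / h - (\<Sum>y\<in>F x. pmf (P h x) y / h)" for h
  have "((\<lambda>h. \<Sum>y\<in>F x. pmf (P h x) y / h * (g y - g x)) \<longlongrightarrow> (\<Sum>y\<in>F x. q x y * (g y - g x))) (at_right 0)"
    using x F(2)[OF x] by (intro tendsto_sum tendsto_mult tendsto_const rate_lim) auto
  then have lim_sum: "((\<lambda>h. \<Sum>y\<in>F x. pmf (P h x) y / h * (g y - g x)) \<longlongrightarrow> gen g x) (at_right 0)"
    unfolding gen_def using x by simp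
  have "(R \<longlongrightarrow> (\<Sum>y\<in>F x. q x y) - (\<Sum>y\<in>F x. q x y)) (at_right 0)"
    unfolding R_def using x F(2)[OF x] by (intro tendsto_diff tendsto_sum rate_lim exit_lim) auto
  then have R: "((\<lambda>h. 2 * G * R h) \<longlongrightarrow> 0) (at_right 0)"
    by (auto intro: tendsto_mult_right_zero)
  have bound: "\<bar>quot g h x - (\<Sum>y\<in>F x. pmf (P h x) y / h * (g y - g x))\<bar> \<le> 2 * G * R h" if h: "h > 0" for h
  proof -
    let ?E = "measure_pmf.expectation (P h x)"
    have ig: "integrable (measure_pmf (P h x)) g" using g by (rule integrable_pmf_bounded)
    have fin: "finite (F x)" "x \<notin> F x" using F x by auto
    have EF: "?E (\<lambda>y. indicator (F x) y * k y) = (\<Sum>y\<in>F x. pmf (P h x) y * k y)" for k :: "'s \<Rightarrow> real"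
    proof -
      have "?E (\<lambda>y. indicator (F x) y * k y) = (\<Sum>y\<in>F x. pmf (P h x) y * (indicator (F x) y * k y))"
        using fin by (subst integral_measure_pmf_real[where A = "F x"]) (auto simp: indicator_def mult.commute split: if_splits)
      then show ?thesis by simp
    qed
    have iF: "integrable (measure_pmf (P h x)) (\<lambda>y. indicator (F x) y * (g y - g x))"
      by (rule integrable_pmf_bounded[where G = "2 * G"]) (use g g[of x] G0 in \<open>auto simp: indicator_def intro: order_trans[OF abs_triangle_ineq4] add_mono[of _ G _ G, simplified]\<close>)
    have "?E g - g x - (\<Sum>y\<in>F x. pmf (P h x) y * (g y - g x)) = ?E (\<lambda>y. (g y - g x) - indicator (F x) y * (g y - g x))"
      using ig iF EF[of "\<lambda>y. g y - g x"] by simp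
    also have "\<bar>\<dots>\<bar> \<le> ?E (\<lambda>y. \<bar>(g y - g x) - indicator (F x) y * (g y - g x)\<bar>)"
      by (rule integral_abs_bound)
    also have "\<dots> \<le> ?E (\<lambda>y. 2 * G * (indicator (- {x}) y - indicator (F x) y))"
    proof (rule integral_mono)
      show "integrable (measure_pmf (P h x)) (\<lambda>y. \<bar>(g y - g x) - indicator (F x) y * (g y - g x)\<bar>)"
        using ig iF by simp
      show "integrable (measure_pmf (P h x)) (\<lambda>y. 2 * G * (indicator (- {x}) y - indicator (F x) y))"
        by (rule integrable_pmf_bounded[where G="2*G"]) (use G0 in \<open>auto simp: indicator_def\<close>)
      show "\<bar>(g y - g x) - indicator (F x) y * (g y - g x)\<bar> \<le> 2 * G * (indicator (- {x}) y - indicator (F x) y)" for y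
        using g[of x] g[of y] fin by (auto simp: indicator_def)
    qed
    also have "\<dots> = 2 * G * (?E (indicator (- {x})) - ?E (indicator (F x)))"
      by (simp add: measure_pmf.emeasure_eq_measure)
    also have "\<dots> = 2 * G * (1 - pmf (P h x) x - (\<Sum>y\<in>F x. pmf (P h x) y))"
      using measure_pmf.prob_compl[of "{x}" "P h x"] EF[of "\<lambda>_. 1"]
      by (simp add: Compl_eq_Diff_UNIV pmf.rep_eq)
    finally have "\<bar>?E g - g x - (\<Sum>y\<in>F x. pmf (P h x) y * (g y - g x))\<bar> / h
        \<le> 2 * G * (1 - pmf (P h x) x - (\<Sum>y\<in>F x. pmf (P h x) y)) / h"
      using h by (intro divide_right_mono) auto
    moreover have "quot g h x - (\<Sum>y\<in>F x. pmf (P h x) y / h * (g y - g x))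
        = (?E g - g x - (\<Sum>y\<in>F x. pmf (P h x) y * (g y - g x))) / h"
      using x by (simp add: quot_def diff_divide_distrib sum_divide_distrib)
    moreover have "2 * G * (1 - pmf (P h x) x - (\<Sum>y\<in>F x. pmf (P h x) y)) / h = 2 * G * R h"
      unfolding R_def by (simp add: diff_divide_distrib sum_divide_distrib[symmetric] right_diff_distrib)
    ultimately show ?thesis using h by simp
  qed
  have "((\<lambda>h. quot g h x - (\<Sum>y\<in>F x. pmf (P h x) y / h * (g y - g x))) \<longlongrightarrow> 0) (at_right 0)"
  proof (rule Lim_null_comparison[OF _ R])
    show "\<forall>\<^sub>F h in at_right 0. norm (quot g h x - (\<Sum>y\<in>F x. pmf (P h x) y / h * (g y - g x))) \<le> 2 * G * R h"
      using eventually_at_right_less[of "0::real"] by eventually_elim (use bound in auto)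
  qed
  from tendsto_add[OF this lim_sum] show ?thesis by simp
qed

lemma quot_bound:
  assumes h: "h > 0" and g: "\<And>y. \<bar>g y\<bar> \<le> G"
  shows "\<bar>quot g h x\<bar> \<le> 2 * G * \<bar>C\<bar>"
proof (cases "x \<in> S")
  case True
  then have "\<bar>quot g h x\<bar> \<le> (2 * G * (C * h)) / h"
    unfolding quot_def using expectation_diff_le[OF True, of h g G] h g by (simp add: field_simps)
  then show ?thesis using h C_nonneg[OF True] by simp
next
  case False
  then show ?thesis using g[of x] by (simp add: quot_def)
qed

lemma gen_bound:
  assumes g: "\<And>y. \<bar>g y\<bar> \<le> G"
  shows "\<bar>gen g x\<bar> \<le> 2 * G * \<bar>C\<bar>"
proof (cases "x \<in> S")
  case True
  have "((\<lambda>h. \<bar>quot g h x\<bar>) \<longlongrightarrow> \<bar>gen g x\<bar>) (at_right 0)"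
    by (intro tendsto_rabs quot_lim[OF True g])
  then show ?thesis
    by (rule tendsto_upperbound)
       (auto intro!: eventually_at_right_less[THEN eventually_mono] quot_bound g)
next
  case False
  then show ?thesis using g[of x] by (simp add: gen_def)
qed

text \<open>An increment over a step h is h times the mean of \<open>quot g h\<close> at the earlier
  time. To the right of t this is the state at t itself, and dominated convergence applies. To the
  left it is the state at y < t, which is exchanged for the state at t at a cost linear in t -
  y.\<close>

lemma expectation_has_derivative:
  assumes x: "x \<in> S" and g: "\<And>y. \<bar>g y\<bar> \<le> G" and t: "0 \<le> t"
  shows "((\<lambda>t. measure_pmf.expectation (P t x) g) has_real_derivative measure_pmf.expectation (P t x) (gen g)) (at t within {0..})"
proof -
  define u where "u t = measure_pmf.expectation (P t x) g" for t
  \<comment> \<open>The Lipschitz constant of \<open>expectation_lipschitz\<close> for a function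
    bounded by \<open>2 * G * \<bar>C\<bar>\<close>, the bound on \<open>quot\<close>.\<close>
  define K where "K = 2 * (2 * G * \<bar>C\<bar>) * C"
  have step: "u (s + h) - u s = h * measure_pmf.expectation (P s x) (quot g h)" if "0 \<le> s" "0 < h" for s h
  proof -
    have b: "\<bar>measure_pmf.expectation (P h y) g\<bar> \<le> G" for y
      using g by (rule expectation_pmf_abs_le)
    have "u (s + h) - u s = measure_pmf.expectation (P s x) (\<lambda>y. measure_pmf.expectation (P h y) g - g y)"
      unfolding u_def
      using integrable_pmf_bounded[of "P s x" g G] integrable_pmf_bounded[OF b, of "P s x"] g that
      by (simp add: P_add x expectation_bind_pmf_bounded[of g G])
    also have "\<dots> = measure_pmf.expectation (P s x) (\<lambda>y. h * quot g h y)"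
      using set_P[OF \<open>0 \<le> s\<close> x] that
      by (intro integral_cong_AE) (auto simp: AE_measure_pmf_iff quot_def)
    finally show ?thesis by simp
  qed
  define e where "e h = measure_pmf.expectation (P t x) (quot g h)" for h
  have e: "(e \<longlongrightarrow> measure_pmf.expectation (P t x) (gen g)) (at_right 0)"
    unfolding filterlim_at_right_to_top e_def
  proof (rule integral_dominated_convergence_at_top[where w = "\<lambda>_. 2 * G * \<bar>C\<bar>"])
    show "AE y in P t x. ((\<lambda>h. quot g (inverse h) y) \<longlongrightarrow> gen g y) at_top"
      using set_P[OF t x] quot_lim[OF _ g] by (auto simp: AE_measure_pmf_iff filterlim_at_right_to_top)
    show "\<forall>\<^sub>F h in at_top. AE y in P t x. norm (quot g (inverse h) y) \<le> 2 * G * \<bar>C\<bar>"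
      using eventually_gt_at_top[of 0] by eventually_elim (auto intro!: quot_bound g)
  qed auto
  have dist: "\<bar>(u y - u t) / (y - t) - e \<bar>y - t\<bar>\<bar> \<le> K * \<bar>y - t\<bar>" if "0 \<le> y" "y \<noteq> t" for y
  proof (cases "y > t")
    case True
    then show ?thesis using step[of t "y - t"] t C_nonneg[OF x] g[of x] unfolding e_def K_def by simp
  next
    case False
    then have yt: "y < t" using that by simp
    then have "(u y - u t) / (y - t) = measure_pmf.expectation (P y x) (quot g (t - y))"
      using step[of y "t - y"] that by (simp add: field_simps)
    moreover have "\<bar>measure_pmf.expectation (P y x) (quot g (t - y)) - measure_pmf.expectation (P t x) (quot g (t - y))\<bar>
        \<le> 2 * (2 * G * \<bar>C\<bar>) * (C * \<bar>y - t\<bar>)"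
      using that t yt by (intro expectation_lipschitz x quot_bound g) auto
    ultimately show ?thesis using yt unfolding e_def K_def by (simp add: mult.assoc)
  qed
  have abs_lim: "filterlim (\<lambda>y. \<bar>y - t\<bar>) (at_right 0) (at t within {0..})"
    unfolding filterlim_at
    by (auto intro!: tendsto_eq_intros simp: eventually_at_filter)
  have "((\<lambda>y. (u y - u t) / (y - t) - e \<bar>y - t\<bar>) \<longlongrightarrow> 0) (at t within {0..})"
  proof (rule Lim_null_comparison)
    show "\<forall>\<^sub>F y in at t within {0..}. norm ((u y - u t) / (y - t) - e \<bar>y - t\<bar>) \<le> K * \<bar>y - t\<bar>"
      using dist by (auto simp: eventually_at_filter)
    have "((\<lambda>y. K * \<bar>y - t\<bar>) \<longlongrightarrow> K * \<bar>t - t\<bar>) (at t within {0..})" by (intro tendsto_intros)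
    then show "((\<lambda>y. K * \<bar>y - t\<bar>) \<longlongrightarrow> 0) (at t within {0..})" by simp
  qed
  from tendsto_add[OF this filterlim_compose[OF e abs_lim]]
  show ?thesis unfolding has_field_derivative_iff u_def by simp
qed

lemma continuous_on_expectation:
  fixes g :: "'s \<Rightarrow> real"
  assumes x: "x \<in> S" and g: "\<And>y. \<bar>g y\<bar> \<le> G"
  shows "continuous_on {0..} (\<lambda>t. measure_pmf.expectation (P t x) g)"
  unfolding continuous_on_eq_continuous_within
proof
  fix t :: real assume "t \<in> {0..}"
  then have "0 \<le> t" by simp
  from expectation_has_derivative[OF x g this]
  show "continuous (at t within {0..}) (\<lambda>t. measure_pmf.expectation (P t x) g)"
    by (rule DERIV_continuous)
qed

text \<open>Dynkin's formula for bounded functions. Boundedness excludes the phase count itself,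
  which is why truncations appear later.\<close>

lemma forward_equation:
  assumes x: "x \<in> S" and g: "\<And>y. \<bar>g y\<bar> \<le> G" and t: "0 \<le> t"
  shows "((\<lambda>s. measure_pmf.expectation (P s x) (gen g)) has_integral
    (measure_pmf.expectation (P t x) g - g x)) {0..t}"
proof -
  have "((\<lambda>s. measure_pmf.expectation (P s x) (gen g)) has_integral
    (measure_pmf.expectation (P t x) g - measure_pmf.expectation (P 0 x) g)) {0..t}"
  proof (rule fundamental_theorem_of_calculus[OF t])
    fix s assume "s \<in> {0..t}"
    then have "((\<lambda>t. measure_pmf.expectation (P t x) g) has_real_derivative measure_pmf.expectation (P s x) (gen g)) (at s within {0..})"
      by (intro expectation_has_derivative[where G = G] x g) auto
    from DERIV_subset[OF this, of "{0..t}"]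
    show "((\<lambda>t. measure_pmf.expectation (P t x) g) has_vector_derivative measure_pmf.expectation (P s x) (gen g)) (at s within {0..t})"
      by (auto simp: has_real_derivative_iff_has_vector_derivative)
  qed
  then show ?thesis using x by (simp add: P_0)
qed

end

section \<open>The Erlang chain\<close>

definition erlang_down :: "nat \<Rightarrow> nat \<times> nat \<Rightarrow> nat \<times> nat" where
  "erlang_down k x = (case x of (n, s) \<Rightarrow>
     if 2 \<le> s then (n, s - 1) else if 2 \<le> n then (n - 1, k) else (0, 0))"

definition erlang_next :: "nat \<Rightarrow> nat \<times> nat \<Rightarrow> (nat \<times> nat) set" where
  "erlang_next k x = (if fst x = 0 then {(1, k)} else {(fst x + 1, snd x), erlang_down k x})"

lemma erlang_states_cases:
  assumes "x \<in> erlang_states k"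
  obtains "x = (0, 0)" | n s where "x = (n, s)" "1 \<le> n" "1 \<le> s" "s \<le> k"
  using assms unfolding erlang_states_def by auto

text \<open>An arrival and a phase completion lead to different states, so sums over
  \<open>erlang_next\<close> split into exactly two terms.\<close>

lemma erlang_rate_next:
  assumes "1 \<le> n" "1 \<le> s" "s \<le> k"
  shows "(n + 1, s) \<noteq> erlang_down k (n, s)"
    and "erlang_down k (n, s) \<in> erlang_states k - {(n, s)}"
    and "erlang_rate lam mu k (n, s) (n + 1, s) = lam"
    and "erlang_rate lam mu k (n, s) (erlang_down k (n, s)) = real k * mu"
  using assms by (auto simp: erlang_down_def erlang_states_def erlang_rate_def)

lemma bounded_rate_chain_erlang:
  assumes "lam > 0" "mu > 0" "k \<ge> 1"
    and "transition_function (erlang_states k) P"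
    and "has_transition_rates (erlang_states k) P (erlang_rate lam mu k)"
  shows "bounded_rate_chain (erlang_states k) P (erlang_rate lam mu k) (erlang_next k) (lam + real k * mu)"
proof
  fix x assume "x \<in> erlang_states k"
  then have "finite (erlang_next k x) \<and> erlang_next k x \<subseteq> erlang_states k - {x} \<and>
    (\<Sum>y\<in>erlang_next k x. erlang_rate lam mu k x y) \<le> lam + real k * mu"
  proof (cases rule: erlang_states_cases)
    case 1
    then show ?thesis using assms(1-3)
      by (simp add: erlang_next_def erlang_states_def erlang_rate_def)
  next
    case (2 n s)
    then show ?thesis
      using erlang_rate_next(1,2)[OF 2(2-4)] erlang_rate_next(3,4)[OF 2(2-4), of lam mu]
      by (simp add: erlang_next_def erlang_states_def)
  qed
  then show "finite (erlang_next k x)" "erlang_next k x \<subseteq> erlang_states k - {x}"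
    "(\<Sum>y\<in>erlang_next k x. erlang_rate lam mu k x y) \<le> lam + real k * mu" by auto
next
  fix x y assume x: "x \<in> erlang_states k" and y: "y \<in> erlang_states k - {x} - erlang_next k x"
  from x show "erlang_rate lam mu k x y = 0"
  proof (cases rule: erlang_states_cases)
    case 1
    then show ?thesis using y by (simp add: erlang_next_def erlang_rate_def)
  next
    case (2 n s)
    then have "y \<noteq> (n + 1, s)" "y \<noteq> erlang_down k (n, s)" using y by (auto simp: erlang_next_def)
    then show ?thesis using 2
      by (cases "2 \<le> s"; cases "2 \<le> n") (simp_all add: erlang_rate_def erlang_down_def)
  qed
qed (use assms in auto)

lemma erlang_start: "(0, 0) \<in> erlang_states k"
  by (simp add: erlang_states_def)

context
  fixes lam mu :: real and k :: nat and P
  assumes lam: "lam > 0" and mu: "mu > 0" and k: "k \<ge> 1"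
    and tf: "transition_function (erlang_states k) P"
    and rates: "has_transition_rates (erlang_states k) P (erlang_rate lam mu k)"
begin

interpretation bounded_rate_chain "erlang_states k" P "erlang_rate lam mu k" "erlang_next k" "lam + real k * mu"
  using lam mu k tf rates by (rule bounded_rate_chain_erlang)

lemma erlang_gen:
  assumes "x \<in> erlang_states k" "x \<noteq> (0, 0)"
  shows "gen g x = lam * (g (fst x + 1, snd x) - g x) + real k * mu * (g (erlang_down k x) - g x)"
  using assms(1)
proof (cases rule: erlang_states_cases)
  case (2 n s)
  then show ?thesis
    using assms(1) erlang_rate_next(1)[OF 2(2-4)] erlang_rate_next(3,4)[OF 2(2-4), of lam mu]
    by (simp add: gen_def erlang_next_def)
qed (use assms in auto)

lemma erlang_gen_empty:
  "gen g (0, 0) = lam * (g (1, k) - g (0, 0))"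
  by (simp add: gen_def erlang_start erlang_next_def erlang_rate_def)

text \<open>Off the empty state the drift of the phase count is therefore the constant k (lam - mu),
  as an arrival adds k phases at rate lam and a completion removes one at rate k mu. At the empty
  state only k lam remains, which is the origin of the term k mu p0 in the equation.\<close>

lemma phase_count_next:
  assumes "x \<in> erlang_states k" "x \<noteq> (0, 0)"
  shows "phase_count k (fst x + 1, snd x) = phase_count k x + k"
    and "phase_count k x = phase_count k (erlang_down k x) + 1"
proof -
  from assms obtain n s where x: "x = (n, s)" "1 \<le> n" "1 \<le> s" by (cases rule: erlang_states_cases) auto
  then obtain m where n: "n = Suc m" by (cases n) auto
  show "phase_count k (fst x + 1, snd x) = phase_count k x + k"
    by (simp add: x(1) n phase_count_def)
  show "phase_count k x = phase_count k (erlang_down k x) + 1"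
  proof (cases "2 \<le> s")
    case True
    then show ?thesis by (simp add: x(1) n phase_count_def erlang_down_def)
  next
    case False
    with x have "s = 1" by simp
    then show ?thesis by (cases m) (simp_all add: x(1) n phase_count_def erlang_down_def)
  qed
qed

text \<open>The forward equation for the indicator of the empty state. It exhibits the empty
  probability as an antiderivative of a bounded continuous function, the form in which it can be
  composed with the random time.\<close>

lemma erlang_empty_prob_integral:
  obtains v V where "continuous_on {0..} v" "\<And>s. 0 \<le> s \<Longrightarrow> \<bar>v s\<bar> \<le> V"
    "\<And>s. 0 \<le> s \<Longrightarrow> (v has_integral pmf (P s (0, 0)) (0, 0) - 1) {0..s}"
proof -
  define g :: "nat \<times> nat \<Rightarrow> real" where "g = indicator {(0, 0)}"
  have g: "\<bar>g y\<bar> \<le> 1" for y by (simp add: g_def indicator_def)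
  define V where "V = 2 * 1 * \<bar>lam + real k * mu\<bar>"
  have gb: "\<bar>gen g y\<bar> \<le> V" for y unfolding V_def by (rule gen_bound[OF g])
  define v where "v s = measure_pmf.expectation (P s (0, 0)) (gen g)" for s
  show ?thesis
  proof
    show "continuous_on {0..} v" unfolding v_def
      by (rule continuous_on_expectation[OF erlang_start gb])
    show "\<bar>v s\<bar> \<le> V" for s unfolding v_def by (rule expectation_pmf_abs_le[OF gb])
    show "(v has_integral pmf (P s (0, 0)) (0, 0) - 1) {0..s}" if "0 \<le> s" for s
      using forward_equation[OF erlang_start, of g 1 s] g that unfolding v_def
      by (simp add: g_def pmf.rep_eq)
  qed
qed

lemma continuous_on_erlang_prob:
  assumes "x \<in> erlang_states k"
  shows "continuous_on {0..} (\<lambda>s. pmf (P s x) y)"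
  using continuous_on_expectation[OF assms, of "indicator {y}" 1]
  by (simp add: pmf.rep_eq indicator_def)

text \<open>The forward equation is applied to the truncations \<open>min (phase_count k x) N\<close>.\<close>

lemma erlang_mean_integral:
  assumes t: "0 \<le> t"
  shows "integrable (P t (0, 0)) (\<lambda>x. real (phase_count k x))"
    and "((\<lambda>s. real k * (lam - mu) + real k * mu * pmf (P s (0, 0)) (0, 0)) has_integral
      measure_pmf.expectation (P t (0, 0)) (\<lambda>x. real (phase_count k x))) {0..t}"
proof -
  let ?L = "\<lambda>x. real (phase_count k x)"
  define g where "g N x = min (?L x) (real N)" for N :: nat and x
  have g: "\<bar>g N y\<bar> \<le> real N" for N y by (simp add: g_def)
  define B where "B = lam * real k + real k * mu"
  define d where "d x = real k * (lam - mu) + real k * mu * indicator {(0, 0)} x" for x :: "nat \<times> nat"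
  \<comment> \<open>Truncation at N is a contraction, so the generator sees jumps of at most k
    upwards and 1 downwards whatever N is. The general bound would grow with N.\<close>
  have gb: "\<bar>gen (g N) x\<bar> \<le> B" for N x
  proof -
    consider "x \<notin> erlang_states k" | "x = (0, 0)" | "x \<in> erlang_states k" "x \<noteq> (0, 0)" by blast
    then show ?thesis
    proof cases
      case 1 then show ?thesis using lam mu by (simp add: gen_def B_def)
    next
      case 2
      have "\<bar>gen (g N) x\<bar> = lam * min (real k) (real N)"
        using lam by (simp add: 2 erlang_gen_empty g_def phase_count_def)
      also have "\<dots> \<le> lam * real k" using lam by (intro mult_left_mono) auto
      finally show ?thesis using lam mu by (simp add: B_def add_increasing2)
    next
      case 3
      have "\<bar>gen (g N) x\<bar> \<le> lam * \<bar>g N (fst x + 1, snd x) - g N x\<bar> + real k * mu * \<bar>g N (erlang_down k x) - g N x\<bar>"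
        unfolding erlang_gen[OF 3] using lam mu
        by (intro order_trans[OF abs_triangle_ineq]) (simp add: abs_mult)
      also have "\<dots> \<le> lam * real k + real k * mu * 1"
        using phase_count_next[OF 3] lam mu unfolding g_def
        by (intro add_mono mult_left_mono) auto
      finally show ?thesis by (simp add: B_def)
    qed
  qed
  \<comment> \<open>As soon as N is at least the phase count plus k, neither x nor any of its
    targets is affected by the truncation.\<close>
  have gl: "(\<lambda>N. gen (g N) x) \<longlonglongrightarrow> d x" if "x \<in> erlang_states k" for x
  proof -
    have "eventually (\<lambda>N. gen (g N) x = d x) sequentially"
      using eventually_ge_at_top[of "phase_count k x + k"]
    proof eventually_elim
      case (elim N)
      show ?case
      proof (cases "x = (0, 0)")
        case True
        then show ?thesis using elim
          by (simp add: erlang_gen_empty g_def d_def phase_count_def algebra_simps)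
      next
        case False
        note pc = phase_count_next[OF that False]
        have "g N (fst x + 1, snd x) - g N x = real k" "g N (erlang_down k x) - g N x = - 1"
          using elim pc unfolding g_def by auto
        then have "gen (g N) x = lam * real k + real k * mu * - 1"
          unfolding erlang_gen[OF that False] by (simp only:)
        then show ?thesis using False by (simp add: d_def algebra_simps)
      qed
    qed
    then show ?thesis by (rule tendsto_eventually)
  qed
  have "(\<lambda>s. real k * (lam - mu) + real k * mu * pmf (P s (0, 0)) (0, 0)) integrable_on {0..t} \<and>
    (\<lambda>N. integral {0..t} (\<lambda>s. measure_pmf.expectation (P s (0, 0)) (gen (g N))))
      \<longlonglongrightarrow> integral {0..t} (\<lambda>s. real k * (lam - mu) + real k * mu * pmf (P s (0, 0)) (0, 0))"
  proof (rule conjI)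
    have 1: "(\<lambda>s. measure_pmf.expectation (P s (0, 0)) (gen (g N))) integrable_on {0..t}" for N
      using forward_equation[OF erlang_start, of "g N" "real N" t] g t by (auto simp: integrable_on_def)
    have 2: "norm (measure_pmf.expectation (P s (0, 0)) (gen (g N))) \<le> B" for N s
      using expectation_pmf_abs_le[OF gb, where p = "P s (0, 0)"] by simp
    have 3: "(\<lambda>N. measure_pmf.expectation (P s (0, 0)) (gen (g N))) \<longlonglongrightarrow> real k * (lam - mu) + real k * mu * pmf (P s (0, 0)) (0, 0)"
      if "s \<in> {0..t}" for s
    proof -
      have "(\<lambda>N. measure_pmf.expectation (P s (0, 0)) (gen (g N))) \<longlonglongrightarrow> measure_pmf.expectation (P s (0, 0)) d"
        by (rule integral_dominated_convergence[where w = "\<lambda>_. B"])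
           (use gb gl set_P[OF _ erlang_start, of s] that in \<open>auto simp: AE_measure_pmf_iff\<close>)
      also have "measure_pmf.expectation (P s (0, 0)) d = real k * (lam - mu) + real k * mu * pmf (P s (0, 0)) (0, 0)"
        unfolding d_def by (simp add: pmf.rep_eq measure_pmf.emeasure_eq_measure)
      finally show ?thesis .
    qed
    show "(\<lambda>s. real k * (lam - mu) + real k * mu * pmf (P s (0, 0)) (0, 0)) integrable_on {0..t}"
      by (rule dominated_convergence(1)[OF 1 _ 2 3]) auto
    show "(\<lambda>N. integral {0..t} (\<lambda>s. measure_pmf.expectation (P s (0, 0)) (gen (g N))))
      \<longlonglongrightarrow> integral {0..t} (\<lambda>s. real k * (lam - mu) + real k * mu * pmf (P s (0, 0)) (0, 0))"
      by (rule dominated_convergence(2)[OF 1 _ 2 3]) auto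
  qed
  moreover have "integral {0..t} (\<lambda>s. measure_pmf.expectation (P s (0, 0)) (gen (g N))) = measure_pmf.expectation (P t (0, 0)) (g N)" for N
    using integral_unique[OF forward_equation[OF erlang_start, of "g N" "real N" t]] g t by (simp add: g_def phase_count_def)
  ultimately have I: "(\<lambda>s. real k * (lam - mu) + real k * mu * pmf (P s (0, 0)) (0, 0)) integrable_on {0..t}"
    and lim: "(\<lambda>N. measure_pmf.expectation (P t (0, 0)) (g N))
      \<longlonglongrightarrow> integral {0..t} (\<lambda>s. real k * (lam - mu) + real k * mu * pmf (P s (0, 0)) (0, 0))"
    by simp_all
  \<comment> \<open>The limit of the truncated means is already known to be finite, so monotone
    convergence gives integrability together with the value.\<close>
  have L1: "integrable (P t (0, 0)) (g N)" for N using g by (rule integrable_pmf_bounded)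
  have L2: "AE x in P t (0, 0). mono (\<lambda>N. g N x)" by (auto simp: g_def mono_def)
  have L3: "AE x in P t (0, 0). (\<lambda>N. g N x) \<longlonglongrightarrow> ?L x"
  proof (rule AE_I2)
    fix x
    show "(\<lambda>N. g N x) \<longlonglongrightarrow> ?L x"
      unfolding g_def
      by (rule tendsto_eventually, rule eventually_mono[OF eventually_ge_at_top[of "phase_count k x"]]) simp
  qed
  show "integrable (P t (0, 0)) ?L"
    by (rule integrable_monotone_convergence[OF L1 L2 L3 lim]) simp
  have "measure_pmf.expectation (P t (0, 0)) ?L = integral {0..t} (\<lambda>s. real k * (lam - mu) + real k * mu * pmf (P s (0, 0)) (0, 0))"
    by (rule integral_monotone_convergence[OF L1 L2 L3 lim]) simp
  with I show "((\<lambda>s. real k * (lam - mu) + real k * mu * pmf (P s (0, 0)) (0, 0)) has_integral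
      measure_pmf.expectation (P t (0, 0)) ?L) {0..t}"
    by (simp add: has_integral_iff)
qed

end

section \<open>Inverses of sums of two powers\<close>

definition power_sum :: "real \<Rightarrow> real \<Rightarrow> real \<Rightarrow> real \<Rightarrow> real \<Rightarrow> real" where
  "power_sum p q a b u = a * u powr p + b * u powr q"

definition power_sum_deriv :: "real \<Rightarrow> real \<Rightarrow> real \<Rightarrow> real \<Rightarrow> real \<Rightarrow> real" where
  "power_sum_deriv p q a b u = a * p * u powr (p - 1) + b * q * u powr (q - 1)"

text \<open>Excludes a = b = 0, for which \<open>power_sum\<close> vanishes identically and has no
  inverse.\<close>

definition admissible :: "real \<Rightarrow> real \<Rightarrow> bool" where
  "admissible a b \<longleftrightarrow> 0 \<le> a \<and> 0 \<le> b \<and> 0 < a + b"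

text \<open>The default value 0 keeps sign, monotonicity, and for t > 0 also continuity and
  differentiability, valid for all a and b, so that exceptional points need no separate treatment
  under the integral.\<close>

definition power_sum_inv :: "real \<Rightarrow> real \<Rightarrow> real \<Rightarrow> real \<Rightarrow> real \<Rightarrow> real" where
  "power_sum_inv p q a b t = (if admissible a b \<and> 0 < t then THE u. 0 < u \<and> power_sum p q a b u = t else 0)"

definition power_sum_inv_deriv :: "real \<Rightarrow> real \<Rightarrow> real \<Rightarrow> real \<Rightarrow> real \<Rightarrow> real" where
  "power_sum_inv_deriv p q a b t =
     (if admissible a b \<and> 0 < t then inverse (power_sum_deriv p q a b (power_sum_inv p q a b t)) else 0)"

context
  fixes p q :: real
  assumes p: "1 \<le> p" and q: "1 \<le> q"
begin

lemma power_sum_strict_mono: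
  assumes "admissible a b" "0 \<le> u" "u < v"
  shows "power_sum p q a b u < power_sum p q a b v"
proof -
  have *: "u powr p < v powr p" "u powr q < v powr q"
    using assms p q by (auto intro!: powr_less_mono2)
  consider "a > 0" "b \<ge> 0" | "b > 0" "a \<ge> 0" using assms(1) unfolding admissible_def by fastforce
  then show ?thesis
  proof cases
    case 1
    then show ?thesis using * unfolding power_sum_def by (intro add_less_le_mono mult_strict_left_mono mult_left_mono) auto
  next
    case 2
    then show ?thesis using * unfolding power_sum_def by (intro add_le_less_mono mult_strict_left_mono mult_left_mono) auto
  qed
qed

lemma power_sum_less_iff:
  assumes "admissible a b" "0 \<le> u" "0 \<le> v"
  shows "power_sum p q a b u < power_sum p q a b v \<longleftrightarrow> u < v"
  using power_sum_strict_mono[OF assms(1), of u v] power_sum_strict_mono[OF assms(1), of v u] assms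
  by (cases u v rule: linorder_cases) auto

lemma power_sum_0: "power_sum p q a b 0 = 0"
  using p q by (simp add: power_sum_def)

text \<open>Growth at least linear, because both exponents are at least 1. It yields a bracket for
  the intermediate value theorem here and an exponential tail in u later.\<close>

lemma power_sum_ge:
  assumes "admissible a b" "1 \<le> u"
  shows "(a + b) * u \<le> power_sum p q a b u"
proof -
  have "u powr 1 \<le> u powr p" "u powr 1 \<le> u powr q"
    using powr_mono[of 1 p u] powr_mono[of 1 q u] assms p q by auto
  then have "u \<le> u powr p" "u \<le> u powr q" using assms by simp_all
  then have "a * u \<le> a * u powr p" "b * u \<le> b * u powr q"
    using assms by (auto simp: admissible_def intro!: mult_left_mono)
  then show ?thesis by (simp add: power_sum_def distrib_right)
qed

lemma continuous_on_power_sum: "continuous_on {0..} (power_sum p q a b)"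
  unfolding power_sum_def using p q by (intro continuous_on_add continuous_on_mult continuous_on_powr' continuous_on_const continuous_on_id) auto

lemma power_sum_inv_unique:
  assumes ab: "admissible a b" and t: "0 < t"
  shows "\<exists>!u. 0 < u \<and> power_sum p q a b u = t"
proof -
  \<comment> \<open>The 1 makes \<open>power_sum_ge\<close> applicable, the quotient makes the
    linear bound reach t.\<close>
  define U where "U = max 1 (t / (a + b))"
  have "t = (a + b) * (t / (a + b))" using ab by (simp add: admissible_def)
  also have "\<dots> \<le> (a + b) * U" using ab unfolding U_def admissible_def by (intro mult_left_mono) auto
  also have "\<dots> \<le> power_sum p q a b U" using ab by (intro power_sum_ge) (auto simp: U_def)
  finally have "t \<le> power_sum p q a b U" .
  moreover have U0: "0 \<le> U" unfolding U_def by simp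
  moreover have "continuous_on {0..U} (power_sum p q a b)"
    by (rule continuous_on_subset[OF continuous_on_power_sum]) auto
  ultimately obtain u where u: "0 \<le> u" "power_sum p q a b u = t"
    using IVT'[of "power_sum p q a b" 0 t U] t U0 by (auto simp: power_sum_0)
  moreover have "u \<noteq> 0" using u(2) t power_sum_0[of a b] by auto
  ultimately have "0 < u \<and> power_sum p q a b u = t" by simp
  moreover have "v = u" if "0 < v \<and> power_sum p q a b v = t" for v
    using that u power_sum_strict_mono[OF ab, of u v] power_sum_strict_mono[OF ab, of v u]
    by (cases u v rule: linorder_cases) auto
  ultimately show ?thesis by blast
qed

lemma power_sum_inv:
  assumes "admissible a b" "0 < t"
  shows "0 < power_sum_inv p q a b t" "power_sum p q a b (power_sum_inv p q a b t) = t"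
  using theI'[OF power_sum_inv_unique[OF assms]] assms by (auto simp: power_sum_inv_def)

lemma power_sum_inv_nonneg: "0 \<le> power_sum_inv p q a b t"
  using power_sum_inv(1)[of a b t] by (cases "admissible a b \<and> 0 < t") (auto simp: power_sum_inv_def)

lemma power_sum_inv_0: "power_sum_inv p q a b 0 = 0"
  by (simp add: power_sum_inv_def)

lemma less_power_sum_inv_iff:
  assumes "admissible a b" "0 < t" "0 \<le> u"
  shows "u < power_sum_inv p q a b t \<longleftrightarrow> power_sum p q a b u < t"
  using power_sum_less_iff[OF assms(1,3), of "power_sum_inv p q a b t"] power_sum_inv[OF assms(1,2)] by auto

lemma power_sum_inv_less_iff:
  assumes "admissible a b" "0 < t" "0 \<le> u"
  shows "power_sum_inv p q a b t < u \<longleftrightarrow> t < power_sum p q a b u"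
  using power_sum_less_iff[OF assms(1), of "power_sum_inv p q a b t" u] power_sum_inv[OF assms(1,2)] assms(3) by auto

lemma le_power_sum_inv_iff:
  assumes "admissible a b" "0 < t" "0 \<le> u"
  shows "u \<le> power_sum_inv p q a b t \<longleftrightarrow> power_sum p q a b u \<le> t"
  using power_sum_inv_less_iff[OF assms] by (auto simp: not_less[symmetric])

lemma power_sum_inv_mono:
  assumes "s \<le> t"
  shows "power_sum_inv p q a b s \<le> power_sum_inv p q a b t"
proof (cases "admissible a b \<and> 0 < s")
  case True
  then show ?thesis using assms power_sum_inv[of a b s] by (subst le_power_sum_inv_iff) auto
next
  case False
  then have "power_sum_inv p q a b s = 0" by (auto simp: power_sum_inv_def)
  then show ?thesis using power_sum_inv_nonneg by simp
qed

text \<open>Multiplying the derivative by u weights the two powers by p and q, each at least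
  1.\<close>

lemma power_sum_deriv_ge:
  assumes "admissible a b" "0 < u"
  shows "power_sum p q a b u / u \<le> power_sum_deriv p q a b u"
proof -
  have "u * power_sum_deriv p q a b u = p * (a * u powr p) + q * (b * u powr q)"
    using assms by (simp add: power_sum_deriv_def powr_diff algebra_simps)
  also have "\<dots> \<ge> 1 * (a * u powr p) + 1 * (b * u powr q)"
    using assms p q by (intro add_mono mult_right_mono) (auto simp: admissible_def)
  finally show ?thesis using assms by (simp add: power_sum_def field_simps)
qed

lemma power_sum_pos:
  assumes "admissible a b" "0 < u"
  shows "0 < power_sum p q a b u"
  using power_sum_strict_mono[of a b 0 u] assms power_sum_0 by simp

lemma power_sum_deriv_pos:
  assumes "admissible a b" "0 < u"
  shows "0 < power_sum_deriv p q a b u"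
  using power_sum_deriv_ge[OF assms] power_sum_pos[OF assms] assms(2)
  by (meson divide_pos_pos less_le_trans)

lemma isCont_power_sum_inv:
  assumes t: "0 < t"
  shows "isCont (power_sum_inv p q a b) t"
proof (cases "admissible a b")
  case ab: True
  show ?thesis unfolding isCont_def
  proof (rule order_tendstoI)
    fix c assume c: "c < power_sum_inv p q a b t"
    show "\<forall>\<^sub>F s in at t. c < power_sum_inv p q a b s"
    proof (cases "c < 0")
      case True
      show ?thesis
        by (intro always_eventually allI less_le_trans[OF True power_sum_inv_nonneg])
    next
      case False
      \<comment> \<open>The maximum with 0 keeps s positive as well, as the order equivalence
        demands.\<close>
      then have "max 0 (power_sum p q a b c) < t" using c ab t by (simp add: less_power_sum_inv_iff)
      then have "\<forall>\<^sub>F s in at t. max 0 (power_sum p q a b c) < s"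
        by (rule order_tendstoD(1)[OF tendsto_ident_at])
      then show ?thesis by eventually_elim (use False ab in \<open>auto simp: less_power_sum_inv_iff\<close>)
    qed
  next
    fix c assume c: "power_sum_inv p q a b t < c"
    then have c0: "0 \<le> c" using power_sum_inv_nonneg[of a b t] by simp
    then have "t < power_sum p q a b c" using c ab t by (simp add: power_sum_inv_less_iff)
    then have "\<forall>\<^sub>F s in at t. s < power_sum p q a b c"
      by (rule order_tendstoD(2)[OF tendsto_ident_at])
    moreover have "\<forall>\<^sub>F s in at t. 0 < s" using t by (rule order_tendstoD(1)[OF tendsto_ident_at])
    ultimately show "\<forall>\<^sub>F s in at t. power_sum_inv p q a b s < c"
      by eventually_elim (use c0 ab in \<open>auto simp: power_sum_inv_less_iff\<close>)
  qed
next
  case False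
  then have "power_sum_inv p q a b = (\<lambda>_. 0)" by (auto simp: power_sum_inv_def)
  then show ?thesis by simp
qed

lemma DERIV_power_sum_inv:
  assumes t: "0 < t"
  shows "(power_sum_inv p q a b has_real_derivative power_sum_inv_deriv p q a b t) (at t)"
proof (cases "admissible a b")
  case ab: True
  let ?z = "power_sum_inv p q a b t"
  have z: "0 < ?z" using power_sum_inv ab t by simp
  have "(power_sum p q a b has_real_derivative power_sum_deriv p q a b ?z) (at ?z)"
    unfolding power_sum_def power_sum_deriv_def
    using z by (auto intro!: derivative_eq_intros simp: powr_diff field_simps)
  then have "(power_sum_inv p q a b has_real_derivative inverse (power_sum_deriv p q a b ?z)) (at t)"
    using power_sum_deriv_pos[OF ab z] t ab
    by (intro DERIV_inverse_function[where f = "power_sum p q a b" and a = 0 and b = "t + 1"] isCont_power_sum_inv power_sum_inv(2)) auto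
  then show ?thesis using ab t by (simp add: power_sum_inv_deriv_def)
next
  case False
  then have "power_sum_inv p q a b = (\<lambda>_. 0)" by (auto simp: power_sum_inv_def)
  then show ?thesis using False by (simp add: power_sum_inv_deriv_def)
qed

lemma power_sum_inv_deriv_nonneg: "0 \<le> power_sum_inv_deriv p q a b t"
  using power_sum_deriv_pos[of a b "power_sum_inv p q a b t"] power_sum_inv(1)[of a b t]
  by (auto simp: power_sum_inv_deriv_def less_imp_le)

text \<open>The reciprocal of \<open>power_sum_deriv_ge\<close> at the point where
  \<open>power_sum\<close> takes the value t. This replaces an explicit estimate of the derivative
  by one of the inverse itself, whose mean is computable.\<close>

lemma power_sum_inv_deriv_le:
  assumes t: "0 < t"
  shows "power_sum_inv_deriv p q a b t \<le> power_sum_inv p q a b t / t"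
proof (cases "admissible a b")
  case ab: True
  let ?z = "power_sum_inv p q a b t"
  have z: "0 < ?z" "power_sum p q a b ?z = t" using power_sum_inv ab t by simp_all
  have "t / ?z \<le> power_sum_deriv p q a b ?z" using power_sum_deriv_ge[OF ab z(1)] z by simp
  then have "inverse (power_sum_deriv p q a b ?z) \<le> inverse (t / ?z)"
    using t z by (intro le_imp_inverse_le) auto
  then show ?thesis using ab t by (simp add: power_sum_inv_deriv_def)
next
  case False
  then show ?thesis by (simp add: power_sum_inv_deriv_def power_sum_inv_def)
qed

lemma isCont_power_sum_inv_deriv:
  assumes t: "0 < t"
  shows "isCont (power_sum_inv_deriv p q a b) t"
proof (cases "admissible a b")
  case ab: True
  let ?z = "power_sum_inv p q a b"
  have "((\<lambda>s. inverse (power_sum_deriv p q a b (?z s))) \<longlongrightarrow> inverse (power_sum_deriv p q a b (?z t))) (at t)"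
    using power_sum_deriv_pos[OF ab power_sum_inv(1)[OF ab t]] power_sum_inv(1)[OF ab t]
      isCont_power_sum_inv[OF t, of a b]
    unfolding power_sum_deriv_def isCont_def
    by (intro tendsto_intros) auto
  moreover have "\<forall>\<^sub>F s in at t. 0 < s" using t by (rule order_tendstoD(1)[OF tendsto_ident_at])
  then have "\<forall>\<^sub>F s in at t. inverse (power_sum_deriv p q a b (?z s)) = power_sum_inv_deriv p q a b s"
    by eventually_elim (use ab in \<open>auto simp: power_sum_inv_deriv_def\<close>)
  ultimately have "(power_sum_inv_deriv p q a b \<longlongrightarrow> inverse (power_sum_deriv p q a b (?z t))) (at t)"
    by (rule Lim_transform_eventually)
  then show ?thesis using ab t by (simp add: isCont_def power_sum_inv_deriv_def)
next
  case False
  then have "power_sum_inv_deriv p q a b = (\<lambda>_. 0)" by (auto simp: power_sum_inv_deriv_def)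
  then show ?thesis by simp
qed

text \<open>For a positive level u, the inverse is at least u exactly under an explicit inequality
  in the three arguments, so joint measurability follows although the value is given by a definite
  description.\<close>

lemma measurable_power_sum_inv:
  assumes [measurable]: "f \<in> borel_measurable M" "g \<in> borel_measurable M" "h \<in> borel_measurable M"
  shows "(\<lambda>x. power_sum_inv p q (f x) (g x) (h x)) \<in> borel_measurable M"
  unfolding borel_measurable_iff_ge
proof
  fix u
  show "{x \<in> space M. u \<le> power_sum_inv p q (f x) (g x) (h x)} \<in> sets M"
  proof (cases "u \<le> 0")
    case True
    then have "{x \<in> space M. u \<le> power_sum_inv p q (f x) (g x) (h x)} = space M"
      using power_sum_inv_nonneg order_trans by blast
    then show ?thesis by simp
  next
    case False
    have "u \<le> power_sum_inv p q (f x) (g x) (h x) \<longleftrightarrow>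
        0 \<le> f x \<and> 0 \<le> g x \<and> 0 < f x + g x \<and> 0 < h x \<and> f x * u powr p + g x * u powr q \<le> h x" for x
    proof (cases "admissible (f x) (g x) \<and> 0 < h x")
      case True
      then show ?thesis using False by (simp add: le_power_sum_inv_iff power_sum_def admissible_def)
    next
      case b: False
      then show ?thesis using False by (auto simp: power_sum_inv_def admissible_def)
    qed
    note iff = this
    have "{x \<in> space M. 0 \<le> f x \<and> 0 \<le> g x \<and> 0 < f x + g x \<and> 0 < h x \<and> f x * c + g x * d \<le> h x} \<in> sets M" for c d
      by measurable
    then show ?thesis by (simp only: iff)
  qed
qed

lemma measurable_power_sum_inv_deriv:
  assumes [measurable]: "f \<in> borel_measurable M" "g \<in> borel_measurable M" "h \<in> borel_measurable M"
  shows "(\<lambda>x. power_sum_inv_deriv p q (f x) (g x) (h x)) \<in> borel_measurable M"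
proof -
  note measurable_power_sum_inv[OF assms, measurable]
  show ?thesis unfolding power_sum_inv_deriv_def power_sum_deriv_def admissible_def by measurable
qed

end

section \<open>Laplace transforms and fractional integrals\<close>

text \<open>For nonnegative functions a gauge integral is absolutely convergent, which makes the
  known exponential and Gamma integrals available as Lebesgue integrals.\<close>

lemma nonneg_has_integral_lborel:
  fixes f :: "real \<Rightarrow> real"
  assumes I: "(f has_integral I) S" and [measurable]: "S \<in> sets borel" "f \<in> borel_measurable borel"
    and nonneg: "\<And>x. x \<in> S \<Longrightarrow> 0 \<le> f x"
  shows "set_integrable lborel S f" and "(LINT x:S|lborel. f x) = I"
proof -
  have nn: "(\<integral>\<^sup>+x. ennreal (indicator S x * f x) \<partial>lborel) = ennreal I"
    using nn_integral_has_integral_lebesgue[OF nonneg I] by simp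
  have I0: "0 \<le> I" using has_integral_nonneg[OF I nonneg] .
  have 0: "\<And>x. 0 \<le> indicator S x * f x" using nonneg by (simp add: indicator_def)
  show i: "set_integrable lborel S f"
    unfolding set_integrable_def by (rule integrableI_nn_integral_finite[where x = I]) (use 0 nn I0 in auto)
  have "(LINT x:S|lborel. f x) = enn2real (\<integral>\<^sup>+x. ennreal (indicator S x * f x) \<partial>lborel)"
    unfolding set_lebesgue_integral_def using 0 by (subst integral_eq_nn_integral) auto
  then show "(LINT x:S|lborel. f x) = I" using nn I0 by simp
qed

lemma has_integral_greaterThan_iff:
  fixes f :: "real \<Rightarrow> real"
  shows "(f has_integral I) {s<..} \<longleftrightarrow> (f has_integral I) {s..}"
  by (rule has_integral_spike_set_eq; rule negligible_subset[of "{s}"]) auto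

lemma set_integrable_exp_minus:
  fixes w :: real
  assumes "w > 0"
  shows "set_integrable lborel {s..} (\<lambda>x. exp (- w * x))"
    and "(LINT x:{s..}|lborel. exp (- w * x)) = exp (- w * s) / w"
    and "set_integrable lborel {s<..} (\<lambda>x. exp (- w * x))"
    and "(LINT x:{s<..}|lborel. exp (- w * x)) = exp (- w * s) / w"
  using has_integral_exp_minus_to_infinity[OF assms, of s]
  by (auto intro!: nonneg_has_integral_lborel simp: has_integral_greaterThan_iff)

lemma set_integrable_powr_exp_minus:
  fixes a z :: real
  assumes a: "a > 0" and z: "z > 0"
  shows "set_integrable lborel {0<..} (\<lambda>t. exp (- z * t) * t powr (a - 1))" (is ?i)
    and "(LINT t:{0<..}|lborel. exp (- z * t) * t powr (a - 1)) = Gamma a * z powr (- a)" (is "?l = _")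
proof -
  define F where "F t = indicator {0<..} t * (t powr (a - 1) / exp t)" for t :: real
  have "((\<lambda>t. t powr (a - 1) / exp t) has_integral Gamma a) {0<..}"
    using Gamma_integral_real[OF a] by (simp add: has_integral_greaterThan_iff)
  from nonneg_has_integral_lborel[OF this]
  have F: "integrable lborel F" "integral\<^sup>L lborel F = Gamma a"
    unfolding F_def set_integrable_def set_lebesgue_integral_def by auto
  have eq: "F (0 + z * t) = z powr (a - 1) * (indicator {0<..} t * (exp (- z * t) * t powr (a - 1)))" for t
    unfolding F_def using z by (auto simp: indicator_def powr_mult exp_minus field_simps zero_less_mult_iff)
  have "integrable lborel (\<lambda>t. F (0 + z * t))"
    using lborel_integrable_real_affine[OF F(1), of z 0] z by simp
  then have "integrable lborel (\<lambda>t. z powr (a - 1) * (indicator {0<..} t * (exp (- z * t) * t powr (a - 1))))"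
    unfolding eq .
  then show ?i unfolding set_integrable_def using z by simp
  have "Gamma a = z * (\<integral>t. F (0 + z * t) \<partial>lborel)"
    using lborel_integral_real_affine[of z F 0] z F(2) by simp
  also have "\<dots> = z * (z powr (a - 1) * ?l)"
    unfolding eq set_lebesgue_integral_def by simp
  also have "\<dots> = z powr a * ?l" using z by (simp add: powr_diff)
  finally show "?l = Gamma a * z powr (- a)" using z by (simp add: powr_minus field_simps)
qed

section \<open>Limits and derivatives under the integral sign\<close>

text \<open>Reduced to sequences converging to t0; the domination holds only near t0, so an initial
  segment of each sequence is shifted away.\<close>

lemma tendsto_integral_dominated_at:
  fixes X :: "real \<Rightarrow> 'a \<Rightarrow> real"
  assumes ev: "\<forall>\<^sub>F t in at t0. X t \<in> borel_measurable M \<and> (AE x in M. \<bar>X t x\<bar> \<le> W x)"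
    and [measurable]: "f \<in> borel_measurable M" and W: "integrable M W"
    and lim: "AE x in M. ((\<lambda>t. X t x) \<longlongrightarrow> f x) (at t0)"
  shows "((\<lambda>t. \<integral>x. X t x \<partial>M) \<longlongrightarrow> (\<integral>x. f x \<partial>M)) (at t0)"
  unfolding tendsto_at_iff_sequentially
proof (intro allI impI)
  fix S assume S: "\<forall>i. S i \<in> UNIV - {t0}" "S \<longlonglongrightarrow> t0"
  then have fl: "filterlim S (at t0) sequentially"
    by (auto simp: filterlim_at)
  from filterlim_iff[THEN iffD1, OF fl, rule_format, OF ev]
  obtain N where N: "\<And>n. N \<le> n \<Longrightarrow> X (S n) \<in> borel_measurable M \<and> (AE x in M. \<bar>X (S n) x\<bar> \<le> W x)"
    by (auto simp: eventually_sequentially)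
  have "(\<lambda>n. \<integral>x. X (S (n + N)) x \<partial>M) \<longlonglongrightarrow> (\<integral>x. f x \<partial>M)"
  proof (rule integral_dominated_convergence[OF _ _ W])
    show "AE x in M. (\<lambda>n. X (S (n + N)) x) \<longlonglongrightarrow> f x"
      using lim
    proof eventually_elim
      case (elim x)
      from filterlim_compose[OF elim fl] show ?case by (rule LIMSEQ_ignore_initial_segment)
    qed
  qed (use N in auto)
  then show "((\<lambda>t. \<integral>x. X t x \<partial>M) \<circ> S) \<longlonglongrightarrow> (\<integral>x. f x \<partial>M)"
    unfolding o_def by (rule LIMSEQ_offset)
qed

text \<open>By the mean value inequality the bound on \<open>X'\<close> is also a bound on the
  difference quotients, so dominated convergence applies to them.\<close>

lemma DERIV_integral_dominated:
  fixes X X' :: "real \<Rightarrow> 'a \<Rightarrow> real"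
  assumes t0: "r < t0" "t0 < s"
    and X: "\<And>t. r < t \<Longrightarrow> t < s \<Longrightarrow> integrable M (X t)"
    and X' [measurable]: "X' t0 \<in> borel_measurable M"
    and deriv: "\<And>t x. r < t \<Longrightarrow> t < s \<Longrightarrow> x \<in> space M \<Longrightarrow> ((\<lambda>t. X t x) has_real_derivative X' t x) (at t)"
    and bound: "\<And>t x. r < t \<Longrightarrow> t < s \<Longrightarrow> x \<in> space M \<Longrightarrow> \<bar>X' t x\<bar> \<le> W x" and W: "integrable M W"
  shows "((\<lambda>t. \<integral>x. X t x \<partial>M) has_real_derivative (\<integral>x. X' t0 x \<partial>M)) (at t0)"
proof -
  let ?Q = "\<lambda>t x. (X t x - X t0 x) / (t - t0)"
  have ne: "\<forall>\<^sub>F t in at t0. r < t \<and> t < s \<and> t \<noteq> t0"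
    using order_tendstoD(1)[OF tendsto_ident_at t0(1), of UNIV] order_tendstoD(2)[OF tendsto_ident_at t0(2), of UNIV]
    by (auto simp: eventually_at_filter elim: eventually_elim2)
  have "((\<lambda>t. \<integral>x. ?Q t x \<partial>M) \<longlongrightarrow> (\<integral>x. X' t0 x \<partial>M)) (at t0)"
  proof (rule tendsto_integral_dominated_at[OF _ X' W])
    show "\<forall>\<^sub>F t in at t0. ?Q t \<in> borel_measurable M \<and> (AE x in M. \<bar>?Q t x\<bar> \<le> W x)"
      using ne
    proof eventually_elim
      case (elim t)
      have [measurable]: "X t \<in> borel_measurable M" "X t0 \<in> borel_measurable M" using X elim t0 by auto
      have "\<bar>?Q t x\<bar> \<le> W x" if x: "x \<in> space M" for x
      proof -
        have "norm (X t x - X t0 x) \<le> W x * norm (t - t0)"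
        proof (rule field_differentiable_bound[where S = "{r<..<s}"])
          show "\<And>z. z \<in> {r<..<s} \<Longrightarrow> ((\<lambda>t. X t x) has_field_derivative X' z x) (at z within {r<..<s})"
            using deriv x by (auto intro: has_field_derivative_at_within)
        qed (use elim t0 bound x in auto)
        then show ?thesis using elim by (simp add: divide_le_eq abs_divide)
      qed
      then show ?case by auto
    qed
    show "AE x in M. ((\<lambda>t. ?Q t x) \<longlongrightarrow> X' t0 x) (at t0)"
      using deriv[OF t0] by (auto simp: has_field_derivative_iff)
  qed
  moreover have "\<forall>\<^sub>F t in at t0. (\<integral>x. ?Q t x \<partial>M) = ((\<integral>x. X t x \<partial>M) - (\<integral>x. X t0 x \<partial>M)) / (t - t0)"
    using ne by eventually_elim (use X t0 in simp)
  ultimately show ?thesis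
    unfolding has_field_derivative_iff by (rule Lim_transform_eventually)
qed

section \<open>Convolutions on the half-line and fractional integrals\<close>

text \<open>With the kernel s^(-\<alpha>) this is Gamma (1 - \<alpha>) times the Riemann-Liouville
  integral of order 1 - \<alpha>, hence, applied to a derivative, an unnormalized Caputo derivative.
  With the kernel 1 it is the antiderivative.\<close>

definition fun_convolution :: "(real \<Rightarrow> real) \<Rightarrow> (real \<Rightarrow> real) \<Rightarrow> real \<Rightarrow> real" where
  "fun_convolution k h t = (LINT y:{0<..<t}|lborel. k (t - y) * h y)"

text \<open>The weight exp (-zt) splits over t - y and y. Extended by 0 to the line, the weighted
  functions are convolved over all of it, and Fubini with translation invariance separates the
  factors.\<close>

lemma laplace_convolution:
  fixes k h :: "real \<Rightarrow> real"
  assumes [measurable]: "k \<in> borel_measurable borel" "h \<in> borel_measurable borel"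
    and k: "set_integrable lborel {0<..} (\<lambda>t. exp (- z * t) * k t)"
    and h: "set_integrable lborel {0<..} (\<lambda>t. exp (- z * t) * h t)"
  shows "set_integrable lborel {0<..} (\<lambda>t. exp (- z * t) * fun_convolution k h t)"
    and "(LINT t:{0<..}|lborel. exp (- z * t) * fun_convolution k h t)
      = (LINT t:{0<..}|lborel. exp (- z * t) * k t) * (LINT t:{0<..}|lborel. exp (- z * t) * h t)"
proof -
  define K where "K s = indicator {0<..} s * (exp (- z * s) * k s)" for s
  define H where "H s = indicator {0<..} s * (exp (- z * s) * h s)" for s
  have [measurable]: "K \<in> borel_measurable borel" "H \<in> borel_measurable borel" unfolding K_def H_def by measurable
  have K: "integrable lborel K" and H: "integrable lborel H"
    using k h unfolding K_def H_def set_integrable_def by simp_all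
  have shift: "integrable lborel (\<lambda>t. K (t - y))" "(\<integral>t. K (t - y) \<partial>lborel) = integral\<^sup>L lborel K"
    "(\<integral>t. \<bar>K (t - y)\<bar> \<partial>lborel) = (\<integral>t. \<bar>K t\<bar> \<partial>lborel)" for y
    using lborel_integrable_real_affine[OF K, of 1 "- y"] lborel_integral_real_affine[of 1 K "- y"]
      lborel_integral_real_affine[of 1 "\<lambda>t. \<bar>K t\<bar>" "- y"]
    by simp_all
  have I: "integrable (lborel \<Otimes>\<^sub>M lborel) (\<lambda>(y, t). K (t - y) * H y)"
  proof (rule lborel_pair.Fubini_integrable)
    show "integrable lborel (\<lambda>y. \<integral>t. norm (case (y, t) of (y, t) \<Rightarrow> K (t - y) * H y) \<partial>lborel)"
      using H by (simp add: abs_mult shift)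
  qed (auto simp: shift)
  have inner: "(\<integral>y. K (t - y) * H y \<partial>lborel) = indicator {0<..} t * (exp (- z * t) * fun_convolution k h t)" for t
  proof -
    have "K (t - y) * H y = indicator {0<..} t * (exp (- z * t) * (indicator {0<..<t} y * (k (t - y) * h y)))" for y
    proof -
      have "exp (- z * t) = exp (- z * (t - y)) * exp (- z * y)"
        by (simp add: exp_add[symmetric] algebra_simps)
      then show ?thesis unfolding K_def H_def by (simp add: indicator_def mult_ac)
    qed
    then show ?thesis by (simp add: fun_convolution_def set_lebesgue_integral_def)
  qed
  show "set_integrable lborel {0<..} (\<lambda>t. exp (- z * t) * fun_convolution k h t)"
    using lborel_pair.integrable_snd[OF I] by (simp add: inner set_integrable_def)
  have "(LINT t:{0<..}|lborel. exp (- z * t) * fun_convolution k h t) = (\<integral>t. \<integral>y. K (t - y) * H y \<partial>lborel \<partial>lborel)"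
    by (simp add: inner set_lebesgue_integral_def)
  also have "\<dots> = (\<integral>y. \<integral>t. K (t - y) * H y \<partial>lborel \<partial>lborel)"
    by (rule lborel_pair.Fubini_integral[OF I])
  also have "\<dots> = integral\<^sup>L lborel K * integral\<^sup>L lborel H"
    by (simp add: shift)
  finally show "(LINT t:{0<..}|lborel. exp (- z * t) * fun_convolution k h t)
      = (LINT t:{0<..}|lborel. exp (- z * t) * k t) * (LINT t:{0<..}|lborel. exp (- z * t) * h t)"
    by (simp add: K_def[abs_def] H_def[abs_def] set_lebesgue_integral_def)
qed

context
  fixes h :: "real \<Rightarrow> real" and \<alpha> a C :: real
  assumes \<alpha>: "\<alpha> < 1" and a: "0 < a" "a \<le> 1"
    and hm [measurable]: "h \<in> borel_measurable borel"
    and bound: "\<And>y. 0 < y \<Longrightarrow> \<bar>h y\<bar> \<le> C * y powr (a - 1)"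
begin

text \<open>The integrand of the Beta function with parameters a and 1 - \<alpha>: one singularity
  comes from the bound on h at 0, the other from the kernel at the upper end.\<close>

lemma beta_kernel_integrable:
  "integrable lborel (\<lambda>v. indicator {0<..<1} v * (D * (v powr (a - 1) * (1 - v) powr (- \<alpha>))))"
proof -
  have "set_integrable lborel {0<..<1} (\<lambda>v. v powr (a - 1) * (1 - v) powr ((1 - \<alpha>) - 1))"
    by (rule set_integrable_subset[OF integrable_Beta]) (use \<alpha> a in auto)
  then have "set_integrable lborel {0<..<1} (\<lambda>v. D * (v powr (a - 1) * (1 - v) powr (- \<alpha>)))"
    by simp
  then show ?thesis unfolding set_integrable_def by simp
qed

lemma kernel_bound_nonneg: "0 \<le> C"
  using bound[of 1] by simp

text \<open>Substituting y = t v moves the dependence on t out of the domain and the kernel into the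
  argument of h, so that the singularity of the kernel stays at v = 1.\<close>

lemma fractional_scaling:
  assumes t: "0 < t"
  shows "indicator {0<..<t} (t * v) * ((t - t * v) powr (- \<alpha>) * h (t * v))
    = t powr (- \<alpha>) * (indicator {0<..<1} v * ((1 - v) powr (- \<alpha>) * h (t * v)))"
proof -
  have "(t - t * v) powr (- \<alpha>) = t powr (- \<alpha>) * (1 - v) powr (- \<alpha>)" if "v < 1"
    using that t powr_mult[of t "1 - v" "- \<alpha>"] by (simp add: right_diff_distrib)
  then show ?thesis using t by (auto simp: indicator_def zero_less_mult_iff)
qed

lemma fractional_bound:
  assumes t: "0 < r" "r \<le> t"
  shows "\<bar>indicator {0<..<1} v * ((1 - v) powr (- \<alpha>) * h (t * v))\<bar>
    \<le> indicator {0<..<1} v * (C * r powr (a - 1) * (v powr (a - 1) * (1 - v) powr (- \<alpha>)))"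
proof (cases "0 < v \<and> v < 1")
  case True
  have "\<bar>h (t * v)\<bar> \<le> C * (t * v) powr (a - 1)" using bound[of "t * v"] True t by simp
  also have "\<dots> = C * (t powr (a - 1) * v powr (a - 1))" using True t by (simp add: powr_mult)
  \<comment> \<open>As a \<le> 1, the power is nonincreasing in t, which gives one dominating
    function for all t \<ge> r.\<close>
  also have "\<dots> \<le> C * (r powr (a - 1) * v powr (a - 1))"
    using t a kernel_bound_nonneg by (intro mult_left_mono mult_right_mono powr_mono2') auto
  finally have "(1 - v) powr (- \<alpha>) * \<bar>h (t * v)\<bar> \<le> (1 - v) powr (- \<alpha>) * (C * (r powr (a - 1) * v powr (a - 1)))"
    by (intro mult_left_mono) auto
  then show ?thesis using True by (simp add: abs_mult mult_ac)
next
  case False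
  then show ?thesis by (auto simp: indicator_def)
qed

lemma fractional_unit_integrable:
  assumes t: "0 < t"
  shows "integrable lborel (\<lambda>v. indicator {0<..<1} v * ((1 - v) powr (- \<alpha>) * h (t * v)))"
proof (rule Bochner_Integration.integrable_bound[OF beta_kernel_integrable])
  show "AE v in lborel. norm (indicator {0<..<1} v * ((1 - v) powr (- \<alpha>) * h (t * v)))
    \<le> norm (indicator {0<..<1} v * (C * t powr (a - 1) * (v powr (a - 1) * (1 - v) powr (- \<alpha>))))"
    unfolding real_norm_def by (intro AE_I2 order_trans[OF fractional_bound[OF t order_refl] abs_ge_self])
qed simp

lemma fractional_integrable:
  assumes t: "0 < t"
  shows "set_integrable lborel {0<..<t} (\<lambda>y. (t - y) powr (- \<alpha>) * h y)"
proof -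
  have "integrable lborel (\<lambda>v. indicator {0<..<t} (0 + t * v) * ((t - (0 + t * v)) powr (- \<alpha>) * h (0 + t * v)))"
    using fractional_unit_integrable[OF t] t by (simp add: fractional_scaling)
  then show ?thesis
    unfolding set_integrable_def
    using lborel_integrable_real_affine_iff[of t "\<lambda>y. indicator {0<..<t} y * ((t - y) powr (- \<alpha>) * h y)" 0] t
    by simp
qed

lemma continuous_on_fractional_integral:
  assumes h: "continuous_on {0<..} h"
  shows "continuous_on {0<..} (fun_convolution (\<lambda>s. s powr (- \<alpha>)) h)"
proof -
  define J where "J t = (\<integral>v. indicator {0<..<1} v * ((1 - v) powr (- \<alpha>) * h (t * v)) \<partial>lborel)" for t
  have eq: "fun_convolution (\<lambda>s. s powr (- \<alpha>)) h t = t * (t powr (- \<alpha>) * J t)" if t: "0 < t" for t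
    unfolding fun_convolution_def set_lebesgue_integral_def
    using lborel_integral_real_affine[of t "\<lambda>y. indicator {0<..<t} y * ((t - y) powr (- \<alpha>) * h y)" 0] t
    by (simp add: fractional_scaling J_def)
  have "isCont J t0" if t0: "0 < t0" for t0
    unfolding isCont_def J_def
  proof (rule tendsto_integral_dominated_at[OF _ _ beta_kernel_integrable])
    have "\<forall>\<^sub>F t in at t0. t0 / 2 < t" using t0 by (intro order_tendstoD(1)[OF tendsto_ident_at]) simp
    then show "\<forall>\<^sub>F t in at t0. (\<lambda>v. indicator {0<..<1} v * ((1 - v) powr (- \<alpha>) * h (t * v))) \<in> borel_measurable lborel \<and>
      (AE v in lborel. \<bar>indicator {0<..<1} v * ((1 - v) powr (- \<alpha>) * h (t * v))\<bar>
        \<le> indicator {0<..<1} v * (C * (t0 / 2) powr (a - 1) * (v powr (a - 1) * (1 - v) powr (- \<alpha>))))"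
    proof eventually_elim
      case (elim t)
      then show ?case using fractional_bound[of "t0 / 2" t] t0 by auto
    qed
    show "AE v in lborel. ((\<lambda>t. indicator {0<..<1} v * ((1 - v) powr (- \<alpha>) * h (t * v)))
        \<longlongrightarrow> indicator {0<..<1} v * ((1 - v) powr (- \<alpha>) * h (t0 * v))) (at t0)"
    proof (rule AE_I2)
      fix v :: real
      show "((\<lambda>t. indicator {0<..<1} v * ((1 - v) powr (- \<alpha>) * h (t * v)))
        \<longlongrightarrow> indicator {0<..<1} v * ((1 - v) powr (- \<alpha>) * h (t0 * v))) (at t0)"
      proof (cases "0 < v")
        case True
        then have "isCont h (t0 * v)" using h t0 by (simp add: continuous_on_eq_continuous_at)
        then have "((\<lambda>t. h (t * v)) \<longlongrightarrow> h (t0 * v)) (at t0)"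
          by (rule isCont_tendsto_compose) (intro tendsto_intros)
        then show ?thesis by (intro tendsto_intros)
      next
        case False
        then show ?thesis by simp
      qed
    qed
  qed measurable
  then have "continuous_on {0<..} J" by (auto intro!: continuous_at_imp_continuous_on)
  then have "continuous_on {0<..} (\<lambda>t. t * (t powr (- \<alpha>) * J t))"
    by (intro continuous_intros) auto
  then show ?thesis by (subst continuous_on_cong[OF refl eq]) auto
qed

end

section \<open>The inverse of the subordinator\<close>

text \<open>The open interval makes the value 0 for y \<le> 0 and lets the antiderivative be a
  convolution with the constant 1.\<close>

definition antideriv :: "(real \<Rightarrow> real) \<Rightarrow> real \<Rightarrow> real" where
  "antideriv g y = (LINT u:{0<..<y}|lborel. g u)"

lemma antideriv_eq_convolution: "antideriv g = fun_convolution (\<lambda>_. 1) g"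
  by (simp add: antideriv_def fun_convolution_def fun_eq_iff)

lemma antideriv_nonpos: "y \<le> 0 \<Longrightarrow> antideriv g y = 0"
  by (simp add: antideriv_def set_lebesgue_integral_def)

context
  fixes g :: "real \<Rightarrow> real" and B :: real
  assumes g: "continuous_on UNIV g" and B: "\<And>y. \<bar>g y\<bar> \<le> B"
begin

lemma antideriv_eq_integral: "antideriv g y = integral {0..y} g"
proof -
  have "set_integrable lborel {0<..<y} g"
    by (rule set_integrable_subset[OF borel_integrable_atLeastAtMost'[of 0 y]])
       (use g in \<open>auto intro: continuous_on_subset\<close>)
  from set_borel_integral_eq_integral(2)[OF this]
  show ?thesis by (simp add: antideriv_def integral_open_interval_real)
qed

lemma DERIV_antideriv:
  assumes "0 < y"
  shows "(antideriv g has_real_derivative g y) (at y)"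
proof -
  have "((\<lambda>x. integral {0..x} g) has_real_derivative g y) (at y within {0..y + 1})"
    using assms g by (intro integral_has_real_derivative) (auto intro: continuous_on_subset)
  then have "((\<lambda>x. integral {0..x} g) has_real_derivative g y) (at y)"
    using assms by (simp add: at_within_Icc_at)
  moreover have "antideriv g = (\<lambda>x. integral {0..x} g)" by (auto simp: antideriv_eq_integral)
  ultimately show ?thesis by simp
qed

lemma antideriv_abs_le: "\<bar>antideriv g y\<bar> \<le> B * max 0 y"
proof (cases "0 \<le> y")
  case True
  have "norm (integral {0..y} g) \<le> B * (y - 0)"
    using True B g by (intro integral_bound) (auto intro: continuous_on_subset)
  then show ?thesis using True by (simp add: antideriv_eq_integral)
next
  case False
  then show ?thesis using B[of 0] by (simp add: antideriv_nonpos)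
qed

lemma continuous_antideriv: "continuous_on UNIV (antideriv g)"
proof -
  have "isCont (antideriv g) y" for y
  proof -
    consider "y < 0" | "y = 0" | "0 < y" by linarith
    then show ?thesis
    proof cases
      case 1
      have "\<forall>\<^sub>F x in at y. antideriv g x = 0"
        using order_tendstoD(2)[OF tendsto_ident_at 1] by (rule eventually_mono) (simp add: antideriv_nonpos)
      then show ?thesis using 1 by (simp add: isCont_def antideriv_nonpos tendsto_eventually)
    next
      case 2
      have "((\<lambda>x. B * max 0 x) \<longlongrightarrow> B * max 0 0) (at 0)" by (intro tendsto_intros)
      then have lim: "((\<lambda>x. B * max 0 x) \<longlongrightarrow> 0) (at 0)" by simp
      have "(antideriv g \<longlongrightarrow> 0) (at 0)"
        by (rule Lim_null_comparison[OF _ lim]) (simp add: antideriv_abs_le)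
      then show ?thesis using 2 by (simp add: isCont_def antideriv_nonpos)
    next
      case 3 then show ?thesis using DERIV_antideriv DERIV_isCont by blast
    qed
  qed
  then show ?thesis by (simp add: continuous_on_eq_continuous_at)
qed

lemma measurable_antideriv: "antideriv g \<in> borel_measurable borel"
  using continuous_antideriv by (rule borel_measurable_continuous_onI)

end

text \<open>\<open>E u\<close> has the law of the subordinator at each single time \<open>u\<close>, but not jointly in \<open>u\<close>.
  If \<open>c1 = 0\<close> or \<open>c2 = 0\<close>, then \<open>a\<close> or \<open>b\<close> vanishes almost surely.\<close>

locale stable_pair = prob_space N for N :: "'n measure" +
  fixes a b :: "'n \<Rightarrow> real" and \<alpha>1 \<alpha>2 c1 c2 :: real
  assumes \<alpha>: "0 < \<alpha>2" "\<alpha>2 < \<alpha>1" "\<alpha>1 < 1"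
    and c: "0 \<le> c1" "0 \<le> c2" "c1 + c2 = 1"
    and am [measurable]: "a \<in> borel_measurable N" and bm [measurable]: "b \<in> borel_measurable N"
    and a_nonneg: "AE \<omega> in N. 0 \<le> a \<omega>" and b_nonneg: "AE \<omega> in N. 0 \<le> b \<omega>"
    and laplace_power_sum: "\<And>u z. 0 < u \<Longrightarrow> 0 < z \<Longrightarrow>
      expectation (\<lambda>\<omega>. exp (- z * power_sum (1 / \<alpha>1) (1 / \<alpha>2) (a \<omega>) (b \<omega>) u))
        = exp (- u * (c1 * z powr \<alpha>1 + c2 * z powr \<alpha>2))"
begin

abbreviation \<phi> :: "real \<Rightarrow> real" where
  "\<phi> z \<equiv> c1 * z powr \<alpha>1 + c2 * z powr \<alpha>2"

abbreviation E :: "real \<Rightarrow> 'n \<Rightarrow> real" where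
  "E u \<omega> \<equiv> power_sum (1 / \<alpha>1) (1 / \<alpha>2) (a \<omega>) (b \<omega>) u"

abbreviation Z :: "real \<Rightarrow> 'n \<Rightarrow> real" where
  "Z t \<omega> \<equiv> power_sum_inv (1 / \<alpha>1) (1 / \<alpha>2) (a \<omega>) (b \<omega>) t"

abbreviation Z' :: "real \<Rightarrow> 'n \<Rightarrow> real" where
  "Z' t \<omega> \<equiv> power_sum_inv_deriv (1 / \<alpha>1) (1 / \<alpha>2) (a \<omega>) (b \<omega>) t"

lemma exponents: "1 \<le> 1 / \<alpha>1" "1 \<le> 1 / \<alpha>2"
  using \<alpha> by (auto simp: field_simps)

lemmas measurable_Z [measurable (raw)] = measurable_power_sum_inv[OF exponents]
lemmas measurable_Z' [measurable (raw)] = measurable_power_sum_inv_deriv[OF exponents]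

lemma measurable_E [measurable (raw)]:
  assumes [measurable]: "f \<in> borel_measurable M" "g \<in> borel_measurable M" "h \<in> borel_measurable M"
  shows "(\<lambda>x. power_sum p q (f x) (g x) (h x)) \<in> borel_measurable M"
  unfolding power_sum_def by measurable

lemma \<phi>_pos: "0 < z \<Longrightarrow> 0 < \<phi> z"
  using c by (cases "c1 = 0") (auto intro!: add_nonneg_pos add_pos_nonneg)

lemma AE_E_nonneg: "AE \<omega> in N. \<forall>u. 0 \<le> E u \<omega>"
  using a_nonneg b_nonneg by eventually_elim (auto simp: power_sum_def)

lemma integrable_exp_E: "0 < z \<Longrightarrow> integrable N (\<lambda>\<omega>. exp (- z * E u \<omega>))"
  using AE_E_nonneg by (intro integrable_const_bound[where B=1]) (auto elim!: eventually_mono)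

lemma expectation_exp_E:
  assumes "0 < u" "0 < z"
  shows "expectation (\<lambda>\<omega>. exp (- z * E u \<omega>)) = exp (- \<phi> z * u)"
proof -
  have "- u * w = - w * u" for w :: real by (simp add: mult.commute)
  then show ?thesis by (simp only: laplace_power_sum[OF assms])
qed

text \<open>Where both variables vanish the exponential of \<open>E 1\<close> equals 1, so the
  probability of this event is at most exp (- \<phi> z) for every z > 0. For z \<ge> 1 the exponent
  \<phi> z is at least z^\<alpha>2 because c1 + c2 = 1, and it tends to infinity.\<close>

lemma AE_admissible: "AE \<omega> in N. admissible (a \<omega>) (b \<omega>)"
proof -
  let ?S = "{\<omega> \<in> space N. a \<omega> = 0 \<and> b \<omega> = 0}"
  have "prob ?S \<le> real (Suc n) powr (- \<alpha>2)" for n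
  proof -
    let ?z = "real (Suc n)"
    have "prob ?S = expectation (indicator ?S)" by simp
    also have "\<dots> \<le> expectation (\<lambda>\<omega>. exp (- ?z * E 1 \<omega>))"
    proof (rule integral_mono_AE)
      show "integrable N (indicat_real ?S)" by (intro integrable_real_indicator) (auto simp: emeasure_eq_measure)
      show "integrable N (\<lambda>\<omega>. exp (- ?z * E 1 \<omega>))" by (rule integrable_exp_E) simp
      show "AE \<omega> in N. indicat_real ?S \<omega> \<le> exp (- ?z * E 1 \<omega>)"
        by (auto simp: indicator_def power_sum_def)
    qed
    also have "\<dots> = exp (- \<phi> ?z)" using laplace_power_sum[of 1 ?z] by simp
    also have "\<dots> \<le> exp (- (?z powr \<alpha>2))"
    proof -
      have "?z powr \<alpha>2 = c1 * ?z powr \<alpha>2 + c2 * ?z powr \<alpha>2"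
        using c by (simp add: distrib_right[symmetric])
      also have "\<dots> \<le> \<phi> ?z" using c \<alpha> by (intro add_right_mono mult_left_mono powr_mono) auto
      finally show ?thesis by simp
    qed
    also have "\<dots> \<le> ?z powr (- \<alpha>2)"
    proof -
      have "?z powr \<alpha>2 \<le> exp (?z powr \<alpha>2)" using exp_ge_add_one_self[of "?z powr \<alpha>2"] by linarith
      then show ?thesis by (simp add: exp_minus powr_minus le_imp_inverse_le del: of_nat_Suc)
    qed
    finally show ?thesis .
  qed
  moreover have "(\<lambda>n. real (Suc n) powr (- \<alpha>2)) \<longlonglongrightarrow> 0"
  proof -
    have "filterlim (\<lambda>n. real (Suc n)) at_top sequentially"
      by (rule filterlim_compose[OF filterlim_real_sequentially filterlim_Suc])
    then show ?thesis using \<alpha> by (intro tendsto_neg_powr) auto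
  qed
  ultimately have "prob ?S \<le> 0" by (intro LIMSEQ_le_const) auto
  then have "AE \<omega> in N. \<omega> \<notin> ?S"
    by (intro AE_not_in) (simp add: null_sets_def emeasure_eq_measure measure_le_0_iff)
  with a_nonneg b_nonneg AE_space show ?thesis
    by eventually_elim (auto simp: admissible_def intro: add_nonneg_pos add_pos_nonneg)
qed

lemma Z_nonneg: "0 \<le> Z t \<omega>"
  by (rule power_sum_inv_nonneg[OF exponents])

text \<open>On the event \<open>E u\<close> < t the product of exp 1 and exp (- \<open>E u\<close> /
  t) is at least 1. Integrating this exponential Markov bound over u > 0 and using the transform of
  \<open>E u\<close> leaves e times the integral of exp (- \<phi> (1/t) u).\<close>

lemma expectation_Z:
  assumes t: "0 < t"
  shows "integrable N (Z t)" and "expectation (Z t) \<le> exp 1 / \<phi> (1 / t)"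
proof -
  let ?w = "\<phi> (1 / t)"
  have w: "0 < ?w" using t by (intro \<phi>_pos) simp
  have "(\<integral>\<^sup>+\<omega>. ennreal (Z t \<omega>) \<partial>N)
      \<le> (\<integral>\<^sup>+\<omega>. \<integral>\<^sup>+u. ennreal (indicator {0<..} u * (exp 1 * exp (- (1 / t) * E u \<omega>))) \<partial>lborel \<partial>N)"
  proof (rule nn_integral_mono_AE)
    show "AE \<omega> in N. ennreal (Z t \<omega>) \<le> (\<integral>\<^sup>+u. ennreal (indicator {0<..} u * (exp 1 * exp (- (1 / t) * E u \<omega>))) \<partial>lborel)"
      using AE_admissible
    proof eventually_elim
      case (elim \<omega>)
      have "ennreal (Z t \<omega>) = (\<integral>\<^sup>+u. indicator {0<..<Z t \<omega>} u \<partial>lborel)" by (simp add: Z_nonneg)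
      also have "\<dots> \<le> (\<integral>\<^sup>+u. ennreal (indicator {0<..} u * (exp 1 * exp (- (1 / t) * E u \<omega>))) \<partial>lborel)"
      proof (rule nn_integral_mono)
        fix u
        show "indicator {0<..<Z t \<omega>} u \<le> ennreal (indicator {0<..} u * (exp 1 * exp (- (1 / t) * E u \<omega>)))"
        proof (cases "0 < u \<and> u < Z t \<omega>")
          case True
          then have "E u \<omega> < t" using less_power_sum_inv_iff[OF exponents elim t, of u] by simp
          then have "1 \<le> exp 1 * exp (- (1 / t) * E u \<omega>)" using t unfolding exp_add[symmetric] by simp
          then show ?thesis using True by simp
        next
          case False then show ?thesis by (auto simp: indicator_def)
        qed
      qed
      finally show ?case .
    qed
  qed
  also have "\<dots> = (\<integral>\<^sup>+u. \<integral>\<^sup>+\<omega>. ennreal (indicator {0<..} u * (exp 1 * exp (- (1 / t) * E u \<omega>))) \<partial>N \<partial>lborel)"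
  proof -
    interpret pair_sigma_finite lborel N ..
    show ?thesis by (rule Fubini') measurable
  qed
  also have "\<dots> = (\<integral>\<^sup>+u. ennreal (indicator {0<..} u * (exp 1 * exp (- ?w * u))) \<partial>lborel)"
  proof (rule nn_integral_cong)
    fix u :: real
    show "(\<integral>\<^sup>+\<omega>. ennreal (indicator {0<..} u * (exp 1 * exp (- (1 / t) * E u \<omega>))) \<partial>N)
        = ennreal (indicator {0<..} u * (exp 1 * exp (- ?w * u)))"
    proof (cases "0 < u")
      case True
      have "(\<integral>\<^sup>+\<omega>. ennreal (exp 1 * exp (- (1 / t) * E u \<omega>)) \<partial>N) = ennreal (expectation (\<lambda>\<omega>. exp 1 * exp (- (1 / t) * E u \<omega>)))"
        using t by (intro nn_integral_eq_integral integrable_mult_right integrable_exp_E) auto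
      also have "\<dots> = ennreal (exp 1 * exp (- ?w * u))"
        using t by (simp only: integral_mult_right_zero expectation_exp_E[OF True] zero_less_divide_1_iff)
      finally show ?thesis using True by simp
    qed simp
  qed
  also have "\<dots> = ennreal (exp 1 / ?w)"
  proof -
    have "(\<integral>\<^sup>+u. ennreal (indicator {0<..} u * (exp 1 * exp (- ?w * u))) \<partial>lborel)
       = ennreal (LINT u:{0<..}|lborel. exp 1 * exp (- ?w * u))"
      unfolding set_lebesgue_integral_def real_scaleR_def
      using set_integrable_mult_right[of "exp 1", OF set_integrable_exp_minus(3)[OF w, of 0]]
      by (intro nn_integral_eq_integral) (auto simp: set_integrable_def)
    then show ?thesis using set_integrable_exp_minus(4)[OF w, of 0] by simp
  qed
  finally have le: "(\<integral>\<^sup>+\<omega>. ennreal (Z t \<omega>) \<partial>N) \<le> ennreal (exp 1 / ?w)" .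
  show i: "integrable N (Z t)"
    using le Z_nonneg by (intro integrableI_bounded) (auto intro: le_less_trans)
  have "ennreal (expectation (Z t)) \<le> ennreal (exp 1 / ?w)"
    using le nn_integral_eq_integral[OF i] Z_nonneg by simp
  then show "expectation (Z t) \<le> exp 1 / \<phi> (1 / t)" using w by simp
qed

text \<open>Since c1 + c2 = 1, one of the coefficients is at least 1/2, and its power alone bounds
  \<phi> (1/t) from below for every t > 0. A single exponent thus serves for small and large
  t.\<close>

lemma expectation_Z_le_powr:
  obtains e K where "0 < e" "e < 1" "0 \<le> K" "\<And>t. 0 < t \<Longrightarrow> expectation (Z t) \<le> K * t powr e"
proof -
  define e where "e = (if c1 \<ge> 1/2 then \<alpha>1 else \<alpha>2)"
  have e: "0 < e" "e < 1" using \<alpha> unfolding e_def by auto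
  have "expectation (Z t) \<le> (2 * exp 1) * t powr e" if t: "0 < t" for t
  proof -
    have "1/2 * (1 / t) powr e \<le> \<phi> (1 / t)"
    proof (cases "c1 \<ge> 1/2")
      case True
      then have "1/2 * (1 / t) powr \<alpha>1 \<le> c1 * (1 / t) powr \<alpha>1" by (intro mult_right_mono) auto
      then show ?thesis using True c by (simp add: e_def add_increasing2)
    next
      case False
      then have "1/2 * (1 / t) powr \<alpha>2 \<le> c2 * (1 / t) powr \<alpha>2" using c by (intro mult_right_mono) auto
      then show ?thesis using False c by (simp add: e_def add_increasing)
    qed
    moreover have "0 < 1/2 * (1 / t) powr e" using t by simp
    ultimately have "exp 1 / \<phi> (1 / t) \<le> exp 1 / (1/2 * (1 / t) powr e)"
      using t by (intro divide_left_mono mult_pos_pos \<phi>_pos) auto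
    also have "\<dots> = 2 * exp 1 * t powr e" using t by (simp add: powr_divide)
    finally show ?thesis using expectation_Z(2)[OF t] by linarith
  qed
  with e show ?thesis by (intro that[of e "2 * exp 1"]) auto
qed

text \<open>Fubini, since \<open>u < Z t\<close> is the same as \<open>E u < t\<close>.\<close>

lemma laplace_antideriv_pathwise:
  assumes ad: "admissible (a \<omega>) (b \<omega>)" and z: "0 < z"
    and g: "continuous_on UNIV g" and B: "\<And>y. \<bar>g y\<bar> \<le> B"
  shows "(\<integral>t. indicator {0<..} t * (exp (- z * t) * antideriv g (Z t \<omega>)) \<partial>lborel)
    = (\<integral>u. indicator {0<..} u * (g u * (exp (- z * E u \<omega>) / z)) \<partial>lborel)"
proof -
  have gm [measurable]: "g \<in> borel_measurable borel" using g by (rule borel_measurable_continuous_onI)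
  have B0: "0 \<le> B" using B[of 0] by simp
  define J where "J u t = indicator {0<..} u * (g u * (indicator {E u \<omega><..} t * exp (- z * t)))" for u t
  have J_alt: "J u t = (if 0 < u \<and> E u \<omega> < t then g u * exp (- z * t) else 0)" for u t
    unfolding J_def by (simp add: indicator_def)
  have [measurable]: "(\<lambda>(u, t). J u t) \<in> borel_measurable (lborel \<Otimes>\<^sub>M lborel)"
    unfolding J_alt by measurable
  have int_exp: "integrable lborel (\<lambda>t. indicator {E u \<omega><..} t * exp (- z * t))"
    "(\<integral>t. indicator {E u \<omega><..} t * exp (- z * t) \<partial>lborel) = exp (- z * E u \<omega>) / z" for u
    using set_integrable_exp_minus(3,4)[OF z, of "E u \<omega>"] by (simp_all add: set_integrable_def set_lebesgue_integral_def)
  have Jt: "(\<integral>t. J u t \<partial>lborel) = indicator {0<..} u * (g u * (exp (- z * E u \<omega>) / z))" for u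
    unfolding J_def using int_exp by simp
  have Jn: "(\<integral>t. \<bar>J u t\<bar> \<partial>lborel) = indicator {0<..} u * (\<bar>g u\<bar> * (exp (- z * E u \<omega>) / z))" for u
  proof -
    have "\<bar>J u t\<bar> = indicator {0<..} u * (\<bar>g u\<bar> * (indicator {E u \<omega><..} t * exp (- z * t)))" for t
      unfolding J_def by (simp add: abs_mult)
    then show ?thesis using int_exp by simp
  qed
  have I: "integrable (lborel \<Otimes>\<^sub>M lborel) (\<lambda>(u, t). J u t)"
  proof (rule lborel_pair.Fubini_integrable)
    show "integrable lborel (\<lambda>u. \<integral>t. norm (case (u, t) of (u, t) \<Rightarrow> J u t) \<partial>lborel)"
    proof (rule Bochner_Integration.integrable_bound)
      let ?s = "a \<omega> + b \<omega>"
      have "set_integrable lborel {0<..} (\<lambda>u. exp (- (z * ?s) * u))"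
        using ad z by (intro set_integrable_exp_minus) (simp add: admissible_def)
      then show "integrable lborel (\<lambda>u. B * exp (z * ?s) / z * (indicator {0<..} u * exp (- (z * ?s) * u)))"
        by (simp add: set_integrable_def)
      show "AE u in lborel. norm (\<integral>t. norm (case (u, t) of (u, t) \<Rightarrow> J u t) \<partial>lborel)
          \<le> norm (B * exp (z * ?s) / z * (indicator {0<..} u * exp (- (z * ?s) * u)))"
      proof (rule AE_I2)
        fix u :: real
        show "norm (\<integral>t. norm (case (u, t) of (u, t) \<Rightarrow> J u t) \<partial>lborel)
          \<le> norm (B * exp (z * ?s) / z * (indicator {0<..} u * exp (- (z * ?s) * u)))"
        proof (cases "0 < u")
          case True
          \<comment> \<open>For u \<ge> 1 this is the linear lower bound of
            \<open>power_sum_ge\<close>; for smaller u the left side is negative. It produces an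
            exponential tail in u at the cost of the factor exp (z (a + b)).\<close>
          have "?s * (u - 1) \<le> E u \<omega>"
          proof (cases "1 \<le> u")
            case True
            then show ?thesis using power_sum_ge[OF exponents ad, of u] ad by (simp add: admissible_def algebra_simps)
          next
            case False
            then have "?s * (u - 1) \<le> 0" using ad by (intro mult_nonneg_nonpos) (auto simp: admissible_def)
            also have "0 \<le> E u \<omega>" using power_sum_pos[OF exponents ad True] by simp
            finally show ?thesis .
          qed
          then have "z * (?s * (u - 1)) \<le> z * E u \<omega>" using z by (intro mult_left_mono) auto
          then have "- z * E u \<omega> \<le> z * ?s + - (z * ?s) * u" by (simp add: algebra_simps)
          then have "exp (- z * E u \<omega>) \<le> exp (z * ?s) * exp (- (z * ?s) * u)"
            unfolding exp_add[symmetric] by simp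
          then have "\<bar>g u\<bar> * (exp (- z * E u \<omega>) / z) \<le> B * (exp (z * ?s) * exp (- (z * ?s) * u) / z)"
            using B[of u] B0 z by (intro mult_mono divide_right_mono) auto
          then have "norm (indicator {0<..} u * (\<bar>g u\<bar> * (exp (- z * E u \<omega>) / z)))
              \<le> B * (exp (z * ?s) * exp (- (z * ?s) * u) / z)"
            using True z by (simp add: abs_mult)
          also have "\<dots> = norm (B * exp (z * ?s) / z * (indicator {0<..} u * exp (- (z * ?s) * u)))"
            using True z B0 by (simp add: abs_mult)
          finally show ?thesis by (simp only: prod.case real_norm_def Jn)
        qed (simp add: Jn)
      qed
    qed (unfold split_beta, measurable)
    show "AE u in lborel. integrable lborel (\<lambda>t. case (u, t) of (u, t) \<Rightarrow> J u t)"
      unfolding J_def using int_exp by simp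
  qed measurable
  have Ju: "(\<integral>u. J u t \<partial>lborel) = indicator {0<..} t * (exp (- z * t) * antideriv g (Z t \<omega>))" for t
  proof (cases "0 < t")
    case True
    have "J u t = exp (- z * t) * (indicator {0<..<Z t \<omega>} u * g u)" for u
      using less_power_sum_inv_iff[OF exponents ad True, of u] by (auto simp: J_alt indicator_def)
    then show ?thesis using True by (simp add: antideriv_def set_lebesgue_integral_def)
  next
    case False
    have "J u t = 0" for u
      using False power_sum_pos[OF exponents ad, of u] by (auto simp: J_alt)
    then show ?thesis using False by simp
  qed
  show ?thesis using lborel_pair.Fubini_integral[OF I] by (simp add: Ju Jt)
qed

text \<open>The pathwise identity is averaged with two applications of Fubini. The t-side is
  dominated through the power bound on the mean of \<open>Z t\<close>. On the u-side the mean of exp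
  (- z \<open>E u\<close>) equals exp (- \<phi> z u), and this is where z turns into \<phi>
  z.\<close>

lemma laplace_antideriv:
  assumes z: "0 < z" and g: "continuous_on UNIV g" and B: "\<And>y. \<bar>g y\<bar> \<le> B"
  shows "set_integrable lborel {0<..} (\<lambda>t. exp (- z * t) * expectation (\<lambda>\<omega>. antideriv g (Z t \<omega>)))"
    and "(LINT t:{0<..}|lborel. exp (- z * t) * expectation (\<lambda>\<omega>. antideriv g (Z t \<omega>)))
      = 1 / z * (LINT u:{0<..}|lborel. exp (- \<phi> z * u) * g u)"
proof -
  have gm [measurable]: "g \<in> borel_measurable borel" using g by (rule borel_measurable_continuous_onI)
  note measurable_antideriv[OF g B, measurable]
  have B0: "0 \<le> B" using B[of 0] by simp
  obtain e K where e: "0 < e" "e < 1" "0 \<le> K" and K: "\<And>t. 0 < t \<Longrightarrow> expectation (Z t) \<le> K * t powr e"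
    using expectation_Z_le_powr by blast
  interpret pair_sigma_finite lborel N ..
  have Gint: "integrable N (\<lambda>\<omega>. antideriv g (Z t \<omega>))"
    and Gle: "expectation (\<lambda>\<omega>. \<bar>antideriv g (Z t \<omega>)\<bar>) \<le> B * (K * t powr e)" if t: "0 < t" for t
  proof -
    have le: "\<bar>antideriv g (Z t \<omega>)\<bar> \<le> B * Z t \<omega>" for \<omega>
      using antideriv_abs_le[OF g B, of "Z t \<omega>"] Z_nonneg by simp
    have bi: "integrable N (\<lambda>\<omega>. B * Z t \<omega>)" using expectation_Z(1)[OF t] by simp
    show i: "integrable N (\<lambda>\<omega>. antideriv g (Z t \<omega>))"
      by (rule Bochner_Integration.integrable_bound[OF bi]) (use le in \<open>auto intro!: AE_I2 intro: order_trans[OF _ abs_ge_self]\<close>)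
    have "expectation (\<lambda>\<omega>. \<bar>antideriv g (Z t \<omega>)\<bar>) \<le> expectation (\<lambda>\<omega>. B * Z t \<omega>)"
      using i bi le by (intro integral_mono) auto
    also have "\<dots> \<le> B * (K * t powr e)" using K[OF t] B0 by (simp add: mult_left_mono)
    finally show "expectation (\<lambda>\<omega>. \<bar>antideriv g (Z t \<omega>)\<bar>) \<le> B * (K * t powr e)" .
  qed
  define H where "H t \<omega> = indicator {0<..} t * (exp (- z * t) * antideriv g (Z t \<omega>))" for t \<omega>
  have [measurable]: "(\<lambda>(t, \<omega>). H t \<omega>) \<in> borel_measurable (lborel \<Otimes>\<^sub>M N)"
    unfolding H_def by measurable
  have I1: "integrable (lborel \<Otimes>\<^sub>M N) (\<lambda>(t, \<omega>). H t \<omega>)"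
  proof (rule Fubini_integrable)
    show "integrable lborel (\<lambda>t. \<integral>\<omega>. norm (case (t, \<omega>) of (t, \<omega>) \<Rightarrow> H t \<omega>) \<partial>N)"
    proof (rule Bochner_Integration.integrable_bound)
      show "integrable lborel (\<lambda>t. B * K * (indicator {0<..} t * (exp (- z * t) * t powr ((e + 1) - 1))))"
        using set_integrable_powr_exp_minus(1)[of "e + 1", OF _ z] e by (simp add: set_integrable_def)
      show "AE t in lborel. norm (\<integral>\<omega>. norm (case (t, \<omega>) of (t, \<omega>) \<Rightarrow> H t \<omega>) \<partial>N)
        \<le> norm (B * K * (indicator {0<..} t * (exp (- z * t) * t powr ((e + 1) - 1))))"
      proof (rule AE_I2)
        fix t :: real
        show "norm (\<integral>\<omega>. norm (case (t, \<omega>) of (t, \<omega>) \<Rightarrow> H t \<omega>) \<partial>N)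
          \<le> norm (B * K * (indicator {0<..} t * (exp (- z * t) * t powr ((e + 1) - 1))))"
        proof (cases "0 < t")
          case True
          have 1: "(\<integral>\<omega>. norm (case (t, \<omega>) of (t, \<omega>) \<Rightarrow> H t \<omega>) \<partial>N) = exp (- z * t) * expectation (\<lambda>\<omega>. \<bar>antideriv g (Z t \<omega>)\<bar>)"
            using True by (simp add: H_def abs_mult)
          have 2: "0 \<le> exp (- z * t) * expectation (\<lambda>\<omega>. \<bar>antideriv g (Z t \<omega>)\<bar>)" by simp
          have "exp (- z * t) * expectation (\<lambda>\<omega>. \<bar>antideriv g (Z t \<omega>)\<bar>) \<le> exp (- z * t) * (B * (K * t powr e))"
            using Gle[OF True] by (intro mult_left_mono) auto
          also have "\<dots> = norm (B * K * (indicator {0<..} t * (exp (- z * t) * t powr ((e + 1) - 1))))"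
            using True B0 e by (simp add: abs_mult mult_ac)
          finally show ?thesis unfolding 1 unfolding real_norm_def abs_of_nonneg[OF 2] .
        qed (simp add: H_def)
      qed
    qed measurable
    show "AE t in lborel. integrable N (\<lambda>\<omega>. case (t, \<omega>) of (t, \<omega>) \<Rightarrow> H t \<omega>)"
      using Gint by (auto simp: H_def indicator_def)
  qed measurable
  have H1: "(\<integral>\<omega>. H t \<omega> \<partial>N) = indicator {0<..} t * (exp (- z * t) * expectation (\<lambda>\<omega>. antideriv g (Z t \<omega>)))" for t
    unfolding H_def by simp
  show "set_integrable lborel {0<..} (\<lambda>t. exp (- z * t) * expectation (\<lambda>\<omega>. antideriv g (Z t \<omega>)))"
    using integrable_fst[OF I1] by (simp add: H1 set_integrable_def)
  define L where "L u \<omega> = indicator {0<..} u * (g u * (exp (- z * E u \<omega>) / z))" for u \<omega>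
  have [measurable]: "(\<lambda>(u, \<omega>). L u \<omega>) \<in> borel_measurable (lborel \<Otimes>\<^sub>M N)"
    unfolding L_def by measurable
  have Lint: "integrable N (L u)" for u
    unfolding L_def using integrable_exp_E[OF z] by simp
  have Lexp: "(\<integral>\<omega>. L u \<omega> \<partial>N) = indicator {0<..} u * (g u * (exp (- \<phi> z * u) / z))" for u
    unfolding L_def using expectation_exp_E[of u z] z by (auto simp: indicator_def mult_ac)
  have Labs: "(\<integral>\<omega>. \<bar>L u \<omega>\<bar> \<partial>N) = indicator {0<..} u * (\<bar>g u\<bar> * (exp (- \<phi> z * u) / z))" for u
    unfolding L_def using expectation_exp_E[of u z] z by (auto simp: indicator_def mult_ac abs_mult)
  have I2: "integrable (lborel \<Otimes>\<^sub>M N) (\<lambda>(u, \<omega>). L u \<omega>)"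
  proof (rule Fubini_integrable)
    show "integrable lborel (\<lambda>u. \<integral>\<omega>. norm (case (u, \<omega>) of (u, \<omega>) \<Rightarrow> L u \<omega>) \<partial>N)"
    proof (rule Bochner_Integration.integrable_bound)
      show "integrable lborel (\<lambda>u. B / z * (indicator {0<..} u * exp (- \<phi> z * u)))"
        using set_integrable_exp_minus(3)[OF \<phi>_pos[OF z], of 0] by (simp add: set_integrable_def)
      show "AE u in lborel. norm (\<integral>\<omega>. norm (case (u, \<omega>) of (u, \<omega>) \<Rightarrow> L u \<omega>) \<partial>N)
        \<le> norm (B / z * (indicator {0<..} u * exp (- \<phi> z * u)))"
      proof (rule AE_I2)
        fix u :: real
        have "\<bar>g u\<bar> * (exp (- \<phi> z * u) / z) \<le> B * (exp (- \<phi> z * u) / z)"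
          using B[of u] z by (intro mult_right_mono) auto
        then show "norm (\<integral>\<omega>. norm (case (u, \<omega>) of (u, \<omega>) \<Rightarrow> L u \<omega>) \<partial>N)
          \<le> norm (B / z * (indicator {0<..} u * exp (- \<phi> z * u)))"
          using z B0 by (simp add: Labs indicator_def abs_mult)
      qed
    qed measurable
  qed (use Lint in auto)
  have "(LINT t:{0<..}|lborel. exp (- z * t) * expectation (\<lambda>\<omega>. antideriv g (Z t \<omega>)))
      = (\<integral>t. \<integral>\<omega>. H t \<omega> \<partial>N \<partial>lborel)"
    by (simp add: H1 set_lebesgue_integral_def)
  also have "\<dots> = (\<integral>\<omega>. \<integral>t. H t \<omega> \<partial>lborel \<partial>N)" by (rule Fubini_integral[OF I1, symmetric])
  also have "\<dots> = (\<integral>\<omega>. \<integral>u. L u \<omega> \<partial>lborel \<partial>N)"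
  proof (rule integral_cong_AE)
    show "AE \<omega> in N. (\<integral>t. H t \<omega> \<partial>lborel) = (\<integral>u. L u \<omega> \<partial>lborel)"
      using AE_admissible
      by eventually_elim (unfold H_def L_def, rule laplace_antideriv_pathwise[OF _ z g B])
  qed measurable
  also have "\<dots> = (\<integral>u. \<integral>\<omega>. L u \<omega> \<partial>N \<partial>lborel)" by (rule Fubini_integral[OF I2])
  also have "\<dots> = 1 / z * (LINT u:{0<..}|lborel. exp (- \<phi> z * u) * g u)"
  proof -
    have "(\<integral>\<omega>. L u \<omega> \<partial>N) = 1 / z * (indicator {0<..} u * (exp (- \<phi> z * u) * g u))" for u
      unfolding Lexp by simp
    then show ?thesis by (simp add: set_lebesgue_integral_def)
  qed
  finally show "(LINT t:{0<..}|lborel. exp (- z * t) * expectation (\<lambda>\<omega>. antideriv g (Z t \<omega>)))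
      = 1 / z * (LINT u:{0<..}|lborel. exp (- \<phi> z * u) * g u)" .
qed

end

lemma laplace_antiderivative:
  fixes g :: "real \<Rightarrow> real"
  assumes w: "0 < w" and [measurable]: "g \<in> borel_measurable borel"
    and g: "set_integrable lborel {0<..} (\<lambda>u. exp (- w * u) * g u)"
  shows "set_integrable lborel {0<..} (\<lambda>u. exp (- w * u) * antideriv g u)"
    and "(LINT u:{0<..}|lborel. exp (- w * u) * antideriv g u) = 1 / w * (LINT u:{0<..}|lborel. exp (- w * u) * g u)"
proof -
  have one: "set_integrable lborel {0<..} (\<lambda>u. exp (- w * u) * 1)"
    "(LINT u:{0<..}|lborel. exp (- w * u) * 1) = 1 / w"
    using set_integrable_exp_minus(3,4)[OF w, of 0] by simp_all
  show "set_integrable lborel {0<..} (\<lambda>u. exp (- w * u) * antideriv g u)"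
    unfolding antideriv_eq_convolution by (rule laplace_convolution(1)[OF _ _ one(1) g]) simp_all
  show "(LINT u:{0<..}|lborel. exp (- w * u) * antideriv g u) = 1 / w * (LINT u:{0<..}|lborel. exp (- w * u) * g u)"
    unfolding antideriv_eq_convolution one(2)[symmetric]
    by (rule laplace_convolution(2)[OF _ _ one(1) g]) simp_all
qed

lemma set_integrable_exp_bounded:
  fixes g :: "real \<Rightarrow> real"
  assumes w: "0 < w" and [measurable]: "g \<in> borel_measurable borel" and B: "\<And>y. \<bar>g y\<bar> \<le> B"
  shows "set_integrable lborel {0<..} (\<lambda>u. exp (- w * u) * g u)"
proof (rule set_integrable_bound)
  show "set_integrable lborel {0<..} (\<lambda>u. exp (- w * u) * B)"
    by (rule set_integrable_mult_left) (rule set_integrable_exp_minus(3)[OF w])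
  show "AE u in lborel. u \<in> {0<..} \<longrightarrow> norm (exp (- w * u) * g u) \<le> norm (exp (- w * u) * B)"
    using B by (auto simp: abs_mult intro!: mult_left_mono AE_I2 order_trans[OF _ abs_ge_self])
qed (simp add: set_borel_measurable_def)

section \<open>The derivative of the time-changed antiderivative and its Laplace transform\<close>

context stable_pair
begin

text \<open>The function \<open>flux f\<close> is the derivative of \<open>\<lambda>t. expectation (\<lambda>\<omega>. antideriv f (Z t \<omega>))\<close>.\<close>

definition flux :: "(real \<Rightarrow> real) \<Rightarrow> real \<Rightarrow> real" where
  "flux f t = expectation (\<lambda>\<omega>. f (Z t \<omega>) * Z' t \<omega>)"

context
  fixes f :: "real \<Rightarrow> real" and B :: real
  assumes f: "continuous_on UNIV f" and B: "\<And>y. \<bar>f y\<bar> \<le> B"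
begin

lemma integrand_measurable [measurable]: "f \<in> borel_measurable borel"
  using f by (rule borel_measurable_continuous_onI)

text \<open>The bound does not depend on t within [r, s], because \<open>Z\<close> is nondecreasing
  in t. It thus provides one integrable dominating function near each positive time.\<close>

lemma flux_integrand_le:
  assumes "0 < r" "r \<le> t" "t \<le> s"
  shows "\<bar>f (Z t \<omega>) * Z' t \<omega>\<bar> \<le> B * (Z s \<omega> / r)"
proof -
  have "\<bar>Z' t \<omega>\<bar> \<le> Z t \<omega> / t"
    using power_sum_inv_deriv_le[OF exponents, of t "a \<omega>" "b \<omega>"] power_sum_inv_deriv_nonneg[OF exponents, of "a \<omega>" "b \<omega>" t] assms
    by simp
  also have "\<dots> \<le> Z s \<omega> / r"
    using assms Z_nonneg power_sum_inv_mono[OF exponents assms(3), of "a \<omega>" "b \<omega>"] by (intro frac_le) auto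
  finally show ?thesis unfolding abs_mult using B[of "Z t \<omega>"] B[of 0] by (intro mult_mono) auto
qed

lemma antideriv_Z_le: "\<bar>antideriv f (Z t \<omega>)\<bar> \<le> B * Z t \<omega>"
  using antideriv_abs_le[OF f B, of "Z t \<omega>"] by (simp add: max_absorb2 Z_nonneg)

lemma integrable_antideriv_Z:
  assumes "0 < t"
  shows "integrable N (\<lambda>\<omega>. antideriv f (Z t \<omega>))"
proof (rule Bochner_Integration.integrable_bound)
  note measurable_antideriv[OF f B, measurable]
  show "integrable N (\<lambda>\<omega>. B * Z t \<omega>)" using expectation_Z(1)[OF assms] by simp
  show "AE \<omega> in N. norm (antideriv f (Z t \<omega>)) \<le> norm (B * Z t \<omega>)"
    unfolding real_norm_def by (intro AE_I2 order_trans[OF antideriv_Z_le abs_ge_self])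
  show "(\<lambda>\<omega>. antideriv f (Z t \<omega>)) \<in> borel_measurable N" by measurable
qed

lemma DERIV_expectation_antideriv:
  assumes t: "0 < t"
  shows "((\<lambda>t. expectation (\<lambda>\<omega>. antideriv f (Z t \<omega>))) has_real_derivative flux f t) (at t)"
  unfolding flux_def
proof (rule DERIV_integral_dominated[where r = "t / 2" and s = "2 * t" and W = "\<lambda>\<omega>. B * (Z (2 * t) \<omega> / (t / 2))"])
  show "integrable N (\<lambda>\<omega>. B * (Z (2 * t) \<omega> / (t / 2)))"
    using expectation_Z(1)[of "2 * t"] t by simp
  fix s \<omega> assume s: "t / 2 < s" "s < 2 * t"
  then show "integrable N (\<lambda>\<omega>. antideriv f (Z s \<omega>))" using t by (intro integrable_antideriv_Z) simp
  show "\<bar>f (Z s \<omega>) * Z' s \<omega>\<bar> \<le> B * (Z (2 * t) \<omega> / (t / 2))"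
    using s t by (intro flux_integrand_le) auto
  show "((\<lambda>t. antideriv f (Z t \<omega>)) has_real_derivative f (Z s \<omega>) * Z' s \<omega>) (at s)"
  proof (cases "admissible (a \<omega>) (b \<omega>)")
    case True
    then have "0 < Z s \<omega>" using s t by (intro power_sum_inv(1)[OF exponents]) auto
    then show ?thesis
      using s t by (intro DERIV_chain2[OF DERIV_antideriv[OF f B]] DERIV_power_sum_inv[OF exponents]) auto
  next
    \<comment> \<open>Both \<open>Z\<close> and \<open>Z'\<close> take their default value 0 at such
      a point, so the derivative of a constant is at stake.\<close>
    case False
    then show ?thesis by (simp add: power_sum_inv_def power_sum_inv_deriv_def)
  qed
qed (use t in auto)

lemma flux_measurable [measurable]: "flux f \<in> borel_measurable borel"
proof -
  have "(\<lambda>t. \<integral>\<omega>. f (Z t \<omega>) * Z' t \<omega> \<partial>N) \<in> borel_measurable borel"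
    by (rule borel_measurable_lebesgue_integral) measurable
  then show ?thesis unfolding flux_def[abs_def] .
qed

lemma continuous_flux: "continuous_on {0<..} (flux f)"
proof -
  have "isCont (flux f) t" if t: "0 < t" for t
    unfolding isCont_def flux_def
  proof (rule tendsto_integral_dominated_at[where W = "\<lambda>\<omega>. B * (Z (2 * t) \<omega> / (t / 2))"])
    have "\<forall>\<^sub>F s in at t. t / 2 < s" "\<forall>\<^sub>F s in at t. s < 2 * t"
      using t by (intro order_tendstoD[OF tendsto_ident_at]; simp)+
    then show "\<forall>\<^sub>F s in at t. (\<lambda>\<omega>. f (Z s \<omega>) * Z' s \<omega>) \<in> borel_measurable N \<and>
        (AE \<omega> in N. \<bar>f (Z s \<omega>) * Z' s \<omega>\<bar> \<le> B * (Z (2 * t) \<omega> / (t / 2)))"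
    proof eventually_elim
      case (elim s)
      then have le: "\<bar>f (Z s \<omega>) * Z' s \<omega>\<bar> \<le> B * (Z (2 * t) \<omega> / (t / 2))" for \<omega>
        using t by (intro flux_integrand_le) auto
      show ?case by (intro conjI AE_I2 le) measurable
    qed
    show "integrable N (\<lambda>\<omega>. B * (Z (2 * t) \<omega> / (t / 2)))"
      using expectation_Z(1)[of "2 * t"] t by simp
    show "AE \<omega> in N. ((\<lambda>s. f (Z s \<omega>) * Z' s \<omega>) \<longlongrightarrow> f (Z t \<omega>) * Z' t \<omega>) (at t)"
    proof (rule AE_I2)
      fix \<omega>
      have "isCont f (Z t \<omega>)" using f by (simp add: continuous_on_eq_continuous_at)
      then have "((\<lambda>s. f (Z s \<omega>)) \<longlongrightarrow> f (Z t \<omega>)) (at t)"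
        using isCont_power_sum_inv[OF exponents t, of "a \<omega>" "b \<omega>"] unfolding isCont_def
        by (rule isCont_tendsto_compose[unfolded isCont_def])
      then show "((\<lambda>s. f (Z s \<omega>) * Z' s \<omega>) \<longlongrightarrow> f (Z t \<omega>) * Z' t \<omega>) (at t)"
        using isCont_power_sum_inv_deriv[OF exponents t, of "a \<omega>" "b \<omega>"] unfolding isCont_def
        by (rule tendsto_mult)
    qed
  qed measurable
  then show ?thesis by (auto intro!: continuous_at_imp_continuous_on)
qed

text \<open>Both estimates come from the power bound on the mean of \<open>Z t\<close>; the flux
  loses one power of t through the inequality between \<open>Z'\<close> and \<open>Z t / t\<close>.
  As e > 0, the singularity at 0 is integrable.\<close>

lemma flux_bound:
  "\<exists>e C. 0 < e \<and> e < 1 \<and> (\<forall>t>0. \<bar>flux f t\<bar> \<le> C * t powr (e - 1) \<and>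
    \<bar>expectation (\<lambda>\<omega>. antideriv f (Z t \<omega>))\<bar> \<le> C * t powr e)"
proof -
  obtain e K where e: "0 < e" "e < 1" "0 \<le> K" and K: "\<And>t. 0 < t \<Longrightarrow> expectation (Z t) \<le> K * t powr e"
    using expectation_Z_le_powr by blast
  have B0: "0 \<le> B" using B[of 0] by simp
  show ?thesis
  proof (rule exI[of _ e], rule exI[of _ "B * K"], intro conjI allI impI e(1,2))
    fix t :: real assume t: "0 < t"
    have bi: "integrable N (\<lambda>\<omega>. B * (Z t \<omega> / t))" using expectation_Z(1)[OF t] by simp
    have le: "\<bar>f (Z t \<omega>) * Z' t \<omega>\<bar> \<le> B * (Z t \<omega> / t)" for \<omega>
      using t by (intro flux_integrand_le) auto
    have i: "integrable N (\<lambda>\<omega>. f (Z t \<omega>) * Z' t \<omega>)"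
    proof (rule Bochner_Integration.integrable_bound[OF bi])
      show "AE \<omega> in N. norm (f (Z t \<omega>) * Z' t \<omega>) \<le> norm (B * (Z t \<omega> / t))"
        unfolding real_norm_def by (intro AE_I2 order_trans[OF le abs_ge_self])
    qed measurable
    have "\<bar>flux f t\<bar> \<le> expectation (\<lambda>\<omega>. \<bar>f (Z t \<omega>) * Z' t \<omega>\<bar>)"
      unfolding flux_def by (rule integral_abs_bound)
    also have "\<dots> \<le> expectation (\<lambda>\<omega>. B * (Z t \<omega> / t))"
      by (rule integral_mono[OF integrable_abs[OF i] bi le])
    also have "\<dots> \<le> B * (K * t powr e / t)" using K[OF t] t B0 by (simp add: mult_left_mono divide_right_mono)
    also have "\<dots> = B * K * t powr (e - 1)" using t by (simp add: powr_diff)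
    finally show "\<bar>flux f t\<bar> \<le> B * K * t powr (e - 1)" .
    have "\<bar>expectation (\<lambda>\<omega>. antideriv f (Z t \<omega>))\<bar> \<le> expectation (\<lambda>\<omega>. B * Z t \<omega>)"
      using integrable_antideriv_Z[OF t] expectation_Z(1)[OF t]
      by (intro order_trans[OF integral_abs_bound] integral_mono) (auto simp: antideriv_Z_le)
    also have "\<dots> \<le> B * (K * t powr e)" using K[OF t] B0 by (simp add: mult_left_mono)
    finally show "\<bar>expectation (\<lambda>\<omega>. antideriv f (Z t \<omega>))\<bar> \<le> B * K * t powr e" by simp
  qed
qed

text \<open>The flux may blow up at 0, so the fundamental theorem is used with derivatives in the
  interior only. Continuity of the mean at 0 comes from its bound of order t^e.\<close>

lemma antideriv_flux:
  assumes t: "0 < t"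
  shows "antideriv (flux f) t = expectation (\<lambda>\<omega>. antideriv f (Z t \<omega>))"
proof -
  define m where "m t = expectation (\<lambda>\<omega>. antideriv f (Z t \<omega>))" for t
  obtain e C where e: "0 < e" "e < 1" and C: "\<And>t. 0 < t \<Longrightarrow> \<bar>flux f t\<bar> \<le> C * t powr (e - 1)"
    and m_le: "\<And>t. 0 < t \<Longrightarrow> \<bar>m t\<bar> \<le> C * t powr e"
    using flux_bound unfolding m_def by blast
  have m0: "m 0 = 0"
    unfolding m_def by (simp add: power_sum_inv_0[OF exponents] antideriv_nonpos)
  \<comment> \<open>Plain integrability is the case \<alpha> = 0 of
    \<open>fractional_integrable\<close>, where the kernel is 1.\<close>
  have "set_integrable lborel {0<..<t} (\<lambda>y. (t - y) powr (- 0) * flux f y)"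
    by (rule fractional_integrable[OF _ e(1) _ flux_measurable C t]) (use e in auto)
  then have "set_integrable lborel {0<..<t} (flux f)"
    by (rule set_integrable_cong[THEN iffD1, rotated -1]) auto
  from set_borel_integral_eq_integral(2)[OF this]
  have "antideriv (flux f) t = integral {0..t} (flux f)"
    by (simp add: antideriv_def integral_open_interval_real)
  also have "\<dots> = m t - m 0"
  proof (rule integral_unique, rule fundamental_theorem_of_calculus_interior)
    show "(m has_vector_derivative flux f y) (at y)" if "y \<in> {0<..<t}" for y
      using DERIV_expectation_antideriv[of y] that
      by (simp add: has_real_derivative_iff_has_vector_derivative m_def[abs_def])
    have "isCont m y" if "0 < y" for y
      using DERIV_isCont[OF DERIV_expectation_antideriv[OF that]] by (simp add: m_def[abs_def])
    moreover have "(m \<longlongrightarrow> m 0) (at 0 within {0..t})"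
    proof -
      have "((\<lambda>y. C * y powr e) \<longlongrightarrow> C * 0 powr e) (at 0 within {0..t})"
        using e by (intro tendsto_intros tendsto_powr') (auto simp: eventually_at_filter)
      then have "((\<lambda>y. C * y powr e) \<longlongrightarrow> 0) (at 0 within {0..t})" by simp
      then have "(m \<longlongrightarrow> 0) (at 0 within {0..t})"
        by (rule Lim_null_comparison[rotated]) (use m_le in \<open>auto simp: eventually_at_filter\<close>)
      then show ?thesis by (simp add: m0)
    qed
    ultimately have "(m \<longlongrightarrow> m y) (at y within {0..t})" if "0 \<le> y" for y
      using that tendsto_within_subset[of m "nhds (m y)" y UNIV "{0..t}"] by (cases "y = 0") (auto simp: isCont_def)
    then show "continuous_on {0..t} m"
      by (auto simp: continuous_on_def)
  qed (use t in simp)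
  finally show ?thesis unfolding m0 by (simp add: m_def)
qed

text \<open>The transform of the antiderivative of the flux is known in two ways, and the factor 1/z
  cancels. Time change thus acts on transforms by replacing z with \<phi> z.\<close>

lemma laplace_flux:
  assumes z: "0 < z"
  shows "set_integrable lborel {0<..} (\<lambda>t. exp (- z * t) * flux f t)"
    and "(LINT t:{0<..}|lborel. exp (- z * t) * flux f t) = (LINT u:{0<..}|lborel. exp (- \<phi> z * u) * f u)"
proof -
  obtain e C where e: "0 < e" and C: "\<And>t. 0 < t \<Longrightarrow> \<bar>flux f t\<bar> \<le> C * t powr (e - 1)"
    using flux_bound by auto
  show i: "set_integrable lborel {0<..} (\<lambda>t. exp (- z * t) * flux f t)"
  proof (rule set_integrable_bound)
    show "set_integrable lborel {0<..} (\<lambda>t. C * (exp (- z * t) * t powr (e - 1)))"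
      by (rule set_integrable_mult_right) (rule set_integrable_powr_exp_minus(1)[OF e z])
    show "AE t in lborel. t \<in> {0<..} \<longrightarrow> norm (exp (- z * t) * flux f t) \<le> norm (C * (exp (- z * t) * t powr (e - 1)))"
    proof (rule AE_I2, rule impI)
      fix t :: real assume "t \<in> {0<..}"
      then have "exp (- z * t) * \<bar>flux f t\<bar> \<le> exp (- z * t) * (C * t powr (e - 1))"
        using C by (intro mult_left_mono) auto
      also have "\<dots> = C * (exp (- z * t) * t powr (e - 1))" by simp
      finally show "norm (exp (- z * t) * flux f t) \<le> norm (C * (exp (- z * t) * t powr (e - 1)))"
        unfolding real_norm_def by (intro order_trans[OF _ abs_ge_self]) (simp add: abs_mult)
    qed
  qed (simp add: set_borel_measurable_def)
  have "1 / z * (LINT t:{0<..}|lborel. exp (- z * t) * flux f t)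
      = (LINT t:{0<..}|lborel. exp (- z * t) * antideriv (flux f) t)"
    by (rule laplace_antiderivative(2)[OF z flux_measurable i, symmetric])
  also have "\<dots> = (LINT t:{0<..}|lborel. exp (- z * t) * expectation (\<lambda>\<omega>. antideriv f (Z t \<omega>)))"
    by (rule set_lebesgue_integral_cong) (auto simp: antideriv_flux)
  also have "\<dots> = 1 / z * (LINT u:{0<..}|lborel. exp (- \<phi> z * u) * f u)"
    by (rule laplace_antideriv(2)[OF z f B])
  finally show "(LINT t:{0<..}|lborel. exp (- z * t) * flux f t) = (LINT u:{0<..}|lborel. exp (- \<phi> z * u) * f u)"
    using z by simp
qed

end

text \<open>Both sides have the Laplace transform \<open>\<phi> z / z\<close> times the Laplace transform of \<open>f\<close> at \<open>\<phi> z\<close>.\<close>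

lemma fractional_equation:
  assumes f: "continuous_on UNIV f" "\<And>y. \<bar>f y\<bar> \<le> B"
    and f': "continuous_on UNIV f'" "\<And>y. \<bar>f' y\<bar> \<le> B'"
    and ff': "\<And>y. 0 \<le> y \<Longrightarrow> f y = f 0 + antideriv f' y"
    and t: "0 < t"
  shows "c1 * (1 / Gamma (1 - \<alpha>1) * fun_convolution (\<lambda>s. s powr (- \<alpha>1)) (flux f) t)
      + c2 * (1 / Gamma (1 - \<alpha>2) * fun_convolution (\<lambda>s. s powr (- \<alpha>2)) (flux f) t)
    = expectation (\<lambda>\<omega>. f (Z t \<omega>))"
proof -
  note fm = borel_measurable_continuous_onI[OF f(1)] borel_measurable_continuous_onI[OF f'(1)]
  note hm = flux_measurable[OF f]
  define \<kappa> where "\<kappa> \<alpha> s = 1 / Gamma (1 - \<alpha>) * s powr (- \<alpha>)" for \<alpha> s :: real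
  define R where "R \<alpha> t = 1 / Gamma (1 - \<alpha>) * fun_convolution (\<lambda>s. s powr (- \<alpha>)) (flux f) t" for \<alpha> t
  \<comment> \<open>Writing the mean of f (Z t) through \<open>antideriv f'\<close> makes both its
    continuity and its transform instances of the results on antiderivatives.\<close>
  define G where "G t = f 0 + expectation (\<lambda>\<omega>. antideriv f' (Z t \<omega>))" for t
  define F where "F w = (LINT u:{0<..}|lborel. exp (- w * u) * f u)" for w
  obtain e C where e: "0 < e" "e < 1" and C: "\<And>t. 0 < t \<Longrightarrow> \<bar>flux f t\<bar> \<le> C * t powr (e - 1)"
    using flux_bound[OF f] by auto
  have Rcont: "continuous_on {0<..} (R \<alpha>)" if "\<alpha> < 1" for \<alpha>
    unfolding R_def
    by (intro continuous_intros continuous_on_fractional_integral[OF that e(1) _ hm C continuous_flux[OF f]])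
       (use e in auto)
  have Gcont: "continuous_on {0<..} G"
  proof -
    have "isCont (\<lambda>t. expectation (\<lambda>\<omega>. antideriv f' (Z t \<omega>))) t" if "0 < t" for t
      using DERIV_expectation_antideriv[OF f' that] by (rule DERIV_isCont)
    then show ?thesis unfolding G_def by (auto intro!: continuous_at_imp_continuous_on)
  qed
  have LR: "set_integrable lborel {0<..} (\<lambda>t. exp (- z * t) * R \<alpha> t)"
    "(LINT t:{0<..}|lborel. exp (- z * t) * R \<alpha> t) = z powr (\<alpha> - 1) * F (\<phi> z)" if \<alpha>: "\<alpha> < 1" and z: "0 < z" for \<alpha> z
  proof -
    have a: "1 - \<alpha> > 0" using \<alpha> by simp
    have G: "Gamma (1 - \<alpha>) > 0" using a by (rule Gamma_real_pos)
    have k: "set_integrable lborel {0<..} (\<lambda>t. exp (- z * t) * t powr (- \<alpha>))"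
      "(LINT t:{0<..}|lborel. exp (- z * t) * t powr (- \<alpha>)) = Gamma (1 - \<alpha>) * z powr (\<alpha> - 1)"
      using set_integrable_powr_exp_minus[OF a z] by simp_all
    have km: "(\<lambda>s::real. s powr (- \<alpha>)) \<in> borel_measurable borel" by measurable
    note conv = laplace_convolution[OF km hm k(1) laplace_flux(1)[OF f z]]
    have eq: "exp (- z * t) * R \<alpha> t = 1 / Gamma (1 - \<alpha>) * (exp (- z * t) * fun_convolution (\<lambda>s. s powr (- \<alpha>)) (flux f) t)" for t
      unfolding R_def by simp
    show "set_integrable lborel {0<..} (\<lambda>t. exp (- z * t) * R \<alpha> t)"
      unfolding eq by (rule set_integrable_mult_right) (rule conv(1))
    show "(LINT t:{0<..}|lborel. exp (- z * t) * R \<alpha> t) = z powr (\<alpha> - 1) * F (\<phi> z)"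
      unfolding eq set_integral_mult_right conv(2) k(2) laplace_flux(2)[OF f z] F_def using G by simp
  qed
  have LG: "set_integrable lborel {0<..} (\<lambda>t. exp (- z * t) * G t)"
    "(LINT t:{0<..}|lborel. exp (- z * t) * G t) = \<phi> z / z * F (\<phi> z)" if z: "0 < z" for z
  proof -
    define w where "w = \<phi> z"
    have w: "0 < w" unfolding w_def using z by (rule \<phi>_pos)
    note I1 = set_integrable_exp_bounded[OF w fm(2) f'(2)]
    note A = laplace_antiderivative[OF w fm(2) I1]
    define F1 where "F1 = (LINT u:{0<..}|lborel. exp (- w * u) * f' u)"
    have c0: "set_integrable lborel {0<..} (\<lambda>u. f 0 * exp (- x * u))"
      "(LINT u:{0<..}|lborel. f 0 * exp (- x * u)) = f 0 / x" if "0 < x" for x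
      using set_integrable_exp_minus(3,4)[OF that, of 0] by simp_all
    have "F w = (LINT u:{0<..}|lborel. f 0 * exp (- w * u) + exp (- w * u) * antideriv f' u)"
      unfolding F_def
    proof (rule set_lebesgue_integral_cong, simp, intro allI impI)
      fix u :: real assume "u \<in> {0<..}"
      then have "f u = f 0 + antideriv f' u" by (intro ff') simp
      then show "exp (- w * u) * f u = f 0 * exp (- w * u) + exp (- w * u) * antideriv f' u"
        by (simp add: algebra_simps)
    qed
    also have "\<dots> = f 0 / w + 1 / w * F1"
      unfolding set_integral_add(2)[OF c0(1)[OF w] A(1)] c0(2)[OF w] A(2) F1_def ..
    \<comment> \<open>The rule for the transform of a derivative, at the argument \<phi> z.\<close>
    finally have Fw: "w * F w = f 0 + F1" using w by (simp add: field_simps)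
    have eq: "exp (- z * t) * G t = f 0 * exp (- z * t) + exp (- z * t) * expectation (\<lambda>\<omega>. antideriv f' (Z t \<omega>))" for t
      unfolding G_def by (simp add: algebra_simps)
    note LA = laplace_antideriv[OF z f']
    show "set_integrable lborel {0<..} (\<lambda>t. exp (- z * t) * G t)"
      unfolding eq by (intro set_integral_add(1) c0 LA z)
    have "(LINT t:{0<..}|lborel. exp (- z * t) * G t) = f 0 / z + 1 / z * F1"
      unfolding eq set_integral_add(2)[OF c0(1)[OF z] LA(1)] c0(2)[OF z] LA(2) F1_def w_def ..
    also have "\<dots> = w / z * F w" using z Fw by (simp add: field_simps)
    finally show "(LINT t:{0<..}|lborel. exp (- z * t) * G t) = \<phi> z / z * F (\<phi> z)" unfolding w_def .
  qed
  have "c1 * R \<alpha>1 t + c2 * R \<alpha>2 t - G t = 0"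
  proof (rule lerch[where g = "\<lambda>t. c1 * R \<alpha>1 t + c2 * R \<alpha>2 t - G t", OF _ _ _ t])
    show "continuous_on {0<..} (\<lambda>t. c1 * R \<alpha>1 t + c2 * R \<alpha>2 t - G t)"
      using \<alpha> by (intro continuous_intros Rcont Gcont) auto
    fix z :: real assume z: "0 < z"
    have \<alpha>': "\<alpha>1 < 1" "\<alpha>2 < 1" using \<alpha> by auto
    have eq: "exp (- z * t) * (c1 * R \<alpha>1 t + c2 * R \<alpha>2 t - G t)
        = (c1 * (exp (- z * t) * R \<alpha>1 t) + c2 * (exp (- z * t) * R \<alpha>2 t)) - exp (- z * t) * G t" for t
      by (simp add: algebra_simps)
    note i1 = set_integrable_mult_right[of c1, OF LR(1)[OF \<alpha>'(1) z]]
    note i2 = set_integrable_mult_right[of c2, OF LR(1)[OF \<alpha>'(2) z]]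
    note i12 = set_integral_add(1)[OF i1 i2]
    show "set_integrable lborel {0<..} (\<lambda>t. exp (- z * t) * (c1 * R \<alpha>1 t + c2 * R \<alpha>2 t - G t))"
      unfolding eq by (rule set_integral_diff(1)[OF i12 LG(1)[OF z]])
    have "(LINT t:{0<..}|lborel. exp (- z * t) * (c1 * R \<alpha>1 t + c2 * R \<alpha>2 t - G t))
        = c1 * (z powr (\<alpha>1 - 1) * F (\<phi> z)) + c2 * (z powr (\<alpha>2 - 1) * F (\<phi> z)) - \<phi> z / z * F (\<phi> z)"
      unfolding eq set_integral_diff(2)[OF i12 LG(1)[OF z]] set_integral_add(2)[OF i1 i2] set_integral_mult_right
        LR(2)[OF \<alpha>'(1) z] LR(2)[OF \<alpha>'(2) z] LG(2)[OF z] ..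
    \<comment> \<open>The powers z^(\<alpha>1 - 1) and z^(\<alpha>2 - 1), weighted by c1 and c2, add
      up to \<phi> z / z.\<close>
    also have "\<dots> = 0" using z by (simp add: powr_diff field_simps)
    finally show "(LINT t:{0<..}|lborel. exp (- z * t) * (c1 * R \<alpha>1 t + c2 * R \<alpha>2 t - G t)) = 0" .
  qed
  moreover have "G t = expectation (\<lambda>\<omega>. f (Z t \<omega>))"
  proof -
    have "expectation (\<lambda>\<omega>. f (Z t \<omega>)) = expectation (\<lambda>\<omega>. f 0 + antideriv f' (Z t \<omega>))"
      using ff'[OF Z_nonneg] by simp
    also have "\<dots> = G t" unfolding G_def using integrable_antideriv_Z[OF f' t] by (simp add: prob_space)
    finally show ?thesis by simp
  qed
  ultimately show ?thesis unfolding R_def by simp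
qed

end

section \<open>One-time laws of the first passage time\<close>

text \<open>Let v decrease to x and use right-continuity. The slack x < v absorbs the difference
  between strict and weak inequalities when passage events are compared.\<close>

lemma cdf_sandwich_imp_eq:
  assumes \<mu>: "real_distribution \<mu>" and \<nu>: "real_distribution \<nu>"
    and 1: "\<And>x v. x < v \<Longrightarrow> cdf \<mu> x \<le> cdf \<nu> v" and 2: "\<And>x v. x < v \<Longrightarrow> cdf \<nu> x \<le> cdf \<mu> v"
  shows "\<mu> = \<nu>"
proof -
  have le: "cdf \<kappa> x \<le> cdf \<kappa>' x"
    if "\<And>x v. x < v \<Longrightarrow> cdf \<kappa> x \<le> cdf \<kappa>' v" "real_distribution \<kappa>'" for \<kappa> \<kappa>' :: "real measure" and x
  proof -
    interpret real_distribution \<kappa>' by fact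
    have "(cdf \<kappa>' \<longlongrightarrow> cdf \<kappa>' x) (at_right x)"
      using cdf_is_right_cont[of x] by (simp add: continuous_within)
    then show ?thesis
      by (rule tendsto_lowerbound)
         (auto simp: eventually_at_right_less intro!: eventually_at_right_less[THEN eventually_mono] that(1))
  qed
  have "cdf \<mu> = cdf \<nu>"
    using le[of \<mu> \<nu>, OF 1 \<nu>] le[of \<nu> \<mu>, OF 2 \<mu>] by (intro ext antisym)
  then show ?thesis by (rule cdf_unique[OF \<mu> \<nu>])
qed

text \<open>Independence factorizes the transform, and the powers u^(1/\<alpha>1) and
  u^(1/\<alpha>2) are those for which (z u^(1/\<alpha>))^\<alpha> equals u z^\<alpha>.\<close>

lemma stable_pair_product:
  fixes A B :: "real measure"
  assumes \<alpha>: "0 < \<alpha>2" "\<alpha>2 < \<alpha>1" "\<alpha>1 < 1" and c: "0 \<le> c1" "0 \<le> c2" "c1 + c2 = 1"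
    and A: "real_distribution A" "AE x in A. 0 \<le> x"
      "\<And>z. z > 0 \<Longrightarrow> (\<integral>x. exp (- z * x) \<partial>A) = exp (- (c1 * z powr \<alpha>1))"
    and B: "real_distribution B" "AE x in B. 0 \<le> x"
      "\<And>z. z > 0 \<Longrightarrow> (\<integral>x. exp (- z * x) \<partial>B) = exp (- (c2 * z powr \<alpha>2))"
  shows "stable_pair (A \<Otimes>\<^sub>M B) fst snd \<alpha>1 \<alpha>2 c1 c2"
proof -
  interpret A: real_distribution A by fact
  interpret B: real_distribution B by fact
  interpret AB: pair_prob_space A B ..
  have sets [measurable_cong]: "sets A = sets borel" "sets B = sets borel" by simp_all
  show ?thesis
  proof
    show "AE x in A \<Otimes>\<^sub>M B. 0 \<le> fst x" "AE x in A \<Otimes>\<^sub>M B. 0 \<le> snd x"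
    proof -
      have "{x \<in> space (A \<Otimes>\<^sub>M B). 0 \<le> fst x} \<in> sets (A \<Otimes>\<^sub>M B)" by measurable
      then show "AE x in A \<Otimes>\<^sub>M B. 0 \<le> fst x" using A(2) by (intro AB.AE_pair_measure) simp_all
      have "{x \<in> space (A \<Otimes>\<^sub>M B). 0 \<le> snd x} \<in> sets (A \<Otimes>\<^sub>M B)" by measurable
      then show "AE x in A \<Otimes>\<^sub>M B. 0 \<le> snd x" using B(2) by (intro AB.AE_pair_measure) simp_all
    qed
    show "(fst :: real \<times> real \<Rightarrow> real) \<in> borel_measurable (A \<Otimes>\<^sub>M B)"
      "(snd :: real \<times> real \<Rightarrow> real) \<in> borel_measurable (A \<Otimes>\<^sub>M B)" by measurable
    fix u z :: real assume u: "0 < u" and z: "0 < z"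
    define r s where "r = z * u powr (1 / \<alpha>1)" and "s = z * u powr (1 / \<alpha>2)"
    have rs: "0 < r" "0 < s" using u z by (simp_all add: r_def s_def)
    have intA: "integrable A (\<lambda>x. exp (- r * x))"
      by (rule A.integrable_const_bound[where B=1]) (use A(2) rs in \<open>auto elim!: eventually_mono\<close>)
    have intB: "integrable B (\<lambda>x. exp (- s * x))"
      by (rule B.integrable_const_bound[where B=1]) (use B(2) rs in \<open>auto elim!: eventually_mono\<close>)
    have I: "integrable (A \<Otimes>\<^sub>M B) (\<lambda>(x, y). exp (- r * x) * exp (- s * y))"
      by (rule AB.Fubini_integrable) (use intA intB in auto)
    have "(\<integral>x. exp (- z * power_sum (1 / \<alpha>1) (1 / \<alpha>2) (fst x) (snd x) u) \<partial>(A \<Otimes>\<^sub>M B))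
        = (\<integral>(x, y). exp (- r * x) * exp (- s * y) \<partial>(A \<Otimes>\<^sub>M B))"
      by (intro Bochner_Integration.integral_cong)
         (auto simp: power_sum_def r_def s_def exp_add[symmetric] algebra_simps)
    also have "\<dots> = (\<integral>x. exp (- r * x) \<partial>A) * (\<integral>y. exp (- s * y) \<partial>B)"
      using AB.integral_fst[OF I] by simp
    also have "\<dots> = exp (- (c1 * r powr \<alpha>1)) * exp (- (c2 * s powr \<alpha>2))"
      using A(3)[OF rs(1)] B(3)[OF rs(2)] by simp
    also have "\<dots> = exp (- u * (c1 * z powr \<alpha>1 + c2 * z powr \<alpha>2))"
      using u z \<alpha> by (simp add: r_def s_def powr_mult powr_powr exp_add[symmetric] algebra_simps)
    finally show "(\<integral>x. exp (- z * power_sum (1 / \<alpha>1) (1 / \<alpha>2) (fst x) (snd x) u) \<partial>(A \<Otimes>\<^sub>M B))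
      = exp (- u * (c1 * z powr \<alpha>1 + c2 * z powr \<alpha>2))" .
  qed (use \<alpha> c in auto)
qed

lemma first_passage_nonneg: "0 \<le> first_passage D t \<omega>"
  unfolding first_passage_def by (auto intro: cInf_greatest)

lemma
  assumes D: "mixed_stable_subordinator M c1 \<alpha>1 c2 \<alpha>2 D"
  shows subordinator_measurable: "0 \<le> u \<Longrightarrow> D u \<in> borel_measurable M"
    and subordinator_mono: "\<omega> \<in> space M \<Longrightarrow> 0 \<le> u \<Longrightarrow> u \<le> v \<Longrightarrow> D u \<omega> \<le> D v \<omega>"
    and subordinator_nonneg: "0 \<le> u \<Longrightarrow> AE \<omega> in M. 0 \<le> D u \<omega>"
proof -
  show "0 \<le> u \<Longrightarrow> D u \<in> borel_measurable M"
    using D unfolding mixed_stable_subordinator_def levy_process_def by blast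
  have mono: "D u \<omega> \<le> D v \<omega>" if "\<omega> \<in> space M" "0 \<le> u" "u \<le> v" for \<omega> u v
    using D that unfolding mixed_stable_subordinator_def mono_on_def by auto
  then show "\<omega> \<in> space M \<Longrightarrow> 0 \<le> u \<Longrightarrow> u \<le> v \<Longrightarrow> D u \<omega> \<le> D v \<omega>" .
  assume u: "0 \<le> u"
  have "AE \<omega> in M. D 0 \<omega> = 0"
    using D unfolding mixed_stable_subordinator_def levy_process_def by blast
  then show "AE \<omega> in M. 0 \<le> D u \<omega>"
    using AE_space by eventually_elim (use u mono[of _ 0 u] in fastforce)
qed

lemma (in prob_space) stable_pair_for_subordinator:
  assumes D: "mixed_stable_subordinator M c1 \<alpha>1 c2 \<alpha>2 D"
    and \<alpha>: "0 < \<alpha>2" "\<alpha>2 < \<alpha>1" "\<alpha>1 < 1" and c: "0 \<le> c1" "0 \<le> c2" "c1 + c2 = 1"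
  obtains N :: "(real \<times> real) measure" where "stable_pair N fst snd \<alpha>1 \<alpha>2 c1 c2"
    and "\<And>u. 0 < u \<Longrightarrow> distr M borel (D u)
      = distr N borel (\<lambda>x. power_sum (1 / \<alpha>1) (1 / \<alpha>2) (fst x) (snd x) u)"
proof -
  note Dm [measurable] = subordinator_measurable[OF D]
  note Dpos = subordinator_nonneg[OF D]
  have Dlt: "expectation (\<lambda>\<omega>. exp (- z * D u \<omega>)) = exp (- u * (c1 * z powr \<alpha>1 + c2 * z powr \<alpha>2))"
    if "0 \<le> u" "0 < z" for u z
    using D that unfolding mixed_stable_subordinator_def by blast
  let ?\<delta> = "\<lambda>u. distr M borel (D u)"
  have dist: "real_distribution (?\<delta> u)" if "0 < u" for u
    using that by (intro real_distribution_distr Dm) simp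
  have pos: "AE x in ?\<delta> u. 0 \<le> x" if "0 < u" for u
    using that Dpos[of u] by (subst AE_distr_iff) auto
  have lt: "(\<integral>x. exp (- z * x) \<partial>?\<delta> u) = exp (- u * (c1 * z powr \<alpha>1 + c2 * z powr \<alpha>2))"
    if "0 < u" "0 < z" for u z
    using that Dlt[of u z] by (subst integral_distr) auto
  from stable_components_exist(1)[OF \<alpha>(1,2) c(1,2) dist pos lt]
  obtain A where A: "real_distribution A \<and> (AE x in A. 0 \<le> x) \<and>
      (\<forall>z>0. (\<integral>x. exp (- z * x) \<partial>A) = exp (- (c1 * z powr \<alpha>1)))" by (rule exE)
  from stable_components_exist(2)[OF \<alpha>(1,2) c(1,2) dist pos lt]
  obtain B where B: "real_distribution B \<and> (AE x in B. 0 \<le> x) \<and>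
      (\<forall>z>0. (\<integral>x. exp (- z * x) \<partial>B) = exp (- (c2 * z powr \<alpha>2)))" by (rule exE)
  have sp: "stable_pair (A \<Otimes>\<^sub>M B) fst snd \<alpha>1 \<alpha>2 c1 c2"
    using A B by (intro stable_pair_product \<alpha> c) auto
  then interpret N: stable_pair "A \<Otimes>\<^sub>M B" fst snd \<alpha>1 \<alpha>2 c1 c2 .
  have "?\<delta> u = distr (A \<Otimes>\<^sub>M B) borel (N.E u)" if u: "0 < u" for u
  proof (rule laplace_transform_unique)
    have Em [measurable]: "N.E u \<in> borel_measurable (A \<Otimes>\<^sub>M B)"
      by (rule N.measurable_E[OF N.am N.bm]) simp
    show "real_distribution (?\<delta> u)" by (rule dist[OF u])
    show "real_distribution (distr (A \<Otimes>\<^sub>M B) borel (N.E u))" by (rule N.real_distribution_distr[OF Em])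
    show "AE x in ?\<delta> u. 0 \<le> x" by (rule pos[OF u])
    show "AE x in distr (A \<Otimes>\<^sub>M B) borel (N.E u). 0 \<le> x"
      using N.AE_E_nonneg by (subst AE_distr_iff) auto
    fix z :: real assume z: "0 < z"
    show "(\<integral>x. exp (- z * x) \<partial>?\<delta> u) = (\<integral>x. exp (- z * x) \<partial>distr (A \<Otimes>\<^sub>M B) borel (N.E u))"
      unfolding lt[OF u z] using N.laplace_power_sum[OF u z] by (subst integral_distr) auto
  qed
  with sp show ?thesis by (rule that)
qed

text \<open>The event that the path stays below t up to time n has probability at most exp (t - n),
  by the Markov bound with z = 1, where the Laplace exponent is c1 + c2 = 1. Consequently
  \<open>first_passage\<close> resorts to its default value for an empty set on a null set
  only.\<close>

lemma (in prob_space) AE_subordinator_unbounded: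
  assumes D: "mixed_stable_subordinator M c1 \<alpha>1 c2 \<alpha>2 D" and c: "c1 + c2 = 1"
  shows "AE \<omega> in M. {s. 0 \<le> s \<and> t < D s \<omega>} \<noteq> {}"
proof -
  note Dm [measurable] = subordinator_measurable[OF D]
  note Dpos = subordinator_nonneg[OF D]
  have Dm' [measurable]: "D (real n) \<in> borel_measurable M" for n :: nat by (rule Dm) simp
  let ?S = "{\<omega> \<in> space M. \<forall>n::nat. D (real n) \<omega> \<le> t}"
  have "prob ?S \<le> exp t * exp (- real n)" for n
  proof -
    have "prob ?S = expectation (indicator ?S)" by simp
    also have "\<dots> \<le> expectation (\<lambda>\<omega>. exp t * exp (- 1 * D (real n) \<omega>))"
    proof (rule integral_mono_AE)
      show "integrable M (indicat_real ?S)" by (intro integrable_real_indicator) (auto simp: emeasure_eq_measure)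
      have "integrable M (\<lambda>\<omega>. exp (- 1 * D (real n) \<omega>))"
        by (rule integrable_const_bound[where B=1]) (use Dpos[of "real n"] in \<open>auto elim!: eventually_mono\<close>)
      then show "integrable M (\<lambda>\<omega>. exp t * exp (- 1 * D (real n) \<omega>))" by simp
      show "AE \<omega> in M. indicat_real ?S \<omega> \<le> exp t * exp (- 1 * D (real n) \<omega>)"
        unfolding exp_add[symmetric] by (auto simp: indicator_def)
    qed
    also have "\<dots> = exp t * exp (- real n)"
    proof -
      have "expectation (\<lambda>\<omega>. exp (- 1 * D (real n) \<omega>)) = exp (- real n * (c1 * 1 powr \<alpha>1 + c2 * 1 powr \<alpha>2))"
        using D unfolding mixed_stable_subordinator_def
        by (elim conjE) (simp only: zero_less_one of_nat_0_le_iff)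
      then show ?thesis using c by simp
    qed
    finally show ?thesis .
  qed
  moreover have "(\<lambda>n. exp t * exp (- real n)) \<longlonglongrightarrow> exp t * 0"
    by (intro tendsto_intros filterlim_compose[OF exp_at_bot] filterlim_compose[OF filterlim_uminus_at_bot_at_top] filterlim_real_sequentially)
  ultimately have "prob ?S \<le> exp t * 0" by (intro LIMSEQ_le_const) blast+
  then have "prob ?S \<le> 0" by simp
  then have "AE \<omega> in M. \<omega> \<notin> ?S"
    by (intro AE_not_in) (simp add: null_sets_def emeasure_eq_measure measure_le_0_iff)
  with AE_space show ?thesis
  proof eventually_elim
    case (elim \<omega>)
    then obtain n :: nat where "t < D (real n) \<omega>" by (auto simp: not_le)
    then have "real n \<in> {s. 0 \<le> s \<and> t < D s \<omega>}" by simp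
    then show ?case by blast
  qed
qed

text \<open>Passage by time x and exceeding t at time x are different events when the path takes the
  value t exactly at x. Each is nevertheless caught between the other at nearby times, on the side
  of \<open>D\<close> as on the side of \<open>E\<close>, and the events of exceeding t at a fixed
  time have equal probabilities on both sides.\<close>

lemma (in prob_space) distr_first_passage:
  assumes D: "mixed_stable_subordinator M c1 \<alpha>1 c2 \<alpha>2 D" and t: "0 < t"
    and Y [measurable]: "first_passage D t \<in> borel_measurable M"
    and N: "stable_pair N a b \<alpha>1 \<alpha>2 c1 c2"
    and law: "\<And>u. 0 < u \<Longrightarrow> distr M borel (D u) = distr N borel (\<lambda>x. power_sum (1 / \<alpha>1) (1 / \<alpha>2) (a x) (b x) u)"
  shows "distr M borel (first_passage D t) = distr N borel (\<lambda>x. power_sum_inv (1 / \<alpha>1) (1 / \<alpha>2) (a x) (b x) t)"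
proof -
  interpret N: stable_pair N a b \<alpha>1 \<alpha>2 c1 c2 by (rule N)
  let ?Y = "first_passage D t"
  note Dm [measurable] = subordinator_measurable[OF D]
  note Dmono = subordinator_mono[OF D]
  have Zm [measurable]: "N.Z t \<in> borel_measurable N"
    by (rule N.measurable_Z[OF N.am N.bm]) simp
  have Em [measurable]: "N.E u \<in> borel_measurable N" for u
    by (rule N.measurable_E[OF N.am N.bm]) simp
  have cdfY: "cdf (distr M borel ?Y) x = prob {\<omega> \<in> space M. ?Y \<omega> \<le> x}" for x
    by (simp add: cdf_def measure_distr vimage_def Int_def conj_commute)
  have cdfZ: "cdf (distr N borel (N.Z t)) x = N.prob {\<omega> \<in> space N. N.Z t \<omega> \<le> x}" for x
    by (simp add: cdf_def measure_distr vimage_def Int_def conj_commute)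
  have DE: "prob {\<omega> \<in> space M. t < D v \<omega>} = N.prob {\<omega> \<in> space N. t < N.E v \<omega>}" if v: "0 < v" for v
  proof -
    have "measure (distr M borel (D v)) {t<..} = measure (distr N borel (N.E v)) {t<..}"
      by (simp add: law[OF v])
    then show ?thesis using v by (simp add: measure_distr vimage_def Int_def conj_commute)
  qed
  have ne: "AE \<omega> in M. {s. 0 \<le> s \<and> t < D s \<omega>} \<noteq> {}"
    by (rule AE_subordinator_unbounded[OF D N.c(3)])
  have bdd: "bdd_below {s. 0 \<le> s \<and> t < D s \<omega>}" for \<omega> by (rule bdd_belowI[of _ 0]) auto
  have Y1: "prob {\<omega> \<in> space M. ?Y \<omega> \<le> x} \<le> prob {\<omega> \<in> space M. t < D v \<omega>}" if "0 \<le> x" "x < v" for x v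
  proof (rule finite_measure_mono_AE)
    show "AE \<omega> in M. \<omega> \<in> {\<omega> \<in> space M. ?Y \<omega> \<le> x} \<longrightarrow> \<omega> \<in> {\<omega> \<in> space M. t < D v \<omega>}"
      using ne
    proof eventually_elim
      case (elim \<omega>)
      show ?case
      proof
        assume \<omega>: "\<omega> \<in> {\<omega> \<in> space M. ?Y \<omega> \<le> x}"
        have "?Y \<omega> = Inf {s. 0 \<le> s \<and> t < D s \<omega>}"
          unfolding first_passage_def using elim t by (subst if_not_P) auto
        then have "Inf {s. 0 \<le> s \<and> t < D s \<omega>} < v" using \<omega> that by auto
        then obtain s where s: "0 \<le> s" "t < D s \<omega>" "s < v"
          using cInf_less_iff[OF elim bdd] by auto
        then show "\<omega> \<in> {\<omega> \<in> space M. t < D v \<omega>}" using \<omega> Dmono[of \<omega> s v] by auto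
      qed
    qed
    have [measurable]: "D v \<in> borel_measurable M" using that by (intro Dm) simp
    show "{\<omega> \<in> space M. t < D v \<omega>} \<in> events" by measurable
  qed
  have Y2: "prob {\<omega> \<in> space M. t < D v \<omega>} \<le> prob {\<omega> \<in> space M. ?Y \<omega> \<le> v}" if "0 \<le> v" for v
  proof (rule finite_measure_mono)
    show "{\<omega> \<in> space M. t < D v \<omega>} \<subseteq> {\<omega> \<in> space M. ?Y \<omega> \<le> v}"
      using that t bdd by (auto simp: first_passage_def intro!: cInf_lower)
  qed measurable
  have Z1: "N.prob {\<omega> \<in> space N. t < N.E v \<omega>} \<le> N.prob {\<omega> \<in> space N. N.Z t \<omega> \<le> v}" if "0 \<le> v" for v
  proof (rule N.finite_measure_mono_AE)
    show "AE \<omega> in N. \<omega> \<in> {\<omega> \<in> space N. t < N.E v \<omega>} \<longrightarrow> \<omega> \<in> {\<omega> \<in> space N. N.Z t \<omega> \<le> v}"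
      using N.AE_admissible
      by eventually_elim (use that t power_sum_inv_less_iff[OF N.exponents] in \<open>auto simp: less_imp_le\<close>)
  qed measurable
  have Z2: "N.prob {\<omega> \<in> space N. N.Z t \<omega> \<le> x} \<le> N.prob {\<omega> \<in> space N. t < N.E v \<omega>}" if "0 \<le> x" "x < v" for x v
  proof (rule N.finite_measure_mono_AE)
    show "AE \<omega> in N. \<omega> \<in> {\<omega> \<in> space N. N.Z t \<omega> \<le> x} \<longrightarrow> \<omega> \<in> {\<omega> \<in> space N. t < N.E v \<omega>}"
      using N.AE_admissible
    proof eventually_elim
      case (elim \<omega>)
      then show ?case using that t power_sum_inv_less_iff[OF N.exponents elim t, of v] by auto
    qed
  qed measurable
  show ?thesis
  proof (rule cdf_sandwich_imp_eq)
    show "real_distribution (distr M borel ?Y)" by (rule real_distribution_distr[OF Y])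
    show "real_distribution (distr N borel (N.Z t))" by (rule N.real_distribution_distr[OF Zm])
    fix x v :: real assume xv: "x < v"
    show "cdf (distr M borel ?Y) x \<le> cdf (distr N borel (N.Z t)) v"
    proof (cases "0 \<le> x")
      case True
      then show ?thesis unfolding cdfY cdfZ using Y1[OF True xv] Z1[of v] DE[of v] xv by simp
    next
      case False
      then have "\<not> ?Y \<omega> \<le> x" for \<omega> using first_passage_nonneg[of D t \<omega>] by linarith
      then have "{\<omega> \<in> space M. ?Y \<omega> \<le> x} = {}" by simp
      then have "cdf (distr M borel ?Y) x = 0" by (simp only: cdfY measure_empty)
      then show ?thesis by (simp add: cdfZ)
    qed
    show "cdf (distr N borel (N.Z t)) x \<le> cdf (distr M borel ?Y) v"
    proof (cases "0 \<le> x")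
      case True
      then show ?thesis unfolding cdfY cdfZ using Z2[OF True xv] Y2[of v] DE[of v] xv by simp
    next
      case False
      then have "\<not> N.Z t \<omega> \<le> x" for \<omega> using N.Z_nonneg[where t = t and \<omega> = \<omega>] by linarith
      then have "{\<omega> \<in> space N. N.Z t \<omega> \<le> x} = {}" by simp
      then have "cdf (distr N borel (N.Z t)) x = 0" by (simp only: cdfZ measure_empty)
      then show ?thesis by (simp add: cdfY)
    qed
  qed
qed

section \<open>Time change\<close>

lemma process_eventI:
  assumes "0 \<le> s" and B: "B \<in> sets N" and sp: "space N = UNIV"
  shows "{\<omega> \<in> space M. X s \<omega> \<in> B} \<in> process_events M N X"
proof -
  let ?f = "\<lambda>\<omega>. \<lambda>t\<in>{0..}. X t \<omega>"
  have "{f \<in> space (\<Pi>\<^sub>M t\<in>{0..}. N). f s \<in> B} \<in> sets (\<Pi>\<^sub>M t\<in>{0..}. N)"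
    using measurable_sets[OF measurable_component_singleton[of s "{0..}" "\<lambda>_. N"] B] assms(1)
    by (simp add: vimage_def Int_def conj_commute)
  then have "?f -` {f \<in> space (\<Pi>\<^sub>M t\<in>{0..}. N). f s \<in> B} \<inter> space M \<in> process_events M N X"
    unfolding process_events_def by (rule in_vimage_algebra)
  also have "?f -` {f \<in> space (\<Pi>\<^sub>M t\<in>{0..}. N). f s \<in> B} \<inter> space M = {\<omega> \<in> space M. X s \<omega> \<in> B}"
    using assms(1) by (auto simp: space_PiM sp)
  finally show ?thesis .
qed

text \<open>The random time is approximated from the right by times with countably many values, along
  which the chain is eventually constant by right-continuity.\<close>

lemma (in prob_space) prob_at_independent_time:
  fixes Q :: "real \<Rightarrow> 'a \<Rightarrow> 's" and T :: "'a \<Rightarrow> real" and \<pi> :: "real \<Rightarrow> real"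
  assumes right_cont: "\<And>t \<omega>. 0 \<le> t \<Longrightarrow> \<omega> \<in> space M \<Longrightarrow> \<forall>\<^sub>F u in at_right t. Q u \<omega> = Q t \<omega>"
    and T [measurable]: "T \<in> borel_measurable M" and T0: "\<And>\<omega>. 0 \<le> T \<omega>"
    and Q: "\<And>s. 0 \<le> s \<Longrightarrow> {\<omega> \<in> space M. Q s \<omega> = x} \<in> events"
    and indep: "\<And>s B. 0 \<le> s \<Longrightarrow> B \<in> sets borel \<Longrightarrow>
      prob ({\<omega> \<in> space M. Q s \<omega> = x} \<inter> {\<omega> \<in> space M. T \<omega> \<in> B})
        = prob {\<omega> \<in> space M. Q s \<omega> = x} * prob {\<omega> \<in> space M. T \<omega> \<in> B}"
    and \<pi>: "\<And>s. 0 \<le> s \<Longrightarrow> prob {\<omega> \<in> space M. Q s \<omega> = x} = \<pi> s"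
    and cont: "continuous_on UNIV \<pi>" and \<pi>_bound: "\<And>s. \<pi> s \<in> {0..1}"
  shows "{\<omega> \<in> space M. Q (T \<omega>) \<omega> = x} \<in> events"
    and "prob {\<omega> \<in> space M. Q (T \<omega>) \<omega> = x} = expectation (\<lambda>\<omega>. \<pi> (T \<omega>))"
proof -
  have \<pi>m [measurable]: "\<pi> \<in> borel_measurable borel" using cont by (rule borel_measurable_continuous_onI)
  define K where "K n \<omega> = nat \<lfloor>T \<omega> * real (Suc n)\<rfloor>" for n :: nat and \<omega>
  \<comment> \<open>The right end of the grid cell that contains the random time. The added 1 makes
    the approximation strictly larger, as a limit along \<open>at_right\<close> requires.\<close>
  define s where "s n j = (real j + 1) / real (Suc n)" for n j :: nat
  have s0: "0 \<le> s n j" for n j by (simp add: s_def)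
  have Km [measurable]: "K n \<in> measurable M (count_space UNIV)" for n
    unfolding K_def by measurable
  have K: "real (K n \<omega>) \<le> T \<omega> * real (Suc n)" "T \<omega> * real (Suc n) < real (K n \<omega>) + 1" for n \<omega>
  proof -
    have "0 \<le> T \<omega> * real (Suc n)" using T0 by simp
    then have "real (K n \<omega>) = of_int \<lfloor>T \<omega> * real (Suc n)\<rfloor>" unfolding K_def by simp
    then show "real (K n \<omega>) \<le> T \<omega> * real (Suc n)" "T \<omega> * real (Suc n) < real (K n \<omega>) + 1" by linarith+
  qed
  have gt: "T \<omega> < s n (K n \<omega>)" for n \<omega>
    using K(2)[of \<omega> n] by (simp add: s_def pos_less_divide_eq del: of_nat_Suc)
  have le: "s n (K n \<omega>) \<le> T \<omega> + inverse (real (Suc n))" for n \<omega>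
  proof -
    have "s n (K n \<omega>) \<le> (T \<omega> * real (Suc n) + 1) / real (Suc n)"
      unfolding s_def using K(1)[of n \<omega>] by (intro divide_right_mono) auto
    also have "\<dots> = T \<omega> + inverse (real (Suc n))"
      by (simp add: add_divide_distrib inverse_eq_divide del: of_nat_Suc)
    finally show ?thesis .
  qed
  have lim: "(\<lambda>n. s n (K n \<omega>)) \<longlonglongrightarrow> T \<omega>" for \<omega>
  proof (rule tendsto_sandwich[where f = "\<lambda>_. T \<omega>" and h = "\<lambda>n. T \<omega> + inverse (real (Suc n))"])
    show "(\<lambda>n. T \<omega> + inverse (real (Suc n))) \<longlonglongrightarrow> T \<omega>"
      using tendsto_add[OF tendsto_const LIMSEQ_inverse_real_of_nat, of "T \<omega>"] by simp
  qed (simp_all add: le less_imp_le[OF gt] del: of_nat_Suc)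
  then have lim_right: "filterlim (\<lambda>n. s n (K n \<omega>)) (at_right (T \<omega>)) sequentially" for \<omega>
    using gt by (auto simp: filterlim_at less_imp_neq[symmetric])
  define C where "C n j = {\<omega> \<in> space M. Q (s n j) \<omega> = x}" for n j
  define A where "A n j = {\<omega> \<in> space M. K n \<omega> = j}" for n j
  define H where "H n = (\<Union>j. A n j \<inter> C n j)" for n
  have [measurable]: "C n j \<in> events" "A n j \<in> events" for n j
    unfolding C_def A_def by (rule Q[OF s0]) measurable
  have [measurable]: "H n \<in> events" for n unfolding H_def by measurable
  have H_iff: "\<omega> \<in> H n \<longleftrightarrow> Q (s n (K n \<omega>)) \<omega> = x" if "\<omega> \<in> space M" for n \<omega>
    using that by (auto simp: H_def A_def C_def)
  \<comment> \<open>On this event the chain is observed at the deterministic time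
    \<open>s n j\<close> and the rest depends on the random time only, so independence
    applies.\<close>
  have AC: "prob (A n j \<inter> C n j) = \<pi> (s n j) * prob (A n j)" for n j
  proof -
    define B where "B = {y::real. nat \<lfloor>y * real (Suc n)\<rfloor> = j}"
    have A: "A n j = {\<omega> \<in> space M. T \<omega> \<in> B}"
      by (simp add: A_def K_def B_def)
    have "B \<in> sets borel" unfolding B_def by measurable
    from indep[OF s0 this] show ?thesis
      unfolding A C_def \<pi>[OF s0] by (simp only: Int_commute)
  qed
  have disj: "disjoint_family (A n)" for n by (auto simp: disjoint_family_on_def A_def)
  have prob_H: "prob (H n) = expectation (\<lambda>\<omega>. \<pi> (s n (K n \<omega>)))" for n
  proof -
    have [measurable]: "(\<lambda>\<omega>. \<pi> (s n (K n \<omega>))) \<in> borel_measurable M"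
      by (rule measurable_compose[OF Km]) simp
    have "emeasure M (H n) = (\<Sum>j. emeasure M (A n j \<inter> C n j))"
      unfolding H_def using disj[of n]
      by (intro suminf_emeasure[symmetric]) (auto simp: disjoint_family_on_def)
    also have "\<dots> = (\<Sum>j. \<integral>\<^sup>+\<omega>. ennreal (\<pi> (s n j)) * indicator (A n j) \<omega> \<partial>M)"
      using \<pi>_bound by (simp add: nn_integral_cmult emeasure_eq_measure AC ennreal_mult)
    also have "\<dots> = (\<integral>\<^sup>+\<omega>. (\<Sum>j. ennreal (\<pi> (s n j)) * indicator (A n j) \<omega>) \<partial>M)"
      by (intro nn_integral_suminf[symmetric]) measurable
    also have "\<dots> = (\<integral>\<^sup>+\<omega>. ennreal (\<pi> (s n (K n \<omega>))) \<partial>M)"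
      by (intro nn_integral_cong suminf_cmult_indicator[OF disj]) (auto simp: A_def)
    also have "\<dots> = ennreal (expectation (\<lambda>\<omega>. \<pi> (s n (K n \<omega>))))"
      using \<pi>_bound by (intro nn_integral_eq_integral integrable_const_bound[where B=1]) auto
    finally show ?thesis
      using \<pi>_bound by (simp add: emeasure_eq_measure integral_nonneg_AE)
  qed
  let ?S = "{\<omega> \<in> space M. Q (T \<omega>) \<omega> = x}"
  have ind: "(\<lambda>n. indicator (H n) \<omega> :: real) \<longlonglongrightarrow> indicator ?S \<omega>" if \<omega>: "\<omega> \<in> space M" for \<omega>
  proof (rule tendsto_eventually)
    have "\<forall>\<^sub>F n in sequentially. Q (s n (K n \<omega>)) \<omega> = Q (T \<omega>) \<omega>"
      using lim_right right_cont[OF T0 \<omega>] unfolding filterlim_iff by blast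
    then show "\<forall>\<^sub>F n in sequentially. indicator (H n) \<omega> = (indicator ?S \<omega> :: real)"
      by eventually_elim (use \<omega> H_iff in \<open>auto simp: indicator_def\<close>)
  qed
  \<comment> \<open>Measurability of the chain at the random time is itself obtained from the
    approximation, as a pointwise limit of indicators.\<close>
  have "(indicator ?S :: 'a \<Rightarrow> real) \<in> borel_measurable M"
    by (rule borel_measurable_LIMSEQ_real[OF ind]) measurable
  then have "?S \<inter> space M \<in> events" by (simp add: borel_measurable_indicator_iff)
  then show S [measurable]: "?S \<in> events" by (simp add: Int_absorb2)
  have "(\<lambda>n. expectation (\<lambda>\<omega>. indicat_real (H n) \<omega>)) \<longlonglongrightarrow> expectation (\<lambda>\<omega>. indicat_real ?S \<omega>)"
    by (rule integral_dominated_convergence[where w = "\<lambda>_. 1"]) (use ind in auto)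
  then have 1: "(\<lambda>n. prob (H n)) \<longlonglongrightarrow> prob ?S" by simp
  have 2: "(\<lambda>n. expectation (\<lambda>\<omega>. \<pi> (s n (K n \<omega>)))) \<longlonglongrightarrow> expectation (\<lambda>\<omega>. \<pi> (T \<omega>))"
  proof (rule integral_dominated_convergence[where w = "\<lambda>_. 1"])
    show "(\<lambda>\<omega>. \<pi> (s n (K n \<omega>))) \<in> borel_measurable M" for n
      by (rule measurable_compose[OF Km]) simp
    show "AE \<omega> in M. (\<lambda>n. \<pi> (s n (K n \<omega>))) \<longlonglongrightarrow> \<pi> (T \<omega>)"
      using cont lim by (auto intro!: AE_I2 isCont_tendsto_compose[of _ \<pi>] simp: continuous_on_eq_continuous_at)
  qed (use \<pi>_bound in auto)
  show "prob ?S = expectation (\<lambda>\<omega>. \<pi> (T \<omega>))"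
    using LIMSEQ_unique[OF 1] 2 unfolding prob_H by blast
qed

text \<open>Splitting over the countably many values of \<open>X\<close> and exchanging sum and
  integral. Working with nonnegative integrals allows integrability to be concluded
  afterwards.\<close>

lemma (in prob_space) nn_integral_at_independent_time:
  fixes X :: "'a \<Rightarrow> 's :: countable" and p :: "real \<Rightarrow> 's pmf"
  assumes X: "\<And>x. {\<omega> \<in> space M. X \<omega> = x} \<in> events"
    and prob: "\<And>x. prob {\<omega> \<in> space M. X \<omega> = x} = expectation (\<lambda>\<omega>. pmf (p (T \<omega>)) x)"
    and m: "\<And>x. (\<lambda>\<omega>. pmf (p (T \<omega>)) x) \<in> borel_measurable M"
  shows "(\<integral>\<^sup>+\<omega>. ennreal (L (X \<omega>)) \<partial>M) = (\<integral>\<^sup>+\<omega>. \<integral>\<^sup>+x. ennreal (L x) \<partial>p (T \<omega>) \<partial>M)"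
proof -
  note X [measurable] m [measurable]
  have "(\<integral>\<^sup>+\<omega>. ennreal (L (X \<omega>)) \<partial>M)
      = (\<integral>\<^sup>+\<omega>. \<integral>\<^sup>+x. ennreal (L x) * indicator {\<omega> \<in> space M. X \<omega> = x} \<omega> \<partial>count_space UNIV \<partial>M)"
  proof (rule nn_integral_cong)
    fix \<omega> assume "\<omega> \<in> space M"
    then have "(\<integral>\<^sup>+x. ennreal (L x) * indicator {\<omega> \<in> space M. X \<omega> = x} \<omega> \<partial>count_space UNIV)
        = (\<integral>\<^sup>+x. ennreal (L x) * indicator {X \<omega>} x \<partial>count_space UNIV)"
      by (intro nn_integral_cong) (auto simp: indicator_def)
    then show "ennreal (L (X \<omega>)) = (\<integral>\<^sup>+x. ennreal (L x) * indicator {\<omega> \<in> space M. X \<omega> = x} \<omega> \<partial>count_space UNIV)"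
      by simp
  qed
  also have "\<dots> = (\<integral>\<^sup>+x. \<integral>\<^sup>+\<omega>. ennreal (L x) * indicator {\<omega> \<in> space M. X \<omega> = x} \<omega> \<partial>M \<partial>count_space UNIV)"
    by (rule nn_integral_count_space_nn_integral) auto
  also have "\<dots> = (\<integral>\<^sup>+x. \<integral>\<^sup>+\<omega>. ennreal (pmf (p (T \<omega>)) x) * ennreal (L x) \<partial>M \<partial>count_space UNIV)"
  proof (rule nn_integral_cong)
    fix x
    have "(\<integral>\<^sup>+\<omega>. ennreal (pmf (p (T \<omega>)) x) \<partial>M) = ennreal (expectation (\<lambda>\<omega>. pmf (p (T \<omega>)) x))"
      by (intro nn_integral_eq_integral integrable_const_bound[where B=1]) (auto simp: pmf_le_1)
    then show "(\<integral>\<^sup>+\<omega>. ennreal (L x) * indicator {\<omega> \<in> space M. X \<omega> = x} \<omega> \<partial>M)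
        = (\<integral>\<^sup>+\<omega>. ennreal (pmf (p (T \<omega>)) x) * ennreal (L x) \<partial>M)"
      by (simp add: nn_integral_cmult nn_integral_multc emeasure_eq_measure prob mult.commute)
  qed
  also have "\<dots> = (\<integral>\<^sup>+\<omega>. \<integral>\<^sup>+x. ennreal (pmf (p (T \<omega>)) x) * ennreal (L x) \<partial>count_space UNIV \<partial>M)"
    by (rule nn_integral_count_space_nn_integral[symmetric]) auto
  also have "\<dots> = (\<integral>\<^sup>+\<omega>. \<integral>\<^sup>+x. ennreal (L x) \<partial>p (T \<omega>) \<partial>M)"
    by (simp add: nn_integral_measure_pmf)
  finally show ?thesis .
qed

text \<open>The Markov property with the single past time 0. The starting event has probability 1,
  so conditioning on it changes nothing.\<close>

lemma markov_chain_marginal: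
  assumes "prob_space M" and chain: "markov_chain_with_rates M S q x0 X"
  obtains P where "transition_function S P" "has_transition_rates S P q"
    "\<And>u y. 0 \<le> u \<Longrightarrow> measure M {\<omega> \<in> space M. X u \<omega> = y} = pmf (P u x0) y"
proof -
  interpret prob_space M by fact
  from chain obtain P where P: "transition_function S P" "has_transition_rates S P q"
    and markov: "\<And>(n::nat) (t::nat \<Rightarrow> real) x u y.
           0 \<le> t 0 \<Longrightarrow> (\<forall>i<n. t i \<le> t (Suc i)) \<Longrightarrow> t n \<le> u \<Longrightarrow>
           measure M {\<omega>\<in>space M. \<forall>i\<le>n. X (t i) \<omega> = x i} \<noteq> 0 \<Longrightarrow>
           \<P>(\<omega> in M. X u \<omega> = y \<bar> \<forall>i\<le>n. X (t i) \<omega> = x i) = pmf (P (u - t n) (x n)) y"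
    unfolding markov_chain_with_rates_def by blast
  have Xm [measurable]: "X u \<in> measurable M (count_space UNIV)" if "0 \<le> u" for u
    using chain that unfolding markov_chain_with_rates_def by blast
  have X0 [measurable]: "X 0 \<in> measurable M (count_space UNIV)" by (rule Xm) simp
  have start: "AE \<omega> in M. X 0 \<omega> = x0"
    using chain unfolding markov_chain_with_rates_def by blast
  then have one: "prob {\<omega> \<in> space M. X 0 \<omega> = x0} = 1" by (subst prob_Collect_eq_1) auto
  have "prob {\<omega> \<in> space M. X u \<omega> = y} = pmf (P u x0) y" if u: "0 \<le> u" for u y
  proof -
    have [measurable]: "X u \<in> measurable M (count_space UNIV)" by (rule Xm[OF u])
    have "\<P>(\<omega> in M. X u \<omega> = y \<bar> \<forall>i\<le>(0::nat). X 0 \<omega> = x0) = pmf (P (u - 0) x0) y"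
      using markov[of "\<lambda>_. 0" 0 u "\<lambda>_. x0" y] one u by simp
    then have "prob {\<omega> \<in> space M. X u \<omega> = y \<and> X 0 \<omega> = x0} = pmf (P u x0) y"
      using one by (simp add: cond_prob_def)
    moreover have "prob {\<omega> \<in> space M. X u \<omega> = y \<and> X 0 \<omega> = x0} = prob {\<omega> \<in> space M. X u \<omega> = y}"
      by (rule prob_eq_AE) (use start in \<open>auto elim!: eventually_mono\<close>)
    ultimately show ?thesis by simp
  qed
  with P show ?thesis by (rule that)
qed

lemma (in prob_space) cond_mean_AE:
  assumes "AE \<omega> in M. A \<omega>" and [measurable]: "{\<omega> \<in> space M. A \<omega>} \<in> events" "Z \<in> borel_measurable M"
  shows "cond_mean M Z A = expectation Z"
proof -
  have "prob {\<omega> \<in> space M. A \<omega>} = 1" using assms by (subst prob_Collect_eq_1) auto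
  moreover have "(\<integral>\<omega>\<in>{\<omega> \<in> space M. A \<omega>}. Z \<omega> \<partial>M) = expectation Z"
    unfolding set_lebesgue_integral_def
    by (rule integral_cong_AE) (use assms(1) AE_space in \<open>auto simp: indicator_def\<close>)
  ultimately show ?thesis by (simp add: cond_mean_def)
qed

theorem theorem3p4:
  fixes M :: "'w measure"
    and Q :: "real \<Rightarrow> 'w \<Rightarrow> nat \<times> nat"
    and D :: "real \<Rightarrow> 'w \<Rightarrow> real"
    and lam mu \<alpha>1 \<alpha>2 c1 c2 :: real
    and k :: nat
  assumes "prob_space M"
    and "lam > 0" and "mu > 0" and "k \<ge> 1"
    and "0 < \<alpha>2" and "\<alpha>2 < \<alpha>1" and "\<alpha>1 < 1"
    and "c1 \<ge> 0" and "c2 \<ge> 0" and "c1 + c2 = 1"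
    and "erlang_queue M lam mu k Q"
    and "mixed_stable_subordinator M c1 \<alpha>1 c2 \<alpha>2 D"
    and "independent_processes M Q (first_passage D)"
  shows "let X = time_changed Q (first_passage D);
             m = mean_queue_length M k X
         in (\<forall>t\<ge>0. integrable M (\<lambda>\<omega>. real (queue_length k X t \<omega>))) \<and>
            (\<forall>t>0. caputo_differentiable \<alpha>1 m t \<and> caputo_differentiable \<alpha>2 m t \<and>
               c1 * caputo_derivative \<alpha>1 m t + c2 * caputo_derivative \<alpha>2 m t
                 = real k * (lam - mu) + real k * mu * empty_prob M X t) \<and>
            m 0 = 0"
proof -
  interpret prob_space M by fact
  note par = \<open>lam > 0\<close> \<open>mu > 0\<close> \<open>k \<ge> 1\<close>
  define Y where "Y = first_passage D"
  define X where "X = time_changed Q Y"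
  define m where "m = mean_queue_length M k X"
  have chain: "markov_chain_with_rates M (erlang_states k) (erlang_rate lam mu k) (0, 0) Q"
    using \<open>erlang_queue M lam mu k Q\<close> by (simp add: erlang_queue_def)
  obtain P where P: "transition_function (erlang_states k) P"
      "has_transition_rates (erlang_states k) P (erlang_rate lam mu k)"
    and marginal: "\<And>u y. 0 \<le> u \<Longrightarrow> prob {\<omega> \<in> space M. Q u \<omega> = y} = pmf (P u (0, 0)) y"
    using markov_chain_marginal[OF \<open>prob_space M\<close> chain] by blast
  have Qm: "Q u \<in> measurable M (count_space UNIV)" if "0 \<le> u" for u
    using chain that unfolding markov_chain_with_rates_def by blast
  have right_cont: "\<forall>\<^sub>F u in at_right t. Q u \<omega> = Q t \<omega>" if "0 \<le> t" "\<omega> \<in> space M" for t \<omega>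
    using chain that unfolding markov_chain_with_rates_def by blast
  have start: "AE \<omega> in M. Q 0 \<omega> = (0, 0)"
    using chain unfolding markov_chain_with_rates_def by blast
  have indep: "indep_set (process_events M (count_space UNIV) Q) (process_events M borel Y)"
    using \<open>independent_processes M Q (first_passage D)\<close> by (simp add: independent_processes_def Y_def)
  have Y_event: "{\<omega> \<in> space M. Y t \<omega> \<in> B} \<in> process_events M borel Y" if "0 \<le> t" "B \<in> sets borel" for t B
    using that by (intro process_eventI) auto
  have Q_event: "{\<omega> \<in> space M. Q t \<omega> = y} \<in> process_events M (count_space UNIV) Q" if "0 \<le> t" for t y
    using process_eventI[OF that, of "{y}" "count_space UNIV" M Q] by simp
  \<comment> \<open>Independence of sigma-algebras includes that their members are events;
    measurability of the first passage times is read off from this.\<close>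
  have "process_events M borel Y \<subseteq> events"
    using indep unfolding indep_set_def indep_sets_def by (auto simp: UNIV_bool)
  then have Ym: "Y t \<in> borel_measurable M" if "0 \<le> t" for t
    using Y_event[OF that] by (intro measurableI) (auto simp: vimage_def Int_def conj_commute)
  have Y0: "0 \<le> Y t \<omega>" for t \<omega> unfolding Y_def by (rule first_passage_nonneg)

  \<comment> \<open>The constant extension to negative times gives continuity on the whole line, as
    the lemmas on random times and antiderivatives expect.\<close>
  define p where "p s = P (max 0 s) (0, 0)" for s :: real
  have p_eq: "p s = P s (0, 0)" if "0 \<le> s" for s using that by (simp add: p_def)
  have p_cont: "continuous_on UNIV (\<lambda>s. pmf (p s) y)" for y
    unfolding p_def
    by (rule continuous_on_compose2[OF continuous_on_erlang_prob[OF par P erlang_start]])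
       (auto intro!: continuous_intros)
  have pm: "(\<lambda>s. pmf (p s) y) \<in> borel_measurable borel" for y
    using p_cont by (rule borel_measurable_continuous_onI)
  have X_event: "{\<omega> \<in> space M. X t \<omega> = y} \<in> events"
    and X_prob: "prob {\<omega> \<in> space M. X t \<omega> = y} = expectation (\<lambda>\<omega>. pmf (p (Y t \<omega>)) y)" if t: "0 \<le> t" for t y
  proof -
    have ind: "prob ({\<omega> \<in> space M. Q s \<omega> = y} \<inter> {\<omega> \<in> space M. Y t \<omega> \<in> B})
        = prob {\<omega> \<in> space M. Q s \<omega> = y} * prob {\<omega> \<in> space M. Y t \<omega> \<in> B}" if "0 \<le> s" "B \<in> sets borel" for s B
      by (rule indep_setD[OF indep Q_event[OF that(1)] Y_event[OF t that(2)]])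
    have ev: "{\<omega> \<in> space M. Q s \<omega> = y} \<in> events" if "0 \<le> s" for s
    proof -
      have [measurable]: "Q s \<in> measurable M (count_space UNIV)" by (rule Qm[OF that])
      show ?thesis by measurable
    qed
    have marg: "prob {\<omega> \<in> space M. Q s \<omega> = y} = pmf (p s) y" if "0 \<le> s" for s
      using marginal[OF that] p_eq[OF that] by simp
    have bnd: "pmf (p s) y \<in> {0..1}" for s by (simp add: pmf_le_1)
    show "{\<omega> \<in> space M. X t \<omega> = y} \<in> events"
      unfolding X_def time_changed_def
      by (rule prob_at_independent_time(1)[where Q = Q and T = "Y t" and \<pi> = "\<lambda>s. pmf (p s) y" and x = y];
          (rule right_cont Ym[OF t] Y0 ev ind marg p_cont bnd; assumption)?)
    show "prob {\<omega> \<in> space M. X t \<omega> = y} = expectation (\<lambda>\<omega>. pmf (p (Y t \<omega>)) y)"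
      unfolding X_def time_changed_def
      by (rule prob_at_independent_time(2)[where Q = Q and T = "Y t" and \<pi> = "\<lambda>s. pmf (p s) y" and x = y];
          (rule right_cont Ym[OF t] Y0 ev ind marg p_cont bnd; assumption)?)
  qed
  have Xm: "X t \<in> measurable M (count_space UNIV)" if "0 \<le> t" for t
    using X_event[OF that]
    by (subst measurable_count_space_eq2_countable) (auto simp: vimage_def Int_def conj_commute)
  have X0: "AE \<omega> in M. X 0 \<omega> = (0, 0)"
    using start by (simp add: X_def time_changed_def Y_def first_passage_def)

  \<comment> \<open>The drift of the mean phase count at operational time s.\<close>
  define f where "f s = real k * (lam - mu) + real k * mu * pmf (p s) (0, 0)" for s
  define B where "B = \<bar>real k * (lam - mu)\<bar> + real k * mu"
  have f_cont: "continuous_on UNIV f" unfolding f_def by (intro continuous_intros p_cont)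
  have f_bound: "\<bar>f y\<bar> \<le> B" for y
  proof -
    have "\<bar>f y\<bar> \<le> \<bar>real k * (lam - mu)\<bar> + \<bar>real k * mu * pmf (p y) (0, 0)\<bar>"
      unfolding f_def by (rule abs_triangle_ineq)
    also have "\<bar>real k * mu * pmf (p y) (0, 0)\<bar> \<le> real k * mu"
      using par by (simp add: abs_mult pmf_le_1 mult_left_le)
    finally show ?thesis by (simp add: B_def)
  qed
  obtain v V where v: "continuous_on {0..} v" "\<And>s. 0 \<le> s \<Longrightarrow> \<bar>v s\<bar> \<le> V"
    "\<And>s. 0 \<le> s \<Longrightarrow> (v has_integral pmf (P s (0, 0)) (0, 0) - 1) {0..s}"
    using erlang_empty_prob_integral[OF par P] by blast
  \<comment> \<open>On the half-line this is the derivative of \<open>f\<close>, extended constantly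
    to the left.\<close>
  define f' where "f' s = real k * mu * v (max 0 s)" for s
  have f'_cont: "continuous_on UNIV f'"
    unfolding f'_def
    by (intro continuous_intros continuous_on_compose2[OF v(1)]) auto
  have f'_bound: "\<bar>f' y\<bar> \<le> real k * mu * V" for y
    unfolding f'_def using v(2)[of "max 0 y"] par by (simp add: abs_mult)
  have ff': "f y = f 0 + antideriv f' y" if y: "0 \<le> y" for y
  proof -
    have "((\<lambda>s. real k * mu * v s) has_integral real k * mu * (pmf (P y (0, 0)) (0, 0) - 1)) {0..y}"
      using v(3)[OF y] by (rule has_integral_mult_right)
    then have "(f' has_integral real k * mu * (pmf (P y (0, 0)) (0, 0) - 1)) {0..y}"
      by (rule has_integral_eq[rotated]) (simp add: f'_def)
    then have "antideriv f' y = real k * mu * (pmf (P y (0, 0)) (0, 0) - 1)"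
      using antideriv_eq_integral[OF f'_cont f'_bound] by (simp add: integral_unique)
    moreover have "P 0 (0, 0) = return_pmf (0, 0)"
      using P(1) erlang_start unfolding transition_function_def by blast
    ultimately show ?thesis using y by (simp add: f_def p_eq algebra_simps)
  qed

  let ?L = "\<lambda>x. real (phase_count k x)"
  have mean: "(\<integral>\<^sup>+x. ennreal (?L x) \<partial>p s) = ennreal (antideriv f s)" "0 \<le> antideriv f s" if s: "0 \<le> s" for s
  proof -
    have "(f has_integral measure_pmf.expectation (P s (0, 0)) ?L) {0..s}"
      using erlang_mean_integral(2)[OF par P s]
      by (rule has_integral_eq[rotated]) (simp add: f_def p_eq)
    then have eq: "measure_pmf.expectation (P s (0, 0)) ?L = antideriv f s"
      using antideriv_eq_integral[OF f_cont f_bound] by (simp add: integral_unique)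
    show "(\<integral>\<^sup>+x. ennreal (?L x) \<partial>p s) = ennreal (antideriv f s)"
      unfolding eq[symmetric] p_eq[OF s]
      by (rule nn_integral_eq_integral[OF erlang_mean_integral(1)[OF par P s]]) simp
    show "0 \<le> antideriv f s" unfolding eq[symmetric] by simp
  qed

  obtain N :: "(real \<times> real) measure" where sp: "stable_pair N fst snd \<alpha>1 \<alpha>2 c1 c2"
    and law: "\<And>u. 0 < u \<Longrightarrow> distr M borel (D u)
      = distr N borel (\<lambda>x. power_sum (1 / \<alpha>1) (1 / \<alpha>2) (fst x) (snd x) u)"
    using stable_pair_for_subordinator[OF assms(12,5-10)] by blast
  interpret N: stable_pair N fst snd \<alpha>1 \<alpha>2 c1 c2 by (rule sp)
  have distr_Y: "distr M borel (Y t) = distr N borel (N.Z t)" if "0 < t" for t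
    unfolding Y_def using that Ym[of t]
    by (intro distr_first_passage[OF assms(12) _ _ sp law]) (auto simp: Y_def)
  have Zm: "N.Z t \<in> borel_measurable N" for t
    by (rule N.measurable_Z[OF N.am N.bm]) simp
  \<comment> \<open>Only the law at a single time enters, so the first passage time may be exchanged
    for \<open>Z\<close> inside any expectation of this form.\<close>
  have transfer: "expectation (\<lambda>\<omega>. g (Y t \<omega>)) = N.expectation (\<lambda>\<omega>. g (N.Z t \<omega>))"
    and transfer_int: "integrable M (\<lambda>\<omega>. g (Y t \<omega>)) \<longleftrightarrow> integrable N (\<lambda>\<omega>. g (N.Z t \<omega>))"
    if "0 < t" and g: "g \<in> borel_measurable borel" for t and g :: "real \<Rightarrow> real"
    using integral_distr[OF Ym g, of t] integral_distr[OF Zm g, of t]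
      integrable_distr_eq[OF Ym g, of t] integrable_distr_eq[OF Zm g, of t] that distr_Y by simp_all
  have am: "antideriv f \<in> borel_measurable borel" by (rule measurable_antideriv[OF f_cont f_bound])

  have Lm: "(\<lambda>\<omega>. ?L (X t \<omega>)) \<in> borel_measurable M" if "0 \<le> t" for t
    by (rule measurable_compose[OF Xm[OF that]]) simp
  have mean_X: "integrable M (\<lambda>\<omega>. ?L (X t \<omega>))"
      "expectation (\<lambda>\<omega>. ?L (X t \<omega>)) = N.expectation (\<lambda>\<omega>. antideriv f (N.Z t \<omega>))" if t: "0 < t" for t
  proof -
    have i: "integrable M (\<lambda>\<omega>. antideriv f (Y t \<omega>))"
      using N.integrable_antideriv_Z[OF f_cont f_bound t] by (simp only: transfer_int[OF t am])
    have "(\<integral>\<^sup>+\<omega>. ennreal (?L (X t \<omega>)) \<partial>M) = (\<integral>\<^sup>+\<omega>. \<integral>\<^sup>+x. ennreal (?L x) \<partial>p (Y t \<omega>) \<partial>M)"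
      using t X_event X_prob measurable_compose[OF Ym pm]
      by (intro nn_integral_at_independent_time) auto
    also have "\<dots> = (\<integral>\<^sup>+\<omega>. ennreal (antideriv f (Y t \<omega>)) \<partial>M)"
      by (simp only: mean(1)[OF Y0])
    also have "\<dots> = ennreal (expectation (\<lambda>\<omega>. antideriv f (Y t \<omega>)))"
      using i mean(2)[OF Y0] by (intro nn_integral_eq_integral) auto
    finally have nn: "(\<integral>\<^sup>+\<omega>. ennreal (?L (X t \<omega>)) \<partial>M) = ennreal (expectation (\<lambda>\<omega>. antideriv f (Y t \<omega>)))" .
    have e0: "0 \<le> expectation (\<lambda>\<omega>. antideriv f (Y t \<omega>))" using mean(2)[OF Y0] by simp
    show "integrable M (\<lambda>\<omega>. ?L (X t \<omega>))"
      by (rule integrableI_nn_integral_finite[OF Lm[OF less_imp_le[OF t]] _ nn]) simp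
    have "expectation (\<lambda>\<omega>. ?L (X t \<omega>)) = enn2real (\<integral>\<^sup>+\<omega>. ennreal (?L (X t \<omega>)) \<partial>M)"
      by (rule integral_eq_nn_integral[OF Lm[OF less_imp_le[OF t]]]) simp
    also have "\<dots> = expectation (\<lambda>\<omega>. antideriv f (Y t \<omega>))" unfolding nn using e0 by simp
    finally show "expectation (\<lambda>\<omega>. ?L (X t \<omega>)) = N.expectation (\<lambda>\<omega>. antideriv f (N.Z t \<omega>))"
      by (simp only: transfer[OF t am])
  qed
  have L0: "AE \<omega> in M. ?L (X 0 \<omega>) = 0" using X0 by eventually_elim (simp add: phase_count_def)
  have m_eq: "m t = expectation (\<lambda>\<omega>. ?L (X t \<omega>))" if t: "0 \<le> t" for t
    unfolding m_def mean_queue_length_def queue_length_def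
  proof (rule cond_mean_AE)
    show "AE \<omega> in M. phase_count k (X 0 \<omega>) = 0" using L0 by simp
    have [measurable]: "X 0 \<in> measurable M (count_space UNIV)" by (rule Xm) simp
    show "{\<omega> \<in> space M. phase_count k (X 0 \<omega>) = 0} \<in> events" by measurable
  qed (rule Lm[OF t])
  \<comment> \<open>Time 0 stands apart because the estimates for \<open>Z\<close> concern positive
    times; there the phase count vanishes almost surely.\<close>
  have int0: "integrable M (\<lambda>\<omega>. ?L (X 0 \<omega>))"
    using integrable_cong_AE[OF Lm[of 0] borel_measurable_const L0] by simp
  have m0: "m 0 = 0"
    using integral_cong_AE[OF Lm[of 0] borel_measurable_const L0] by (simp add: m_eq)

  have DERIV_m: "(m has_real_derivative N.flux f t) (at t)" if t: "0 < t" for t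
    by (rule has_field_derivative_transform_within_open[OF N.DERIV_expectation_antideriv[OF f_cont f_bound t], of "{0<..}"])
       (use t m_eq mean_X(2) in auto)
  from N.flux_bound[OF f_cont f_bound] obtain e C where e: "0 < e" "e < 1"
    and C: "\<And>t. 0 < t \<Longrightarrow> \<bar>N.flux f t\<bar> \<le> C * t powr (e - 1)" by blast
  have deriv_m: "deriv m y = N.flux f y" if "0 < y" for y
    using DERIV_m[OF that] by (rule DERIV_imp_deriv)
  have caputo_diff: "caputo_differentiable \<alpha> m t" if \<alpha>: "\<alpha> < 1" and t: "0 < t" for \<alpha> t
    unfolding caputo_differentiable_def
  proof (intro conjI ballI)
    show "m differentiable at y" if "y \<in> {0<..<t}" for y
      using DERIV_m[of y] that by (auto simp: real_differentiable_def)
    have "set_integrable lborel {0<..<t} (\<lambda>y. (t - y) powr (- \<alpha>) * N.flux f y)"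
      by (rule fractional_integrable[OF \<alpha> e(1) less_imp_le[OF e(2)] N.flux_measurable[OF f_cont f_bound] C t])
    also have "?this \<longleftrightarrow> set_integrable lborel {0<..<t} (\<lambda>y. (t - y) powr (- \<alpha>) * deriv m y)"
      by (rule set_integrable_cong) (auto simp: deriv_m)
    finally show "set_integrable lborel {0<..<t} (\<lambda>y. (t - y) powr (- \<alpha>) * deriv m y)" .
  qed
  have caputo: "caputo_derivative \<alpha> m t = 1 / Gamma (1 - \<alpha>) * fun_convolution (\<lambda>s. s powr (- \<alpha>)) (N.flux f) t"
    for \<alpha> t
    unfolding caputo_derivative_def fun_convolution_def
    by (intro arg_cong2[where f = "(*)"] refl set_lebesgue_integral_cong) (auto simp: deriv_m)
  have equation: "c1 * caputo_derivative \<alpha>1 m t + c2 * caputo_derivative \<alpha>2 m t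
      = real k * (lam - mu) + real k * mu * empty_prob M X t" if t: "0 < t" for t
  proof -
    have "{\<omega> \<in> space M. X 0 \<omega> = (0, 0)} \<in> events" using X_event[of 0] by simp
    then have "prob {\<omega> \<in> space M. X 0 \<omega> = (0, 0)} = 1"
      using X0 by (subst prob_Collect_eq_1) auto
    moreover have "prob {\<omega> \<in> space M. X t \<omega> = (0, 0) \<and> X 0 \<omega> = (0, 0)} = prob {\<omega> \<in> space M. X t \<omega> = (0, 0)}"
    proof (rule prob_eq_AE)
      have [measurable]: "X t \<in> measurable M (count_space UNIV)" "X 0 \<in> measurable M (count_space UNIV)"
        using t by (auto intro: Xm)
      show "{\<omega> \<in> space M. X t \<omega> = (0, 0) \<and> X 0 \<omega> = (0, 0)} \<in> events"
        "{\<omega> \<in> space M. X t \<omega> = (0, 0)} \<in> events" by measurable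
    qed (use X0 in \<open>auto elim!: eventually_mono\<close>)
    ultimately have "empty_prob M X t = prob {\<omega> \<in> space M. X t \<omega> = (0, 0)}"
      by (simp add: empty_prob_def cond_prob_def)
    also have "\<dots> = N.expectation (\<lambda>\<omega>. pmf (p (N.Z t \<omega>)) (0, 0))"
      using t by (simp add: X_prob transfer[OF t pm])
    finally have ep: "empty_prob M X t = N.expectation (\<lambda>\<omega>. pmf (p (N.Z t \<omega>)) (0, 0))" .
    have pi: "integrable N (\<lambda>\<omega>. pmf (p (N.Z t \<omega>)) (0, 0))"
      using measurable_compose[OF Zm pm] by (intro N.integrable_const_bound[where B = 1]) (auto simp: pmf_le_1)
    have "c1 * caputo_derivative \<alpha>1 m t + c2 * caputo_derivative \<alpha>2 m t = N.expectation (\<lambda>\<omega>. f (N.Z t \<omega>))"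
      unfolding caputo by (rule N.fractional_equation[OF f_cont f_bound f'_cont f'_bound ff' t])
    also have "\<dots> = real k * (lam - mu) + real k * mu * N.expectation (\<lambda>\<omega>. pmf (p (N.Z t \<omega>)) (0, 0))"
      unfolding f_def using pi by (simp add: N.prob_space)
    finally show ?thesis by (simp only: ep)
  qed
  have \<alpha>2_less: "\<alpha>2 < 1" using assms by simp
  have "integrable M (\<lambda>\<omega>. real (queue_length k X t \<omega>))" if "0 \<le> t" for t
    unfolding queue_length_def using that int0 mean_X(1)[of t] by (cases "t = 0") auto
  then show ?thesis
    unfolding Let_def Y_def[symmetric] X_def[symmetric] m_def[symmetric]
    using caputo_diff[OF \<open>\<alpha>1 < 1\<close>] caputo_diff[OF \<alpha>2_less] equation m0 by blast
qed

end
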